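(* (ZF + DC + AD) For every $n\in\omega$, ${}^\omega2/E_0\mapsto({}^\omega2/E_0)^2_n$; that is, for every function $f:[{}^\omega2/E_0]^2_=\to n$ there is $Z\subseteq{}^\omega2/E_0$ in bijection with ${}^\omega2/E_0$ such that $|f[[Z]^2_=]|=1$.
   Context: $E_0$ on ${}^\omega2$: $x\,E_0\,y$ iff $(\exists n)(\forall k>n)(x(k)=y(k))$. For a set $X$, $[X]^2_=$ is the set of ordered pairs $(x_0,x_1)\in{}^2X$ with $x_0\neq x_1$. DC is the axiom of dependent choice, AD the axiom of determinacy. *)

theory Defs
  imports Main
begin

text \<open>
  HOL proves the axiom of choice, so AD is refutable for the sets and functions of HOL itself.
  The theory ZF + DC + AD is therefore treated through its models: first-order structures
  consisting of a type and a binary relation \<open>mem\<close> on it.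
  A sentence follows from ZF + DC + AD iff it holds in all such models (completeness theorem).

  Sets, functions, \<open>\<omega>\<close>, natural numbers, reals, strategies etc.\ below are elements of the model.
  DC, AD and the partition relation are the usual first-order sentences: all their quantifiers
  range over elements of the model. The models need not be well-founded or \<open>\<omega>\<close>-models, and
  power sets are those of the model.
\<close>

text \<open>Formulas of the language of set theory, with de Bruijn indices as variables.\<close>

datatype fm =
    FMem nat nat
  | FEq nat nat
  | FNeg fm
  | FConj fm fm
  | FAll fm

context
  fixes mem :: "'v \<Rightarrow> 'v \<Rightarrow> bool"
begin

text \<open>\<open>elts a = elts b\<close>, \<open>x \<in> elts a\<close>, etc.\ abbreviate first-order formulas.\<close>

definition elts :: "'v \<Rightarrow> 'v set" where
  "elts a = {x. mem x a}"

primrec sat :: "fm \<Rightarrow> (nat \<Rightarrow> 'v) \<Rightarrow> bool" where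
  "sat (FMem i j) e \<longleftrightarrow> mem (e i) (e j)"
| "sat (FEq i j) e \<longleftrightarrow> e i = e j"
| "sat (FNeg \<phi>) e \<longleftrightarrow> \<not> sat \<phi> e"
| "sat (FConj \<phi> \<psi>) e \<longleftrightarrow> sat \<phi> e \<and> sat \<psi> e"
| "sat (FAll \<phi>) e \<longleftrightarrow> (\<forall>x. sat \<phi> (case_nat x e))"


definition is_empty :: "'v \<Rightarrow> bool" where
  "is_empty z \<longleftrightarrow> elts z = {}"

definition is_succ :: "'v \<Rightarrow> 'v \<Rightarrow> bool" where
  "is_succ n m \<longleftrightarrow> elts m = insert n (elts n)"

definition is_inductive :: "'v \<Rightarrow> bool" where
  "is_inductive w \<longleftrightarrow>
     (\<exists>z \<in> elts w. is_empty z) \<and> (\<forall>n \<in> elts w. \<exists>m \<in> elts w. is_succ n m)"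

definition is_omega :: "'v \<Rightarrow> bool" where
  "is_omega w \<longleftrightarrow> is_inductive w \<and> (\<forall>v. is_inductive v \<longrightarrow> elts w \<subseteq> elts v)"

definition is_two :: "'v \<Rightarrow> bool" where
  "is_two t \<longleftrightarrow> (\<exists>z u. is_empty z \<and> is_succ z u \<and> is_succ u t)"

text \<open>The Kuratowski pair \<open>p = {{a}, {a, b}}\<close>.\<close>

definition is_pair :: "'v \<Rightarrow> 'v \<Rightarrow> 'v \<Rightarrow> bool" where
  "is_pair a b p \<longleftrightarrow> (\<exists>u v. elts u = {a} \<and> elts v = {a, b} \<and> elts p = {u, v})"

text \<open>\<open>(a, b) \<in> r\<close>; for a function \<open>r\<close> this says \<open>r(a) = b\<close>.\<close>

definition rel :: "'v \<Rightarrow> 'v \<Rightarrow> 'v \<Rightarrow> bool" where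
  "rel r a b \<longleftrightarrow> (\<exists>p \<in> elts r. is_pair a b p)"

definition is_fun :: "'v \<Rightarrow> 'v \<Rightarrow> 'v \<Rightarrow> bool" where
  "is_fun f A B \<longleftrightarrow>
     (\<forall>p \<in> elts f. \<exists>a \<in> elts A. \<exists>b \<in> elts B. is_pair a b p) \<and>
     (\<forall>a \<in> elts A. \<exists>!b. rel f a b)"

definition is_bij :: "'v \<Rightarrow> 'v \<Rightarrow> 'v \<Rightarrow> bool" where
  "is_bij f A B \<longleftrightarrow> is_fun f A B \<and> (\<forall>b \<in> elts B. \<exists>!a. rel f a b)"

definition is_restr :: "'v \<Rightarrow> 'v \<Rightarrow> 'v \<Rightarrow> bool" where
  "is_restr x n s \<longleftrightarrow> elts s = {p \<in> elts x. \<exists>a \<in> elts n. \<exists>b. is_pair a b p}"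

definition is_image :: "'v \<Rightarrow> 'v \<Rightarrow> 'v \<Rightarrow> bool" where
  "is_image f A I \<longleftrightarrow> elts I = {b. \<exists>a \<in> elts A. rel f a b}"


definition ZF :: bool where
  "ZF \<longleftrightarrow>
     \<comment> \<open>Extensionality\<close>
     (\<forall>x y. elts x = elts y \<longrightarrow> x = y) \<and>
     \<comment> \<open>Foundation\<close>
     (\<forall>x. elts x \<noteq> {} \<longrightarrow> (\<exists>y \<in> elts x. elts x \<inter> elts y = {})) \<and>
     \<comment> \<open>Pairing\<close>
     (\<forall>x y. \<exists>z. elts z = {x, y}) \<and>
     \<comment> \<open>Union\<close>
     (\<forall>x. \<exists>u. elts u = (\<Union>y \<in> elts x. elts y)) \<and>
     \<comment> \<open>Power set\<close>
     (\<forall>x. \<exists>y. elts y = {z. elts z \<subseteq> elts x}) \<and>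
     \<comment> \<open>Infinity\<close>
     (\<exists>w. is_inductive w) \<and>
     \<comment> \<open>Separation schema; the environment \<open>e\<close> supplies the parameters\<close>
     (\<forall>\<phi> e A. \<exists>B. elts B = {x \<in> elts A. sat \<phi> (case_nat x e)}) \<and>
     \<comment> \<open>Replacement schema\<close>
     (\<forall>\<phi> e A. (\<forall>x \<in> elts A. \<exists>!y. sat \<phi> (case_nat x (case_nat y e))) \<longrightarrow>
        (\<exists>B. \<forall>x \<in> elts A. \<exists>y \<in> elts B. sat \<phi> (case_nat x (case_nat y e))))"

definition DC :: bool where
  "DC \<longleftrightarrow>
     (\<forall>X R. elts X \<noteq> {} \<and> (\<forall>x \<in> elts X. \<exists>y \<in> elts X. rel R x y) \<longrightarrow>
        (\<exists>w g. is_omega w \<and> is_fun g w X \<and>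
           (\<forall>n \<in> elts w. \<exists>m a b. is_succ n m \<and> rel g n a \<and> rel g m b \<and> rel R a b)))"


text \<open>
  In the game with payoff set \<open>A\<close>, a subset of the Baire space, player I chooses \<open>x(n)\<close> for even
  \<open>n\<close>, player II for odd \<open>n\<close>, and I wins iff \<open>x \<in> A\<close>. A strategy maps finite sequences (positions)
  to moves.
\<close>

text \<open>The recursion below has exactly one solution \<open>S \<subseteq> \<omega>\<close>, the set of even numbers.\<close>

definition is_evens :: "'v \<Rightarrow> 'v \<Rightarrow> bool" where
  "is_evens w S \<longleftrightarrow> elts S \<subseteq> elts w \<and>
     (\<forall>z. is_empty z \<longrightarrow> z \<in> elts S) \<and>
     (\<forall>n \<in> elts w. \<forall>m. is_succ n m \<longrightarrow> (m \<in> elts S \<longleftrightarrow> n \<notin> elts S))"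

definition is_funspace :: "'v \<Rightarrow> 'v \<Rightarrow> 'v \<Rightarrow> bool" where
  "is_funspace A B F \<longleftrightarrow> elts F = {f. is_fun f A B}"

definition is_finseqs :: "'v \<Rightarrow> 'v \<Rightarrow> bool" where
  "is_finseqs w D \<longleftrightarrow> elts D = {s. \<exists>n \<in> elts w. is_fun s n w}"

text \<open>The run \<open>x\<close> satisfies \<open>x(n) = \<sigma>(x \<restriction> n)\<close> for all \<open>n \<in> T\<close>.\<close>

definition follows :: "'v set \<Rightarrow> 'v \<Rightarrow> 'v \<Rightarrow> bool" where
  "follows T \<sigma> x \<longleftrightarrow> (\<forall>n \<in> T. \<exists>s v. is_restr x n s \<and> rel \<sigma> s v \<and> rel x n v)"

definition AD :: bool where
  "AD \<longleftrightarrow>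
     (\<forall>w S D N A.
        is_omega w \<and> is_evens w S \<and> is_finseqs w D \<and> is_funspace w w N \<and> elts A \<subseteq> elts N \<longrightarrow>
          (\<exists>\<sigma>. is_fun \<sigma> D w \<and>
             (\<forall>x \<in> elts N. follows (elts S) \<sigma> x \<longrightarrow> x \<in> elts A)) \<or>
          (\<exists>\<tau>. is_fun \<tau> D w \<and>
             (\<forall>x \<in> elts N. follows (elts w - elts S) \<tau> x \<longrightarrow> x \<notin> elts A)))"


definition E0 :: "'v \<Rightarrow> 'v \<Rightarrow> 'v \<Rightarrow> bool" where
  "E0 w x y \<longleftrightarrow>
     (\<exists>n \<in> elts w. \<forall>k \<in> elts w. n \<in> elts k \<longrightarrow> (\<exists>v. rel x k v \<and> rel y k v))"

text \<open>\<open>Q\<close> is the set of \<open>E\<^sub>0\<close>-classes on \<open>2\<^sup>\<omega>\<close>.\<close>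

definition is_cantor_mod_E0 :: "'v \<Rightarrow> bool" where
  "is_cantor_mod_E0 Q \<longleftrightarrow>
     (\<exists>w t C. is_omega w \<and> is_two t \<and> is_funspace w t C \<and>
        elts Q = {c. \<exists>x \<in> elts C. elts c = {y \<in> elts C. E0 w x y}})"

text \<open>\<open>P = [X]\<^sup>2\<^sub>=\<close>\<close>

definition is_distinct_pairs :: "'v \<Rightarrow> 'v \<Rightarrow> bool" where
  "is_distinct_pairs X P \<longleftrightarrow>
     elts P = {p. \<exists>x0 \<in> elts X. \<exists>x1 \<in> elts X. x0 \<noteq> x1 \<and> is_pair x0 x1 p}"

text \<open>The partition relation \<open>X \<mapsto> (Y)\<^sup>2\<^sub>n\<close>.\<close>

definition partition_rel :: "'v \<Rightarrow> 'v \<Rightarrow> 'v \<Rightarrow> bool" where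
  "partition_rel X Y n \<longleftrightarrow>
     (\<forall>P f. is_distinct_pairs X P \<and> is_fun f P n \<longrightarrow>
        (\<exists>Z. elts Z \<subseteq> elts X \<and> (\<exists>g. is_bij g Z Y) \<and>
           (\<exists>PZ I c. is_distinct_pairs Z PZ \<and> is_image f PZ I \<and> elts I = {c})))"

end

end

theory Submission
  imports Defs
begin

text \<open>
  A colouring $f$ of pairs of $E_0$-classes by $n$ colours yields sets
  $B_k = \{(x, y) : x \mathrel{E_0} y \mbox{ or } f([x], [y]) < k\}$ for $k \le n$, which are invariant under
  $E_0 \times E_0$. By AD the Banach--Mazur game for $B_k$ is determined. A winning strategy for I
  (II) shows that $B_k$ (its complement) is comeager; the restriction to an open set
  which usually arises from the first move disappears by invariance. As $B_0$ and the complement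
  of $B_n$ are not comeager, for the least $k + 1$ such that I wins, the set
  $B_{k+1} \setminus B_k$ is comeager, i.e. $f([x], [y]) = k$ for comeagerly many pairs.

  A comeager set of pairs contains all $(p(x), p(y))$ with $x, y$ inequivalent for a suitable reduction
  $p$ of $E_0$ to itself: $p(x)$ is a concatenation of blocks, the $j$th being one
  of two fixed words $u_j, v_j$ of the same length according to $x(j)$. The words are extended in
  finitely many steps until every pair of points in which one has the $j$th block $u_j$
  and the other $v_j$ has been forced into the $j$th dense open set. The classes of all $p(x)$ form the
  required homogeneous set.

  All objects live in the model, so every appeal to separation, induction or recursion needs the
  predicate at hand to be first-order definable in the model.
\<close>

section \<open>Definability with parameters in a model of ZF\<close>

text \<open>The core of the game argument is a canonical play. A pair (x, y) itself determines at
  most one play of each length against the given strategy, in which the opponent always takes the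
  least suitable move. For each i, the pairs whose play reaches length i form a dense open set, and
  a pair in all of these sets has a definable infinite play. Its outcome can differ from (x, y) only
  at positions below the opening move of the strategy, and invariance under E0 absorbs this.

  A move is a natural number and has to carry two binary words. These are read off a binary counter:
  its state at time e, cut off at e, supplies both words. The same codes supply the words of the
  blocks in the reduction.

  As omega of the model may be nonstandard, "finite" means bounded by an element of it, and a
  comeager set is witnessed by one definable relation that treats all its dense open sets at
  once.\<close>

primrec ren :: "fm \<Rightarrow> (nat \<Rightarrow> nat) \<Rightarrow> fm" where
  "ren (FMem i j) f = FMem (f i) (f j)"
| "ren (FEq i j) f = FEq (f i) (f j)"
| "ren (FNeg \<phi>) f = FNeg (ren \<phi> f)"
| "ren (FConj \<phi> \<psi>) f = FConj (ren \<phi> f) (ren \<psi> f)"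
| "ren (FAll \<phi>) f = FAll (ren \<phi> (case_nat 0 (\<lambda>i. Suc (f i))))"

lemma sat_ren: "sat mem (ren \<phi> f) e \<longleftrightarrow> sat mem \<phi> (\<lambda>i. e (f i))"
proof (induction \<phi> arbitrary: f e)
  case (FAll \<phi>)
  have "(\<lambda>i. case_nat x e (case_nat 0 (\<lambda>i. Suc (f i)) i)) = case_nat x (\<lambda>i. e (f i))" for x
    by (auto split: nat.split)
  then show ?case by (simp add: FAll)
qed simp_all

locale zf_model =
  fixes mem :: "'v \<Rightarrow> 'v \<Rightarrow> bool"
  assumes ZF: "ZF mem"
begin

abbreviation El :: "'v \<Rightarrow> 'v set" where "El \<equiv> elts mem"

text \<open>Each variable of the formula stands for an entry of the environment or for a parameter.\<close>

definition dfn :: "((nat \<Rightarrow> 'v) \<Rightarrow> bool) \<Rightarrow> bool" where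
  "dfn P \<longleftrightarrow> (\<exists>\<phi> s. (\<forall>i::nat. (\<exists>j. s i = (\<lambda>e. e j)) \<or> (\<exists>a. s i = (\<lambda>e. a))) \<and>
     (\<forall>e. P e \<longleftrightarrow> sat mem \<phi> (\<lambda>i. s i e)))"

definition tdef :: "((nat \<Rightarrow> 'v) \<Rightarrow> 'v) \<Rightarrow> bool" where
  "tdef t \<longleftrightarrow> dfn (\<lambda>e. e 0 = t (\<lambda>i. e (Suc i)))"

text \<open>The rules follow the syntax of formulas. A bound variable appears as entry 0 of the
  environment and the outer entries are shifted by one, so \<open>intro dfn_intros\<close> checks a
  predicate that is spelled out.\<close>

named_theorems dfn_intros

lemma dfn_not [dfn_intros]: "dfn P \<Longrightarrow> dfn (\<lambda>e. \<not> P e)"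
proof -
  assume "dfn P"
  then obtain \<phi> s where "\<forall>i::nat. (\<exists>j. s i = (\<lambda>e. e j)) \<or> (\<exists>a. s i = (\<lambda>e. a))"
    "\<forall>e. P e \<longleftrightarrow> sat mem \<phi> (\<lambda>i. s i e)"
    unfolding dfn_def by blast
  then show ?thesis
    unfolding dfn_def by (intro exI[of _ "FNeg \<phi>"] exI[of _ s]) auto
qed

text \<open>The two formulas may use the same variable for different entries or parameters.
  Interleaving gives the even variables to one and the odd variables to the other.\<close>

lemma dfn_conj [dfn_intros]:
  assumes "dfn P" "dfn Q"
  shows "dfn (\<lambda>e. P e \<and> Q e)"
proof -
  obtain \<phi> s where 1: "\<forall>i::nat. (\<exists>j. s i = (\<lambda>e. e j)) \<or> (\<exists>a. s i = (\<lambda>e. a))"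
    "\<forall>e. P e \<longleftrightarrow> sat mem \<phi> (\<lambda>i. s i e)"
    using assms(1) unfolding dfn_def by blast
  obtain \<psi> t where 2: "\<forall>i::nat. (\<exists>j. t i = (\<lambda>e. e j)) \<or> (\<exists>a. t i = (\<lambda>e. a))"
    "\<forall>e. Q e \<longleftrightarrow> sat mem \<psi> (\<lambda>i. t i e)"
    using assms(2) unfolding dfn_def by blast
  show ?thesis unfolding dfn_def
    by (intro exI[of _ "FConj (ren \<phi> (\<lambda>i. 2 * i)) (ren \<psi> (\<lambda>i. 2 * i + 1))"]
        exI[of _ "\<lambda>i. if even i then s (i div 2) else t (i div 2)"])
      (use 1 2 in \<open>auto simp: sat_ren\<close>)
qed

text \<open>A quantifier binds variable 0 only, whereas many slots of \<open>s\<close> may read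
  entry 0. All of these are renamed to variable 0; the others move up by one and read the
  tail.\<close>

lemma dfn_shift:
  assumes "dfn P"
  obtains \<phi> s where "\<forall>i::nat. (\<exists>j. s i = (\<lambda>e. e j)) \<or> (\<exists>a. s i = (\<lambda>e. a))"
    "\<And>x e. P (case_nat x e) \<longleftrightarrow> sat mem \<phi> (case_nat x (\<lambda>i. s i e))"
proof -
  obtain \<phi> s where 1: "\<And>i::nat. (\<exists>j. s i = (\<lambda>e. e j)) \<or> (\<exists>a. s i = (\<lambda>e. a))"
    "\<And>e. P e \<longleftrightarrow> sat mem \<phi> (\<lambda>i. s i e)"
    using assms(1) unfolding dfn_def by blast
  define f where "f i = (if s i = (\<lambda>e. e 0) then 0 else Suc i)" for i
  \<comment> \<open>The slots that read entry 0 are renamed by \<open>f\<close>, so the value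
    \<open>undefined\<close> they receive here is never consulted.\<close>
  define t where "t i e = s i (case_nat undefined e)" for i e
  have t: "(\<exists>j. t i = (\<lambda>e. e j)) \<or> (\<exists>a. t i = (\<lambda>e. a))" for i
  proof -
    consider j where "s i = (\<lambda>e. e (Suc j))" | "s i = (\<lambda>e. e 0)" | a where "s i = (\<lambda>e. a)"
      using 1(1)[of i] by (metis not0_implies_Suc)
    then show ?thesis unfolding t_def by cases auto
  qed
  have "case_nat x (\<lambda>i. t i e) (f i) = s i (case_nat x e)" for x e i
  proof -
    consider j where "s i = (\<lambda>e. e (Suc j))" "f i = Suc i" | "s i = (\<lambda>e. e 0)" "f i = 0"
      | a where "s i = (\<lambda>e. a)" "f i = Suc i"
      using 1(1)[of i] unfolding f_def by (metis not0_implies_Suc)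
    then show ?thesis unfolding t_def by cases auto
  qed
  then show thesis
    using 1(2) by (intro that[of t "ren \<phi> f"]) (simp_all add: t sat_ren)
qed

lemma dfn_all [dfn_intros]:
  assumes "dfn (\<lambda>e. P (e 0) (\<lambda>i. e (Suc i)))"
  shows "dfn (\<lambda>e. \<forall>x. P x e)"
proof -
  obtain \<phi> s where "\<forall>i::nat. (\<exists>j. s i = (\<lambda>e. e j)) \<or> (\<exists>a. s i = (\<lambda>e. a))"
    "\<And>x e. P x e \<longleftrightarrow> sat mem \<phi> (case_nat x (\<lambda>i. s i e))"
    by (rule dfn_shift[OF assms]) simp
  then show ?thesis unfolding dfn_def by (intro exI[of _ "FAll \<phi>"] exI[of _ s]) auto
qed

lemma dfn_weaken: "dfn P \<Longrightarrow> dfn (\<lambda>e. P (\<lambda>i. e (f i)))"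
proof -
  assume "dfn P"
  then obtain \<phi> s where 1: "\<And>i::nat. (\<exists>j. s i = (\<lambda>e. e j)) \<or> (\<exists>a. s i = (\<lambda>e. a))"
    "\<forall>e. P e \<longleftrightarrow> sat mem \<phi> (\<lambda>i. s i e)"
    unfolding dfn_def by blast
  have "(\<exists>j. (\<lambda>e. s i (\<lambda>i. e (f i))) = (\<lambda>e. e j)) \<or> (\<exists>a. (\<lambda>e. s i (\<lambda>i. e (f i))) = (\<lambda>e. a))" for i
    using 1(1)[of i] by auto
  then show ?thesis
    unfolding dfn_def using 1(2) by (intro exI[of _ \<phi>] exI[of _ "\<lambda>i e. s i (\<lambda>i. e (f i))"]) auto
qed

lemma dfn_var_eq: "dfn (\<lambda>e. e i = e j)"
  unfolding dfn_def by (intro exI[of _ "FEq i j"] exI[of _ "\<lambda>i e. e i"]) auto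

lemma dfn_var_mem: "dfn (\<lambda>e. mem (e i) (e j))"
  unfolding dfn_def by (intro exI[of _ "FMem i j"] exI[of _ "\<lambda>i e. e i"]) auto

lemma dfn_disj [dfn_intros]: "dfn P \<Longrightarrow> dfn Q \<Longrightarrow> dfn (\<lambda>e. P e \<or> Q e)"
  using dfn_not[OF dfn_conj[OF dfn_not[of P] dfn_not[of Q]]] by simp

lemma dfn_imp [dfn_intros]: "dfn P \<Longrightarrow> dfn Q \<Longrightarrow> dfn (\<lambda>e. P e \<longrightarrow> Q e)"
  using dfn_not[OF dfn_conj[of P "\<lambda>e. \<not> Q e"]] dfn_not[of Q] by simp

lemma dfn_iff [dfn_intros]: "dfn P \<Longrightarrow> dfn Q \<Longrightarrow> dfn (\<lambda>e. P e \<longleftrightarrow> Q e)"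
  using dfn_conj[OF dfn_imp[of P Q] dfn_imp[of Q P]] by (simp add: iff_conv_conj_imp)

lemma dfn_ex [dfn_intros]:
  assumes "dfn (\<lambda>e. P (e 0) (\<lambda>i. e (Suc i)))"
  shows "dfn (\<lambda>e. \<exists>x. P x e)"
  using dfn_not[OF dfn_all[of "\<lambda>x e. \<not> P x e"]] dfn_not[OF assms] by simp

lemma tdef_var [dfn_intros]: "tdef (\<lambda>e. e i)"
  unfolding tdef_def by (rule dfn_var_eq)

lemma tdef_const [dfn_intros]: "tdef (\<lambda>e. a)"
  unfolding tdef_def dfn_def
  by (intro exI[of _ "FEq 0 1"] exI[of _ "\<lambda>i. if i = 0 then (\<lambda>e. e 0) else (\<lambda>e. a)"]) auto

lemma tdef_weaken: "tdef t \<Longrightarrow> tdef (\<lambda>e. t (\<lambda>i. e (f i)))"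
  unfolding tdef_def using dfn_weaken[of _ "case_nat 0 (\<lambda>i. Suc (f i))"] by fastforce

lemma dfn_subst_var:
  assumes P: "dfn (\<lambda>e. P (e 0) (\<lambda>i. e (Suc i)))" and t: "tdef t"
  shows "dfn (\<lambda>e. P (t e) e)"
proof -
  have "dfn (\<lambda>e. \<exists>x. x = t e \<and> P x e)"
    by (intro dfn_ex dfn_conj P) (use t in \<open>simp add: tdef_def\<close>)
  then show ?thesis by simp
qed

lemma dfn_eq [dfn_intros]:
  assumes "tdef s" "tdef t"
  shows "dfn (\<lambda>e. s e = t e)"
  by (rule dfn_subst_var[of "\<lambda>x e. x = t e"]) (use assms in \<open>auto simp: tdef_def\<close>)

lemma dfn_mem [dfn_intros]:
  assumes "tdef s" "tdef t"
  shows "dfn (\<lambda>e. mem (s e) (t e))"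
  by (intro dfn_subst_var[of "\<lambda>x e. mem x (t e)", OF _ assms(1)]
      dfn_subst_var[of "\<lambda>y e. mem (e 0) y", OF _ tdef_weaken[OF assms(2)]] dfn_var_mem)

text \<open>Induction on the formula; under a quantifier the new variable stays in place and the
  terms are read in the shifted environment.\<close>

lemma dfn_sat:
  assumes "\<And>i. tdef (s i)"
  shows "dfn (\<lambda>e. sat mem \<phi> (\<lambda>i. s i e))"
  using assms
proof (induction \<phi> arbitrary: s)
  case (FAll \<phi>)
  have "tdef (case_nat (\<lambda>e. e 0) (\<lambda>i e. s i (\<lambda>i. e (Suc i))) i)" for i
    using tdef_weaken[OF FAll.prems] tdef_var by (cases i) simp_all
  from FAll.IH[OF this]
  have *: "dfn (\<lambda>e. sat mem \<phi> (\<lambda>i. case_nat (\<lambda>e. e 0) (\<lambda>i e. s i (\<lambda>i. e (Suc i))) i e))" .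
  have "(\<lambda>i. case_nat (\<lambda>e. e 0) (\<lambda>i e. s i (\<lambda>i. e (Suc i))) i e)
      = case_nat (e 0) (\<lambda>i. s i (\<lambda>i. e (Suc i)))" for e
    by (auto split: nat.split)
  with * have "dfn (\<lambda>e. sat mem \<phi> (case_nat (e 0) (\<lambda>i. s i (\<lambda>i. e (Suc i)))))" by simp
  from dfn_all[of "\<lambda>x e. sat mem \<phi> (case_nat x (\<lambda>i. s i e))", OF this] show ?case by simp
qed (simp_all add: dfn_mem dfn_eq dfn_not dfn_conj)

lemma dfn_subst:
  assumes "dfn P" and s: "\<And>i. tdef (s i)"
  shows "dfn (\<lambda>e. P (\<lambda>i. s i e))"
proof -
  obtain \<phi> r where 1: "\<And>i::nat. (\<exists>j. r i = (\<lambda>e. e j)) \<or> (\<exists>a. r i = (\<lambda>e. a))"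
    "\<And>e. P e \<longleftrightarrow> sat mem \<phi> (\<lambda>i. r i e)"
    using assms(1) unfolding dfn_def by blast
  have "tdef (\<lambda>e. r i (\<lambda>i. s i e))" for i
    using 1(1)[of i] by (auto intro: s dfn_intros)
  then show ?thesis unfolding 1(2) by (rule dfn_sat)
qed

text \<open>Definability of a notion is checked once with variables as arguments and then
  transferred to arbitrary definable arguments. This is how the rules for defined notions are proved
  below.\<close>

lemma dfn_subst2:
  assumes "dfn (\<lambda>e. P (e 0) (e (Suc 0)))" "tdef a" "tdef b"
  shows "dfn (\<lambda>e. P (a e) (b e))"
  using dfn_subst[OF assms(1), of "case_nat a (\<lambda>_. b)"] assms(2-) by (simp split: nat.split)

lemma dfn_subst3:
  assumes "dfn (\<lambda>e. P (e 0) (e (Suc 0)) (e (Suc (Suc 0))))" "tdef a" "tdef b" "tdef c"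
  shows "dfn (\<lambda>e. P (a e) (b e) (c e))"
  using dfn_subst[OF assms(1), of "case_nat a (case_nat b (\<lambda>_. c))"] assms(2-)
  by (simp split: nat.split)

lemma dfn_subst4:
  assumes "dfn (\<lambda>e. P (e 0) (e (Suc 0)) (e (Suc (Suc 0))) (e (Suc (Suc (Suc 0)))))"
    "tdef a" "tdef b" "tdef c" "tdef d"
  shows "dfn (\<lambda>e. P (a e) (b e) (c e) (d e))"
  using dfn_subst[OF assms(1), of "case_nat a (case_nat b (case_nat c (\<lambda>_. d)))"] assms(2-)
  by (simp split: nat.split)

lemma tdef_subst1:
  assumes "tdef (\<lambda>e. F (e 0))" "tdef a"
  shows "tdef (\<lambda>e. F (a e))"
  using dfn_subst2[of "\<lambda>y x. y = F x", OF _ tdef_var[of 0] tdef_weaken[OF assms(2)], of Suc] assms(1)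
  by (simp add: tdef_def)

lemma tdef_subst2:
  assumes "tdef (\<lambda>e. F (e 0) (e (Suc 0)))" "tdef a" "tdef b"
  shows "tdef (\<lambda>e. F (a e) (b e))"
  using dfn_subst3[of "\<lambda>y x z. y = F x z", OF _ tdef_var[of 0] tdef_weaken[OF assms(2)] tdef_weaken[OF assms(3)], of Suc Suc] assms(1)
  by (simp add: tdef_def)

lemma dfn_elts [dfn_intros]: "tdef s \<Longrightarrow> tdef t \<Longrightarrow> dfn (\<lambda>e. s e \<in> El (t e))"
  by (simp add: elts_def dfn_mem)

lemma dfn_ball [dfn_intros]:
  assumes "tdef t" "dfn (\<lambda>e. P (e 0) (\<lambda>i. e (Suc i)))"
  shows "dfn (\<lambda>e. \<forall>x\<in>El (t e). P x e)"
  unfolding Ball_def by (intro dfn_intros assms tdef_weaken[OF assms(1)])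

lemma dfn_bex [dfn_intros]:
  assumes "tdef t" "dfn (\<lambda>e. P (e 0) (\<lambda>i. e (Suc i)))"
  shows "dfn (\<lambda>e. \<exists>x\<in>El (t e). P x e)"
  unfolding Bex_def by (intro dfn_intros assms tdef_weaken[OF assms(1)])

lemma dfn_subset [dfn_intros]:
  assumes "tdef s" "tdef t"
  shows "dfn (\<lambda>e. El (s e) \<subseteq> El (t e))"
  unfolding subset_eq by (intro dfn_intros assms[THEN tdef_weaken])

lemma dfn_Collect [dfn_intros]:
  assumes "tdef s" "dfn (\<lambda>e. P (e 0) (\<lambda>i. e (Suc i)))"
  shows "dfn (\<lambda>e. El (s e) = {x. P x e})"
  unfolding set_eq_iff mem_Collect_eq by (intro dfn_intros assms tdef_weaken[OF assms(1)])

lemma dfn_ex1 [dfn_intros]: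
  assumes "dfn (\<lambda>e. P (e 0) (\<lambda>i. e (Suc i)))"
  shows "dfn (\<lambda>e. \<exists>!x. P x e)"
proof -
  have "dfn (\<lambda>e. P (e 0) (\<lambda>i. e (Suc (Suc i))))"
    using dfn_weaken[OF assms, of "case_nat 0 (\<lambda>i. Suc (Suc i))"] by simp
  then show ?thesis unfolding Ex1_def by (intro dfn_intros assms)
qed

text \<open>Unlike \<open>THE\<close>, this has a fixed value if there is no unique witness, which keeps it definable.\<close>

definition the1 :: "('v \<Rightarrow> bool) \<Rightarrow> 'v" where
  "the1 P = (if \<exists>!y. P y then THE y. P y else undefined)"

lemma the1_eq: "P a \<Longrightarrow> (\<And>y. P y \<Longrightarrow> y = a) \<Longrightarrow> the1 P = a"
  unfolding the1_def by (rule if_P[THEN trans, OF _ the_equality]) blast+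

lemma tdef_if [dfn_intros]:
  assumes "dfn P" "tdef s" "tdef t"
  shows "tdef (\<lambda>e. if P e then s e else t e)"
proof -
  have "dfn (\<lambda>e. P (\<lambda>i. e (Suc i)) \<and> e 0 = s (\<lambda>i. e (Suc i)) \<or> \<not> P (\<lambda>i. e (Suc i)) \<and> e 0 = t (\<lambda>i. e (Suc i)))"
    by (intro dfn_intros assms(2,3)[THEN tdef_weaken] assms(1)[THEN dfn_weaken])
  then show ?thesis unfolding tdef_def by (rule back_subst[of dfn]) auto
qed

lemma tdef_the1 [dfn_intros]:
  assumes "dfn (\<lambda>e. P (e 0) (\<lambda>i. e (Suc i)))"
  shows "tdef (\<lambda>e. the1 (\<lambda>y. P y e))"
proof -
  have ex1: "dfn (\<lambda>e. \<exists>!y. P y (\<lambda>i. e (Suc i)))"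
    using dfn_weaken[OF dfn_ex1[OF assms]] .
  have "dfn (\<lambda>e. (\<exists>!y. P y (\<lambda>i. e (Suc i))) \<and> P (e 0) (\<lambda>i. e (Suc i)) \<or>
      \<not> (\<exists>!y. P y (\<lambda>i. e (Suc i))) \<and> e 0 = undefined)"
    by (intro dfn_intros ex1 assms)
  moreover have "z = the1 Q \<longleftrightarrow> (\<exists>!y. Q y) \<and> Q z \<or> \<not> (\<exists>!y. Q y) \<and> z = undefined" for z Q
    unfolding the1_def using theI'[of Q] by auto
  ultimately show ?thesis unfolding tdef_def by simp
qed

text \<open>Elements of the model that occur in \<open>P\<close> are admissible, since the constant
  slots in \<open>dfn\<close> act as parameters. As \<open>P\<close> looks at entry 0 only, the
  remaining environment can be arbitrary.\<close>

lemma separation: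
  assumes "dfn (\<lambda>e. P (e 0))"
  obtains B where "El B = {x \<in> El A. P x}"
proof -
  show thesis
  proof (rule dfn_shift[OF assms])
    fix \<phi> s
    assume "\<And>x e. P (case_nat x e 0) \<longleftrightarrow> sat mem \<phi> (case_nat x (\<lambda>i. s i e))"
    then have "{x \<in> El A. P x} = {x \<in> El A. sat mem \<phi> (case_nat x (\<lambda>i. s i undefined))}" by simp
    moreover have "\<exists>B. El B = {x \<in> El A. sat mem \<phi> (case_nat x (\<lambda>i. s i undefined))}"
      using ZF unfolding ZF_def by blast
    ultimately show thesis using that by metis
  qed
qed

section \<open>Sets, pairs and functions from the axioms\<close>

lemma ext: "El x = El y \<Longrightarrow> x = y"
  using ZF unfolding ZF_def by blast

lemma foundation: "El x \<noteq> {} \<Longrightarrow> \<exists>y\<in>El x. El x \<inter> El y = {}"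
  using ZF unfolding ZF_def by blast

lemma pairing: obtains z where "El z = {x, y}"
proof -
  have "\<forall>x y. \<exists>z. El z = {x, y}" using ZF unfolding ZF_def by blast
  then show thesis using that by blast
qed

lemma union: obtains u where "El u = (\<Union>y\<in>El x. El y)"
proof -
  have "\<forall>x. \<exists>u. El u = (\<Union>y\<in>El x. El y)" using ZF unfolding ZF_def by blast
  then show thesis using that by blast
qed

lemma power: obtains y where "El y = {z. El z \<subseteq> El x}"
proof -
  have "\<forall>x. \<exists>y. El y = {z. El z \<subseteq> El x}" using ZF unfolding ZF_def by blast
  then show thesis using that by blast
qed

lemma union2: obtains u where "El u = El x \<union> El y"
proof -
  obtain z where "El z = {x, y}" by (rule pairing)
  moreover obtain u where "El u = (\<Union>y\<in>El z. El y)" by (rule union)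
  ultimately show thesis using that by auto
qed

lemma is_pair_iff:
  "is_pair mem a b p \<longleftrightarrow> (\<exists>u v. (\<forall>x. x \<in> El u \<longleftrightarrow> x = a) \<and>
     (\<forall>x. x \<in> El v \<longleftrightarrow> x = a \<or> x = b) \<and> (\<forall>x. x \<in> El p \<longleftrightarrow> x = u \<or> x = v))"
  unfolding is_pair_def set_eq_iff by simp

lemma dfn_is_pair [dfn_intros]:
  assumes "tdef a" "tdef b" "tdef p"
  shows "dfn (\<lambda>e. is_pair mem (a e) (b e) (p e))"
  by (rule dfn_subst3[OF _ assms], unfold is_pair_iff, intro dfn_intros)

definition pair :: "'v \<Rightarrow> 'v \<Rightarrow> 'v" where
  "pair a b = the1 (\<lambda>p. is_pair mem a b p)"

text \<open>Replaces the relational notion of pair by a term; existence comes from pairing,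
  uniqueness from extensionality.\<close>

lemma is_pair_pair: "is_pair mem a b p \<longleftrightarrow> p = pair a b"
proof -
  have uniq: "p = q" if "is_pair mem a b p" "is_pair mem a b q" for p q
    using that unfolding is_pair_def by (metis ext)
  obtain u where u: "El u = {a, a}" by (rule pairing)
  obtain v where v: "El v = {a, b}" by (rule pairing)
  obtain q where "El q = {u, v}" by (rule pairing)
  with u v have q: "is_pair mem a b q" unfolding is_pair_def by auto
  then have "pair a b = q" unfolding pair_def by (rule the1_eq) (use q uniq in blast)
  with q uniq show ?thesis by blast
qed

lemma tdef_pair [dfn_intros]: "tdef a \<Longrightarrow> tdef b \<Longrightarrow> tdef (\<lambda>e. pair (a e) (b e))"
  by (rule tdef_subst2, unfold pair_def, intro dfn_intros)

lemma pair_inject [simp]: "pair a b = pair c d \<longleftrightarrow> a = c \<and> b = d"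
proof
  assume eq: "pair a b = pair c d"
  have *: "is_pair mem a b (pair a b)" "is_pair mem c d (pair a b)"
    using eq by (simp_all add: is_pair_pair)
  obtain u v where 1: "El u = {a}" "El v = {a, b}" "El (pair a b) = {u, v}"
    using *(1) unfolding is_pair_def by blast
  obtain u' v' where 2: "El u' = {c}" "El v' = {c, d}" "El (pair a b) = {u', v'}"
    using *(2) unfolding is_pair_def by blast
  have "{u, v} = {u', v'}" using 1 2 by simp
  then have "u = u' \<and> v = v' \<or> u = v' \<and> v = u'" by (auto simp: doubleton_eq_iff)
  then have "{a} = {c} \<and> {a, b} = {c, d} \<or> {a} = {c, d} \<and> {a, b} = {c}" using 1 2 by metis
  then show "a = c \<and> b = d" by (auto simp: doubleton_eq_iff)
qed simp

lemma rel_iff: "rel mem r a b \<longleftrightarrow> pair a b \<in> El r"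
  unfolding rel_def is_pair_pair by blast

lemma dfn_rel [dfn_intros]:
  assumes "tdef r" "tdef a" "tdef b"
  shows "dfn (\<lambda>e. rel mem (r e) (a e) (b e))"
  unfolding rel_iff by (intro dfn_intros assms)

lemma product: obtains p where "El p = {pair a b | a b. a \<in> El A \<and> b \<in> El B}"
proof -
  \<comment> \<open>A Kuratowski pair is a set of subsets of this union, hence an element of its
    double power set.\<close>
  obtain u where u: "El u = El A \<union> El B" by (rule union2)
  obtain v where v: "El v = {z. El z \<subseteq> El u}" by (rule power)
  obtain x where x: "El x = {z. El z \<subseteq> El v}" by (rule power)
  have "dfn (\<lambda>e. \<exists>a\<in>El A. \<exists>b\<in>El B. e 0 = pair a b)" by (intro dfn_intros)
  then obtain p where p: "El p = {z \<in> El x. \<exists>a\<in>El A. \<exists>b\<in>El B. z = pair a b}"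
    by (rule separation[where P = "\<lambda>z. \<exists>a\<in>El A. \<exists>b\<in>El B. z = pair a b"])
  have "pair a b \<in> El x" if "a \<in> El A" "b \<in> El B" for a b
  proof -
    have "is_pair mem a b (pair a b)" by (simp add: is_pair_pair)
    then obtain c d where "El c = {a}" "El d = {a, b}" "El (pair a b) = {c, d}"
      unfolding is_pair_def by blast
    with that show ?thesis by (auto simp: x v u)
  qed
  then have "El p = {pair a b | a b. a \<in> El A \<and> b \<in> El B}" unfolding p by auto
  then show thesis by (rule that)
qed

definition app :: "'v \<Rightarrow> 'v \<Rightarrow> 'v" (infixl "\<cdot>" 90) where
  "f \<cdot> a = the1 (\<lambda>b. rel mem f a b)"

lemma tdef_app [dfn_intros]: "tdef f \<Longrightarrow> tdef a \<Longrightarrow> tdef (\<lambda>e. f e \<cdot> a e)"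
  by (rule tdef_subst2, unfold app_def, intro dfn_intros)

abbreviation fn :: "'v \<Rightarrow> 'v \<Rightarrow> 'v \<Rightarrow> bool" where "fn \<equiv> is_fun mem"

lemma fn_iff: "fn f A B \<longleftrightarrow> (\<forall>p\<in>El f. \<exists>a\<in>El A. \<exists>b\<in>El B. p = pair a b) \<and> (\<forall>a\<in>El A. \<exists>!b. rel mem f a b)"
  unfolding is_fun_def is_pair_pair ..

lemma dfn_fn [dfn_intros]:
  assumes "tdef f" "tdef a" "tdef b"
  shows "dfn (\<lambda>e. fn (f e) (a e) (b e))"
  by (rule dfn_subst3[OF _ assms], unfold fn_iff, intro dfn_intros)

lemma fn_rel: "fn f A B \<Longrightarrow> rel mem f a b \<longleftrightarrow> a \<in> El A \<and> b = f \<cdot> a"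
proof -
  assume f: "fn f A B"
  have "a \<in> El A" if "rel mem f a b" for a b
    using f that unfolding fn_iff rel_iff by fastforce
  moreover have "b = f \<cdot> a" if "rel mem f a b" "a \<in> El A" for b
    using f that unfolding fn_iff app_def by (metis the1_eq)
  moreover have "rel mem f a (f \<cdot> a)" if "a \<in> El A"
    using f that unfolding fn_iff app_def by (metis the1_eq)
  ultimately show ?thesis by blast
qed

lemma fn_app: "fn f A B \<Longrightarrow> a \<in> El A \<Longrightarrow> f \<cdot> a \<in> El B"
  using fn_rel[of f A B a "f \<cdot> a"] unfolding fn_iff rel_iff by fastforce

lemma fn_El: "fn f A B \<Longrightarrow> El f = {pair a (f \<cdot> a) | a. a \<in> El A}"
proof -
  assume f: "fn f A B"
  show ?thesis
  proof
    show "El f \<subseteq> {pair a (f \<cdot> a) | a. a \<in> El A}"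
      using f fn_rel[OF f] unfolding fn_iff rel_iff by fastforce
    show "{pair a (f \<cdot> a) | a. a \<in> El A} \<subseteq> El f"
      using fn_rel[OF f] unfolding rel_iff by auto
  qed
qed

lemma fn_ext:
  assumes "fn f A B" "fn g A B'" "\<And>a. a \<in> El A \<Longrightarrow> f \<cdot> a = g \<cdot> a"
  shows "f = g"
  using fn_El[OF assms(1)] fn_El[OF assms(2)] assms(3) by (intro ext) auto

lemma fnI:
  assumes "El f = {pair a (t a) | a. a \<in> El A}" "\<And>a. a \<in> El A \<Longrightarrow> t a \<in> El B"
  shows "fn f A B" "\<And>a. a \<in> El A \<Longrightarrow> f \<cdot> a = t a"
proof -
  show f: "fn f A B" using assms unfolding fn_iff rel_iff by auto
  show "f \<cdot> a = t a" if "a \<in> El A" for a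
    using fn_rel[OF f, of a "t a"] assms that unfolding rel_iff by auto
qed

text \<open>The codomain is known in advance, so the graph can be separated from a product.\<close>

lemma lambda_ex:
  assumes t: "tdef (\<lambda>e. t (e 0))" and B: "\<And>a. a \<in> El A \<Longrightarrow> t a \<in> El B"
  obtains f where "fn f A B" "\<And>a. a \<in> El A \<Longrightarrow> f \<cdot> a = t a"
proof -
  obtain p where p: "El p = {pair a b | a b. a \<in> El A \<and> b \<in> El B}" by (rule product)
  have "dfn (\<lambda>e. \<exists>a\<in>El A. e 0 = pair a (t a))"
    by (intro dfn_intros tdef_subst1[of t, OF t])
  then obtain f where f: "El f = {q \<in> El p. \<exists>a\<in>El A. q = pair a (t a)}"
    by (rule separation[where P = "\<lambda>q. \<exists>a\<in>El A. q = pair a (t a)"])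
  have "El f = {pair a (t a) | a. a \<in> El A}" unfolding f p using B by auto
  from fnI[OF this B] show thesis using that by blast
qed

lemma funspace: obtains F where "is_funspace mem A B F"
proof -
  obtain p where p: "El p = {pair a b | a b. a \<in> El A \<and> b \<in> El B}" by (rule product)
  obtain q where q: "El q = {z. El z \<subseteq> El p}" by (rule power)
  have "dfn (\<lambda>e. fn (e 0) A B)" by (intro dfn_intros)
  then obtain F where F: "El F = {f \<in> El q. fn f A B}" by (rule separation)
  have "El f \<subseteq> El p" if "fn f A B" for f
    using that unfolding fn_iff p by blast
  then have "El F = {f. fn f A B}" unfolding F q by auto
  then show thesis by (intro that) (simp add: is_funspace_def)
qed

definition pfst :: "'v \<Rightarrow> 'v" where "pfst p = the1 (\<lambda>a. \<exists>b. p = pair a b)"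
definition psnd :: "'v \<Rightarrow> 'v" where "psnd p = the1 (\<lambda>b. \<exists>a. p = pair a b)"

lemma pfst_pair [simp]: "pfst (pair a b) = a" and psnd_pair [simp]: "psnd (pair a b) = b"
  unfolding pfst_def psnd_def by (rule the1_eq; auto)+

lemma tdef_pfst [dfn_intros]: "tdef a \<Longrightarrow> tdef (\<lambda>e. pfst (a e))"
  by (rule tdef_subst1, unfold pfst_def, intro dfn_intros)

lemma tdef_psnd [dfn_intros]: "tdef a \<Longrightarrow> tdef (\<lambda>e. psnd (a e))"
  by (rule tdef_subst1, unfold psnd_def, intro dfn_intros)

end

section \<open>The natural numbers of the model\<close>

locale zf_omega = zf_model mem for mem :: "'v \<Rightarrow> 'v \<Rightarrow> bool" +
  fixes w :: 'v
  assumes omega: "is_omega mem w"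
begin

definition zero :: 'v where "zero = the1 (\<lambda>z. El z = {})"
definition suc :: "'v \<Rightarrow> 'v" where "suc n = the1 (\<lambda>m. El m = insert n (El n))"

lemma El_suc [simp]: "El (suc n) = insert n (El n)"
proof -
  obtain z where "El z = {n, n}" by (rule pairing)
  moreover obtain u where u: "El u = El n \<union> El z" by (rule union2)
  ultimately have u: "El u = insert n (El n)" by simp
  then have "suc n = u" unfolding suc_def by (rule the1_eq) (use u ext in metis)
  with u show ?thesis by simp
qed

lemma is_succ_iff: "is_succ mem n m \<longleftrightarrow> m = suc n"
  unfolding is_succ_def using El_suc ext by metis

lemma tdef_suc [dfn_intros]: "tdef t \<Longrightarrow> tdef (\<lambda>e. suc (t e))"
  by (rule tdef_subst1, unfold suc_def, unfold set_eq_iff insert_iff, intro dfn_intros)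

lemma is_empty_iff: "is_empty mem z \<longleftrightarrow> z = zero"
  and El_zero [simp]: "El zero = {}"
proof -
  obtain z where z: "El z = {}"
    using omega unfolding is_omega_def is_inductive_def is_empty_def by blast
  then have "zero = z" unfolding zero_def by (rule the1_eq) (use z ext in metis)
  with z show "El zero = {}" by simp
  then show "is_empty mem z \<longleftrightarrow> z = zero" for z
    unfolding is_empty_def using ext by metis
qed

lemma inductive_iff: "is_inductive mem v \<longleftrightarrow> zero \<in> El v \<and> (\<forall>n\<in>El v. suc n \<in> El v)"
  unfolding is_inductive_def is_empty_iff is_succ_iff by blast

abbreviation W :: "'v set" where "W \<equiv> El w"

lemma zero_W [simp]: "zero \<in> W" and suc_W [simp]: "n \<in> W \<Longrightarrow> suc n \<in> W"
  using omega unfolding is_omega_def inductive_iff by blast+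

text \<open>The n with \<open>P n\<close> form a set of the model by separation, and this set is
  inductive. An undefinable predicate could fail at nonstandard elements, which explains the first
  assumption.\<close>

lemma W_induct [consumes 2, case_names zero suc]:
  assumes "dfn (\<lambda>e. P (e 0))" "n \<in> W" "P zero" "\<And>n. n \<in> W \<Longrightarrow> P n \<Longrightarrow> P (suc n)"
  shows "P n"
proof -
  obtain v where v: "El v = {n \<in> W. P n}" using assms(1) by (rule separation)
  then have "is_inductive mem v" using assms(3,4) unfolding inductive_iff by simp
  then have "W \<subseteq> El v" using omega unfolding is_omega_def by blast
  with v assms(2) show ?thesis by blast
qed

text \<open>Foundation yields a minimal element. Least witnesses are what makes later choices
  canonical and hence definable.\<close>

lemma least:
  assumes "dfn (\<lambda>e. P (e 0))" "n \<in> W" "P n"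
  obtains m where "m \<in> W" "P m" "\<And>k. k \<in> El m \<Longrightarrow> \<not> P k"
proof -
  have sub: "El n \<subseteq> W" if "n \<in> W" for n
    by (rule W_induct[OF _ that]) (intro dfn_intros, auto)
  obtain v where v: "El v = {n \<in> W. P n}" using assms(1) by (rule separation)
  then obtain m where "m \<in> El v" "El v \<inter> El m = {}"
    using foundation[of v] assms(2,3) by blast
  then show thesis using v sub by (intro that[of m]) blast+
qed

lemma W_sub: "n \<in> W \<Longrightarrow> El n \<subseteq> W"
  by (rule W_induct[of "\<lambda>n. El n \<subseteq> W"]) (intro dfn_intros, auto)

lemma W_El [simp]: "n \<in> W \<Longrightarrow> k \<in> El n \<Longrightarrow> k \<in> W"
  using W_sub by blast

lemma W_trans: "n \<in> W \<Longrightarrow> k \<in> El n \<Longrightarrow> El k \<subseteq> El n"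
proof -
  assume n: "n \<in> W"
  have "dfn (\<lambda>e. \<forall>k\<in>El (e 0). El k \<subseteq> El (e 0))" by (intro dfn_intros)
  from this n have "\<forall>k\<in>El n. El k \<subseteq> El n"
    by (rule W_induct[where P = "\<lambda>n. \<forall>k\<in>El n. El k \<subseteq> El n"]) auto
  then show "k \<in> El n \<Longrightarrow> El k \<subseteq> El n" by blast
qed

lemma irrefl [simp]: "a \<notin> El a"
proof
  assume a: "a \<in> El a"
  obtain z where "El z = {a, a}" by (rule pairing)
  then show False using foundation[of z] a by auto
qed

lemma asym: "a \<in> El b \<Longrightarrow> b \<notin> El a"
proof
  assume a: "a \<in> El b" "b \<in> El a"
  obtain z where "El z = {a, b}" by (rule pairing)
  then show False using foundation[of z] a by auto
qed

lemma suc_not_zero [simp]: "suc a \<noteq> zero" "zero \<noteq> suc a"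
  using El_suc[of a] El_zero by (metis insert_not_empty)+

lemma suc_neq [simp]: "suc a \<noteq> a" "a \<noteq> suc a"
  using El_suc[of a] irrefl[of a] by (metis insertI1)+

lemma W_cases:
  assumes "n \<in> W"
  obtains "n = zero" | m where "m \<in> W" "n = suc m"
proof -
  have "dfn (\<lambda>e. e 0 = zero \<or> (\<exists>m\<in>W. e 0 = suc m))" by (intro dfn_intros)
  from this assms have "n = zero \<or> (\<exists>m\<in>W. n = suc m)"
    by (rule W_induct[where P = "\<lambda>n. n = zero \<or> (\<exists>m\<in>W. n = suc m)"]) auto
  then show thesis using that by blast
qed

lemma zero_in: "n \<in> W \<Longrightarrow> n = zero \<or> zero \<in> El n"
  by (rule W_induct[of "\<lambda>n. n = zero \<or> zero \<in> El n"]) (intro dfn_intros, auto)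

lemma suc_mono: "n \<in> W \<Longrightarrow> k \<in> El n \<Longrightarrow> suc k \<in> El (suc n)"
proof -
  assume n: "n \<in> W"
  have "dfn (\<lambda>e. \<forall>k\<in>El (e 0). suc k \<in> El (suc (e 0)))" by (intro dfn_intros)
  from this n have "\<forall>k\<in>El n. suc k \<in> El (suc n)"
    by (rule W_induct[where P = "\<lambda>n. \<forall>k\<in>El n. suc k \<in> El (suc n)"]) auto
  then show "k \<in> El n \<Longrightarrow> suc k \<in> El (suc n)" by blast
qed

lemma W_linear:
  assumes "m \<in> W" "n \<in> W"
  shows "m \<in> El n \<or> m = n \<or> n \<in> El m"
proof -
  have "dfn (\<lambda>e. e 0 \<in> El n \<or> e 0 = n \<or> n \<in> El (e 0))" by (intro dfn_intros)
  from this assms(1) show ?thesis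
  proof (rule W_induct[where P = "\<lambda>m. m \<in> El n \<or> m = n \<or> n \<in> El m"])
    show "zero \<in> El n \<or> zero = n \<or> n \<in> El zero" using zero_in[OF assms(2)] by auto
    show "suc m \<in> El n \<or> suc m = n \<or> n \<in> El (suc m)"
      if "m \<in> W" "m \<in> El n \<or> m = n \<or> n \<in> El m" for m
      using that suc_mono[OF assms(2), of m] by auto
  qed
qed

text \<open>On \<open>W\<close>, membership is the strict order and inclusion the weak one; this
  passes between the two.\<close>

lemma not_in_iff: "m \<in> W \<Longrightarrow> n \<in> W \<Longrightarrow> m \<notin> El n \<longleftrightarrow> El n \<subseteq> El m"
  using W_linear[of m n] W_trans[of m n] irrefl by blast

lemma in_iff: "m \<in> W \<Longrightarrow> n \<in> W \<Longrightarrow> m \<in> El n \<longleftrightarrow> \<not> El n \<subseteq> El m"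
  using not_in_iff by blast

lemma W_max:
  assumes "m \<in> W" "n \<in> W"
  obtains k where "k \<in> W" "El m \<subseteq> El k" "El n \<subseteq> El k" "k = m \<or> k = n"
  using assms not_in_iff W_trans by (metis order_refl)

lemma strong_induct [consumes 2, case_names less]:
  assumes "dfn (\<lambda>e. P (e 0))" "n \<in> W" "\<And>n. n \<in> W \<Longrightarrow> (\<And>k. k \<in> El n \<Longrightarrow> P k) \<Longrightarrow> P n"
  shows "P n"
proof (rule ccontr)
  assume "\<not> P n"
  have "dfn (\<lambda>e. \<not> P (e 0))" by (intro dfn_intros assms)
  then obtain m where "m \<in> W" "\<not> P m" "\<And>k. k \<in> El m \<Longrightarrow> \<not> \<not> P k"
    using \<open>n \<in> W\<close> \<open>\<not> P n\<close> by (rule least[where P = "\<lambda>n. \<not> P n"]) blast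
  then show False using assms(3) by blast
qed

text \<open>Any two approximations agree where both are defined, so the value at n is definable as
  the common value of all approximations up to n. Their existence is an internal induction, because
  recursion of HOL cannot run along a nonstandard \<open>w\<close>.\<close>

lemma recursion:
  assumes F: "tdef (\<lambda>e. F (e 0))" and a: "a \<in> El X" and X: "\<And>x. x \<in> El X \<Longrightarrow> F x \<in> El X"
  obtains g where "fn g w X" "g \<cdot> zero = a" "\<And>n. n \<in> W \<Longrightarrow> g \<cdot> suc n = F (g \<cdot> n)"
proof -
  note F' = tdef_subst1[of F, OF F]
  define approx where "approx h n \<longleftrightarrow> fn h (suc n) X \<and> h \<cdot> zero = a \<and> (\<forall>k\<in>El n. h \<cdot> suc k = F (h \<cdot> k))" for h n
  have dfn_approx: "dfn (\<lambda>e. approx (s e) (t e))" if "tdef s" "tdef t" for s t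
    by (rule dfn_subst2[OF _ that], unfold approx_def, intro dfn_intros F')
  have agree: "k \<in> El (suc n) \<longrightarrow> k \<in> El (suc m) \<longrightarrow> h \<cdot> k = h' \<cdot> k"
    if "approx h n" "approx h' m" "n \<in> W" "m \<in> W" "k \<in> W" for h h' n m k
  proof -
    have "dfn (\<lambda>e. e 0 \<in> El (suc n) \<longrightarrow> e 0 \<in> El (suc m) \<longrightarrow> h \<cdot> e 0 = h' \<cdot> e 0)"
      by (intro dfn_intros)
    from this \<open>k \<in> W\<close> show ?thesis
    proof (rule W_induct[where P = "\<lambda>k. k \<in> El (suc n) \<longrightarrow> k \<in> El (suc m) \<longrightarrow> h \<cdot> k = h' \<cdot> k"])
      show "zero \<in> El (suc n) \<longrightarrow> zero \<in> El (suc m) \<longrightarrow> h \<cdot> zero = h' \<cdot> zero"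
        using that unfolding approx_def by simp
      fix k assume k: "k \<in> W" "k \<in> El (suc n) \<longrightarrow> k \<in> El (suc m) \<longrightarrow> h \<cdot> k = h' \<cdot> k"
      have "k \<in> El n" if "suc k \<in> El (suc n)" "n \<in> W" for n
        using W_trans[of "suc n" "suc k"] W_trans[of n "suc k"] that k(1) by auto
      with k that show "suc k \<in> El (suc n) \<longrightarrow> suc k \<in> El (suc m) \<longrightarrow> h \<cdot> suc k = h' \<cdot> suc k"
        unfolding approx_def by (metis El_suc insertCI)
    qed
  qed
  have ex: "\<exists>h. approx h n" if "n \<in> W" for n
  proof -
    have "dfn (\<lambda>e. \<exists>h. approx h (e 0))" by (intro dfn_intros dfn_approx)
    from this that show ?thesis
    proof (rule W_induct[where P = "\<lambda>n. \<exists>h. approx h n"])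
      have "tdef (\<lambda>e. a)" by (rule tdef_const)
      then obtain h where "fn h (suc zero) X" "\<And>k. k \<in> El (suc zero) \<Longrightarrow> h \<cdot> k = a"
        by (rule lambda_ex[where t = "\<lambda>_. a" and A = "suc zero" and B = X]) (use a in blast)+
      then show "\<exists>h. approx h zero" unfolding approx_def by auto
      fix n assume n: "n \<in> W" "\<exists>h. approx h n"
      then obtain h where h: "approx h n" by blast
      have fh: "fn h (suc n) X" using h unfolding approx_def by blast
      have "tdef (\<lambda>e. if e 0 = suc n then F (h \<cdot> n) else h \<cdot> e 0)"
        by (intro dfn_intros)
      then obtain h' where h': "fn h' (suc (suc n)) X"
        "\<And>k. k \<in> El (suc (suc n)) \<Longrightarrow> h' \<cdot> k = (if k = suc n then F (h \<cdot> n) else h \<cdot> k)"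
        by (rule lambda_ex[where t = "\<lambda>k. if k = suc n then F (h \<cdot> n) else h \<cdot> k" and A = "suc (suc n)" and B = X])
          (use fn_app[OF fh] X in \<open>auto split: if_splits\<close>)
      have 1: "h' \<cdot> k = h \<cdot> k" if "k \<in> El (suc n)" for k
        using h'(2)[of k] that irrefl[of "suc n"] by auto
      have 2: "suc k \<in> El (suc n)" if "k \<in> El n" for k by (rule suc_mono[OF n(1) that])
      have "zero \<in> El (suc n)" using zero_in[OF suc_W[OF n(1)]] by auto
      then have "approx h' (suc n)" using h' h 1 2 unfolding approx_def by auto
      then show "\<exists>h. approx h (suc n)" by blast
    qed
  qed
  define t where "t n = the1 (\<lambda>v. \<exists>h. approx h n \<and> v = h \<cdot> n)" for n
  have t: "t k = h \<cdot> k" if "approx h n" "n \<in> W" "k \<in> W" "k \<in> El (suc n)" for h n k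
  proof -
    obtain h' where h': "approx h' k" using ex \<open>k \<in> W\<close> by blast
    have "t k = h' \<cdot> k" unfolding t_def
    proof (rule the1_eq)
      show "\<exists>h. approx h k \<and> h' \<cdot> k = h \<cdot> k" using h' by blast
      show "y = h' \<cdot> k" if "\<exists>h. approx h k \<and> y = h \<cdot> k" for y
        using that agree[OF _ h' \<open>k \<in> W\<close> \<open>k \<in> W\<close> \<open>k \<in> W\<close>] El_suc by blast
    qed
    also have "\<dots> = h \<cdot> k" using agree[OF h' that(1) \<open>k \<in> W\<close> \<open>n \<in> W\<close> \<open>k \<in> W\<close>] that by auto
    finally show ?thesis .
  qed
  have t1: "tdef (\<lambda>e. t (e 0))" unfolding t_def by (intro dfn_intros dfn_approx)
  have t2: "t n \<in> El X" if n: "n \<in> W" for n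
  proof -
    obtain h where h: "approx h n" using ex[OF n] by blast
    then have "h \<cdot> n \<in> El X" unfolding approx_def using fn_app[of h "suc n" X n] by simp
    with t[OF h n n] show ?thesis by simp
  qed
  obtain g where g: "fn g w X" "\<And>k. k \<in> W \<Longrightarrow> g \<cdot> k = t k"
    using lambda_ex[of t w X, OF t1 t2] by blast
  show thesis
  proof (rule that[OF g(1)])
    obtain h where h: "approx h zero" using ex[OF zero_W] by blast
    with t[OF h zero_W zero_W] g show "g \<cdot> zero = a" unfolding approx_def by simp
    fix n assume n: "n \<in> W"
    obtain h where h: "approx h (suc n)" using ex[OF suc_W[OF n]] by blast
    with t[OF h, of n] t[OF h, of "suc n"] g n show "g \<cdot> suc n = F (g \<cdot> n)"
      unfolding approx_def by simp
  qed
qed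

section \<open>Restrictions, finite sequences and parity\<close>

definition restr :: "'v \<Rightarrow> 'v \<Rightarrow> 'v" where
  "restr x n = the1 (\<lambda>s. is_restr mem x n s)"

lemma is_restr_iff: "is_restr mem x n s \<longleftrightarrow> s = restr x n"
proof -
  have "dfn (\<lambda>e. \<exists>a\<in>El n. \<exists>b. is_pair mem a b (e 0))" by (intro dfn_intros)
  then obtain r where r: "El r = {p \<in> El x. \<exists>a\<in>El n. \<exists>b. is_pair mem a b p}"
    by (rule separation)
  then have 1: "is_restr mem x n r" unfolding is_restr_def .
  have 2: "s = r" if "is_restr mem x n s" for s
    using that r unfolding is_restr_def by (intro ext) simp
  have "restr x n = r" unfolding restr_def using 1 2 by (rule the1_eq)
  with 1 2 show ?thesis by blast
qed

lemma dfn_is_restr [dfn_intros]: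
  assumes "tdef x" "tdef n" "tdef s"
  shows "dfn (\<lambda>e. is_restr mem (x e) (n e) (s e))"
  by (rule dfn_subst3[OF _ assms], unfold is_restr_def set_eq_iff mem_Collect_eq, intro dfn_intros)

lemma tdef_restr [dfn_intros]: "tdef x \<Longrightarrow> tdef n \<Longrightarrow> tdef (\<lambda>e. restr (x e) (n e))"
  by (rule tdef_subst2, unfold restr_def, intro dfn_intros)

lemma fn_restr:
  assumes x: "fn x w B" and n: "n \<in> W"
  shows "fn (restr x n) n B"
proof -
  have "is_restr mem x n (restr x n)" by (simp add: is_restr_iff)
  then have "El (restr x n) = {pair k (x \<cdot> k) | k. k \<in> El n}"
    unfolding is_restr_def fn_El[OF x] is_pair_pair using n by (auto simp: W_El)
  then show ?thesis by (rule fnI(1)) (use fn_app[OF x] n W_El in blast)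
qed

lemma restr_cong:
  assumes x: "fn x w B" and y: "fn y w B" and n: "n \<in> W" and eq: "\<And>k. k \<in> El n \<Longrightarrow> x \<cdot> k = y \<cdot> k"
  shows "restr x n = restr y n"
proof -
  have "is_restr mem x n (restr x n)" "is_restr mem y n (restr y n)" by (simp_all add: is_restr_iff)
  then have "El (restr x n) = {pair k (x \<cdot> k) | k. k \<in> El n}"
    "El (restr y n) = {pair k (y \<cdot> k) | k. k \<in> El n}"
    unfolding is_restr_def fn_El[OF x] fn_El[OF y] is_pair_pair using n by (auto simp: W_El)
  then show ?thesis using eq by (intro ext) auto
qed

lemma finseqs: obtains D where "is_finseqs mem w D"
proof -
  obtain p where p: "El p = {pair a b | a b. a \<in> W \<and> b \<in> W}" by (rule product)
  obtain q where q: "El q = {z. El z \<subseteq> El p}" by (rule power)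
  have "dfn (\<lambda>e. \<exists>n\<in>W. fn (e 0) n w)" by (intro dfn_intros)
  then obtain D where D: "El D = {s \<in> El q. \<exists>n\<in>W. fn s n w}" by (rule separation)
  have "El s \<subseteq> El p" if "n \<in> W" "fn s n w" for s n
    using that unfolding fn_iff p by (blast intro: W_El)
  then have "El D = {s. \<exists>n\<in>W. fn s n w}" unfolding D q by auto
  then show thesis by (intro that) (simp add: is_finseqs_def)
qed

lemma evens: obtains S where "is_evens mem w S"
proof -
  \<comment> \<open>Parity is obtained by iterating the exchange of \<open>zero\<close> and
    \<open>suc zero\<close>.\<close>
  have "tdef (\<lambda>e. if e 0 = zero then suc zero else zero)" by (intro dfn_intros)
  then obtain g where g: "fn g w w" "g \<cdot> zero = zero"
    "\<And>n. n \<in> W \<Longrightarrow> g \<cdot> suc n = (if g \<cdot> n = zero then suc zero else zero)"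
    by (rule recursion[where F = "\<lambda>x. if x = zero then suc zero else zero" and a = zero and X = w])
      (auto split: if_splits)
  have "dfn (\<lambda>e. g \<cdot> e 0 = zero)" by (intro dfn_intros)
  then obtain S where "El S = {n \<in> W. g \<cdot> n = zero}" by (rule separation)
  moreover have "g \<cdot> suc n = zero \<longleftrightarrow> g \<cdot> n \<noteq> zero" if "n \<in> W" for n
    using g(3)[OF that] by simp
  ultimately show thesis using g(2)
    by (intro that[of S]) (auto simp: is_evens_def is_empty_iff is_succ_iff)
qed

definition two :: 'v where "two = suc (suc zero)"

lemma El_two [simp]: "El two = {zero, suc zero}" by (auto simp: two_def)

lemma is_two_iff: "is_two mem t \<longleftrightarrow> t = two"
  unfolding is_two_def is_empty_iff is_succ_iff two_def by blast

end

section \<open>Enumerating pairs of finite binary sequences\<close>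

context zf_omega
begin

definition lam :: "'v \<Rightarrow> ('v \<Rightarrow> 'v) \<Rightarrow> 'v" where
  "lam B t = the1 (\<lambda>f. fn f w B \<and> (\<forall>k\<in>W. f \<cdot> k = t k))"

lemma lam:
  assumes t: "tdef (\<lambda>e. t (e 0))" and B: "\<And>k. k \<in> W \<Longrightarrow> t k \<in> El B"
  shows fn_lam: "fn (lam B t) w B" and app_lam: "\<And>k. k \<in> W \<Longrightarrow> lam B t \<cdot> k = t k"
proof -
  obtain f where f: "fn f w B \<and> (\<forall>k\<in>W. f \<cdot> k = t k)"
    using lambda_ex[of t w B, OF t B] by metis
  then have "lam B t = f" unfolding lam_def by (rule the1_eq) (metis f fn_ext)
  with f show "fn (lam B t) w B" "\<And>k. k \<in> W \<Longrightarrow> lam B t \<cdot> k = t k" by simp_all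
qed

text \<open>The body may depend on the environment, as required for operations that send points to
  points.\<close>

lemma tdef_lam [dfn_intros]:
  assumes "tdef (\<lambda>e. t (e 0) (\<lambda>i. e (Suc i)))"
  shows "tdef (\<lambda>e. lam B (\<lambda>k. t k e))"
proof -
  have *: "tdef (\<lambda>e. t (e 0) (\<lambda>i. e (Suc (Suc i))))"
    using tdef_weaken[OF assms, of "case_nat 0 (\<lambda>i. Suc (Suc i))"] by simp
  show ?thesis unfolding lam_def by (intro dfn_intros *)
qed

abbreviation one :: 'v where "one \<equiv> suc zero"
abbreviation bin :: "'v \<Rightarrow> bool" where "bin x \<equiv> fn x w two"

lemma bin_cases: "bin x \<Longrightarrow> k \<in> W \<Longrightarrow> x \<cdot> k = zero \<or> x \<cdot> k = one"
  using fn_app[of x w two k] by simp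

definition flip :: "'v \<Rightarrow> 'v" where "flip v = (if v = zero then one else zero)"

lemma flip_simps [simp]: "flip zero = one" "flip one = zero" "flip v = zero \<longleftrightarrow> v \<noteq> zero"
  by (auto simp: flip_def)

lemma flip_two [simp]: "flip v \<in> El two"
  by (simp add: flip_def)

lemma tdef_flip [dfn_intros]: "tdef t \<Longrightarrow> tdef (\<lambda>e. flip (t e))"
  by (rule tdef_subst1, unfold flip_def, intro dfn_intros)

text \<open>A binary counter whose digits, least significant first, are $a(0), b(0), a(1), b(1), \dots$\<close>

lemma odometer:
  obtains a b where "\<And>e. e \<in> W \<Longrightarrow> bin (a \<cdot> e)" "\<And>e. e \<in> W \<Longrightarrow> bin (b \<cdot> e)"
    "\<And>k. k \<in> W \<Longrightarrow> a \<cdot> zero \<cdot> k = zero" "\<And>k. k \<in> W \<Longrightarrow> b \<cdot> zero \<cdot> k = zero"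
    "\<And>e k. e \<in> W \<Longrightarrow> k \<in> W \<Longrightarrow> a \<cdot> suc e \<cdot> k =
      (if \<forall>j\<in>El k. a \<cdot> e \<cdot> j = one \<and> b \<cdot> e \<cdot> j = one then flip (a \<cdot> e \<cdot> k) else a \<cdot> e \<cdot> k)"
    "\<And>e k. e \<in> W \<Longrightarrow> k \<in> W \<Longrightarrow> b \<cdot> suc e \<cdot> k =
      (if (\<forall>j\<in>El k. a \<cdot> e \<cdot> j = one \<and> b \<cdot> e \<cdot> j = one) \<and> a \<cdot> e \<cdot> k = one
       then flip (b \<cdot> e \<cdot> k) else b \<cdot> e \<cdot> k)"
proof -
  obtain C where "is_funspace mem w two C" by (rule funspace)
  then have C: "x \<in> El C \<longleftrightarrow> bin x" for x by (simp add: is_funspace_def)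
  obtain X where X: "El X = {pair a b | a b. a \<in> El C \<and> b \<in> El C}" by (rule product)
  \<comment> \<open>A carry reaches a(k) exactly when all digits at positions below k are one, and
    reaches b(k) if a(k) is one as well.\<close>
  define ones where "ones x y k \<longleftrightarrow> (\<forall>j\<in>El k. x \<cdot> j = one \<and> y \<cdot> j = one)" for x y k
  have dfn_ones: "dfn (\<lambda>e. ones (s e) (t e) (u e))" if "tdef s" "tdef t" "tdef u" for s t u
    by (rule dfn_subst3[OF _ that], unfold ones_def, intro dfn_intros)
  define fa where "fa x y k = (if ones x y k then flip (x \<cdot> k) else x \<cdot> k)" for x y k
  define fb where "fb x y k = (if ones x y k \<and> x \<cdot> k = one then flip (y \<cdot> k) else y \<cdot> k)" for x y k
  define F where "F p = pair (lam two (fa (pfst p) (psnd p))) (lam two (fb (pfst p) (psnd p)))" for p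
  have lama: "bin (lam two (fa x y))" "k \<in> W \<Longrightarrow> lam two (fa x y) \<cdot> k = fa x y k"
   and lamb: "bin (lam two (fb x y))" "k \<in> W \<Longrightarrow> lam two (fb x y) \<cdot> k = fb x y k"
    if "bin x" "bin y" for x y k
  proof -
    have 1: "tdef (\<lambda>e. fa x y (e 0))" "tdef (\<lambda>e. fb x y (e 0))"
      unfolding fa_def fb_def by (intro dfn_intros dfn_ones)+
    have 2: "fa x y k \<in> El two" "fb x y k \<in> El two" if "k \<in> W" for k
      unfolding fa_def fb_def using fn_app[of _ w two k] that \<open>bin x\<close> \<open>bin y\<close> flip_two by metis+
    show "bin (lam two (fa x y))" "k \<in> W \<Longrightarrow> lam two (fa x y) \<cdot> k = fa x y k"
      "bin (lam two (fb x y))" "k \<in> W \<Longrightarrow> lam two (fb x y) \<cdot> k = fb x y k"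
      using lam[OF 1(1) 2(1)] lam[OF 1(2) 2(2)] by blast+
  qed
  define o0 where "o0 = lam two (\<lambda>_. zero)"
  have o0: "bin o0" "k \<in> W \<Longrightarrow> o0 \<cdot> k = zero" for k
    unfolding o0_def using lam[OF tdef_const[of zero], of two] by auto
  have F: "tdef (\<lambda>e. F (e 0))"
    unfolding F_def fa_def fb_def by (intro dfn_intros dfn_ones)
  have FX: "F x \<in> El X" if "x \<in> El X" for x
    using that lama(1) lamb(1) unfolding X F_def C by fastforce
  have "pair o0 o0 \<in> El X" using o0 by (auto simp: X C)
  then obtain g where g: "fn g w X" "g \<cdot> zero = pair o0 o0" "\<And>n. n \<in> W \<Longrightarrow> g \<cdot> suc n = F (g \<cdot> n)"
    using recursion[of F "pair o0 o0" X, OF F _ FX] by metis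
  have gX: "bin (pfst (g \<cdot> n))" "bin (psnd (g \<cdot> n))" if "n \<in> W" for n
    using fn_app[OF g(1) that] unfolding X C by auto
  have t: "tdef (\<lambda>e. pfst (g \<cdot> e 0))" "tdef (\<lambda>e. psnd (g \<cdot> e 0))" by (intro dfn_intros)+
  have a: "fn (lam C (\<lambda>n. pfst (g \<cdot> n))) w C" "\<And>n. n \<in> W \<Longrightarrow> lam C (\<lambda>n. pfst (g \<cdot> n)) \<cdot> n = pfst (g \<cdot> n)"
    using lam[OF t(1), of C] gX unfolding C by auto
  have b: "fn (lam C (\<lambda>n. psnd (g \<cdot> n))) w C" "\<And>n. n \<in> W \<Longrightarrow> lam C (\<lambda>n. psnd (g \<cdot> n)) \<cdot> n = psnd (g \<cdot> n)"
    using lam[OF t(2), of C] gX unfolding C by auto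
  show thesis
    by (rule that[of "lam C (\<lambda>n. pfst (g \<cdot> n))" "lam C (\<lambda>n. psnd (g \<cdot> n))"])
      (simp_all add: a(2) b(2) gX g(2,3) o0 F_def lama lamb fa_def fb_def ones_def)
qed

text \<open>The counter passes through all patterns of its low digits. The number e of the state
  found also exceeds n, so one number can serve both as a code of two words and as their common
  length.\<close>

lemma enumeration:
  obtains a b where "\<And>e. e \<in> W \<Longrightarrow> bin (a \<cdot> e)" "\<And>e. e \<in> W \<Longrightarrow> bin (b \<cdot> e)"
    "\<And>x y n. bin x \<Longrightarrow> bin y \<Longrightarrow> n \<in> W \<Longrightarrow>
      \<exists>e\<in>W. n \<in> El e \<and> (\<forall>k\<in>El n. a \<cdot> e \<cdot> k = x \<cdot> k \<and> b \<cdot> e \<cdot> k = y \<cdot> k)"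
proof -
  obtain a b where bin: "\<And>e. e \<in> W \<Longrightarrow> bin (a \<cdot> e)" "\<And>e. e \<in> W \<Longrightarrow> bin (b \<cdot> e)"
    and start: "\<And>k. k \<in> W \<Longrightarrow> a \<cdot> zero \<cdot> k = zero" "\<And>k. k \<in> W \<Longrightarrow> b \<cdot> zero \<cdot> k = zero"
    and step: "\<And>e k. e \<in> W \<Longrightarrow> k \<in> W \<Longrightarrow> a \<cdot> suc e \<cdot> k =
      (if \<forall>j\<in>El k. a \<cdot> e \<cdot> j = one \<and> b \<cdot> e \<cdot> j = one then flip (a \<cdot> e \<cdot> k) else a \<cdot> e \<cdot> k)"
    "\<And>e k. e \<in> W \<Longrightarrow> k \<in> W \<Longrightarrow> b \<cdot> suc e \<cdot> k =
      (if (\<forall>j\<in>El k. a \<cdot> e \<cdot> j = one \<and> b \<cdot> e \<cdot> j = one) \<and> a \<cdot> e \<cdot> k = one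
       then flip (b \<cdot> e \<cdot> k) else b \<cdot> e \<cdot> k)"
    by (rule odometer) (rule that; assumption)
  \<comment> \<open>\<open>Z\<close>: the state is cleared below n. \<open>S\<close>: the positions
    from n on are the same in both states. \<open>Q\<close>: from a state cleared below n, every
    pattern below n is reached without disturbing the other positions.\<close>
  define Z where "Z n e \<longleftrightarrow> (\<forall>j\<in>El n. a \<cdot> e \<cdot> j = zero \<and> b \<cdot> e \<cdot> j = zero)" for n e
  define S where "S n e e' \<longleftrightarrow> (\<forall>k\<in>W. El n \<subseteq> El k \<longrightarrow> a \<cdot> e' \<cdot> k = a \<cdot> e \<cdot> k \<and> b \<cdot> e' \<cdot> k = b \<cdot> e \<cdot> k)" for n e e'
  define Q where "Q n \<longleftrightarrow> (\<forall>e\<in>W. Z n e \<longrightarrow> (\<forall>x y. bin x \<longrightarrow> bin y \<longrightarrow>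
    (\<exists>e'\<in>W. (\<forall>j\<in>El n. a \<cdot> e' \<cdot> j = x \<cdot> j \<and> b \<cdot> e' \<cdot> j = y \<cdot> j) \<and> S n e e')))" for n
  \<comment> \<open>At time e a carry cannot pass position e, because it would have to find a one
    there.\<close>
  have supp: "a \<cdot> e \<cdot> k = zero" if "e \<in> W" "k \<in> W" "El e \<subseteq> El k" for e k
  proof -
    have "dfn (\<lambda>e. \<forall>k\<in>W. El (e 0) \<subseteq> El k \<longrightarrow> a \<cdot> e 0 \<cdot> k = zero)" by (intro dfn_intros)
    from this \<open>e \<in> W\<close> have "\<forall>k\<in>W. El e \<subseteq> El k \<longrightarrow> a \<cdot> e \<cdot> k = zero"
    proof (rule W_induct[where P = "\<lambda>e. \<forall>k\<in>W. El e \<subseteq> El k \<longrightarrow> a \<cdot> e \<cdot> k = zero"])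
      fix e assume e: "e \<in> W" "\<forall>k\<in>W. El e \<subseteq> El k \<longrightarrow> a \<cdot> e \<cdot> k = zero"
      have "a \<cdot> suc e \<cdot> k = zero" if k: "k \<in> W" "El (suc e) \<subseteq> El k" for k
      proof -
        have "a \<cdot> e \<cdot> e = zero" "a \<cdot> e \<cdot> k = zero" "e \<in> El k" using e k by auto
        then have "\<not> (\<forall>j\<in>El k. a \<cdot> e \<cdot> j = one \<and> b \<cdot> e \<cdot> j = one)" by force
        with \<open>a \<cdot> e \<cdot> k = zero\<close> show ?thesis unfolding step(1)[OF e(1) k(1)] by simp
      qed
      then show "\<forall>k\<in>W. El (suc e) \<subseteq> El k \<longrightarrow> a \<cdot> suc e \<cdot> k = zero" by blast
    qed (simp add: start)
    with that show ?thesis by blast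
  qed
  have S_trans: "S n e e'' " if "S n e e'" "S n e' e''" for n e e' e''
    using that unfolding S_def by metis
  have Q: "Q n" if "n \<in> W" for n
  proof -
    have "dfn (\<lambda>e. Q (e 0))" unfolding Q_def Z_def S_def by (intro dfn_intros)
    from this that show ?thesis
    proof (rule W_induct[where P = Q])
      show "Q zero" unfolding Q_def S_def by auto
      fix n assume n: "n \<in> W" "Q n"
      note IH = n(2)[unfolded Q_def, rule_format]
      define o1 where "o1 = lam two (\<lambda>_. one)"
      have o1: "bin o1" "\<And>k. k \<in> W \<Longrightarrow> o1 \<cdot> k = one"
        unfolding o1_def using lam[OF tdef_const[of one], of two] by auto
      have S_suc: "S (suc n) e e'" if "S n e e'" for e e'
        using that unfolding S_def by auto
      \<comment> \<open>The induction hypothesis turns all digits below n into ones; the next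
        increment clears them and carries into the two digits at n. As these are not both one,
        nothing beyond n changes.\<close>
      have carry: "\<exists>e''\<in>W. Z n e'' \<and> S (suc n) e e'' \<and> a \<cdot> e'' \<cdot> n = flip (a \<cdot> e \<cdot> n) \<and>
          b \<cdot> e'' \<cdot> n = (if a \<cdot> e \<cdot> n = one then flip (b \<cdot> e \<cdot> n) else b \<cdot> e \<cdot> n)"
        if e: "e \<in> W" "Z n e" "\<not> (a \<cdot> e \<cdot> n = one \<and> b \<cdot> e \<cdot> n = one)" for e
      proof -
        obtain e' where e': "e' \<in> W" "S n e e'"
          and *: "\<forall>j\<in>El n. a \<cdot> e' \<cdot> j = o1 \<cdot> j \<and> b \<cdot> e' \<cdot> j = o1 \<cdot> j"
          using IH[OF e(1,2) o1(1) o1(1)] by blast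
        have ones: "a \<cdot> e' \<cdot> j = one \<and> b \<cdot> e' \<cdot> j = one" if "j \<in> El n" for j
          using * that o1(2) W_El[OF n(1) that] by auto
        have at: "a \<cdot> e' \<cdot> n = a \<cdot> e \<cdot> n" "b \<cdot> e' \<cdot> n = b \<cdot> e \<cdot> n"
          using e'(2) n(1) unfolding S_def by auto
        have "Z n (suc e')"
          using step[OF e'(1)] ones W_El[OF n(1)] W_trans[OF n(1)] unfolding Z_def
          by (auto simp: subset_iff)
        moreover have "S (suc n) e (suc e')"
          unfolding S_def
        proof (intro ballI impI)
          fix k assume k: "k \<in> W" "El (suc n) \<subseteq> El k"
          then have "\<not> (\<forall>j\<in>El k. a \<cdot> e' \<cdot> j = one \<and> b \<cdot> e' \<cdot> j = one)"
            using e(3) at by (metis El_suc insertI1 subsetD)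
          then have "a \<cdot> suc e' \<cdot> k = a \<cdot> e' \<cdot> k" "b \<cdot> suc e' \<cdot> k = b \<cdot> e' \<cdot> k"
            by (simp_all only: step[OF e'(1) k(1)] if_False simp_thms)
          then show "a \<cdot> suc e' \<cdot> k = a \<cdot> e \<cdot> k \<and> b \<cdot> suc e' \<cdot> k = b \<cdot> e \<cdot> k"
            using e'(2) k unfolding S_def by auto
        qed
        moreover have "a \<cdot> suc e' \<cdot> n = flip (a \<cdot> e \<cdot> n)"
          "b \<cdot> suc e' \<cdot> n = (if a \<cdot> e \<cdot> n = one then flip (b \<cdot> e \<cdot> n) else b \<cdot> e \<cdot> n)"
          using step[OF e'(1) n(1)] ones at by auto
        ultimately show ?thesis using suc_W[OF e'(1)] by blast
      qed
      show "Q (suc n)" unfolding Q_def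
      proof (intro ballI allI impI)
        fix e x y assume e: "e \<in> W" "Z (suc n) e" and xy: "bin x" "bin y"
        \<comment> \<open>The two digits at n run through 00, 10, 01, 11, least significant first,
          each time with the lower positions cleared.\<close>
        define R where "R c d \<longleftrightarrow> (\<exists>e'\<in>W. Z n e' \<and> S (suc n) e e' \<and> a \<cdot> e' \<cdot> n = c \<and> b \<cdot> e' \<cdot> n = d)" for c d
        have next': "R (flip c) (if c = one then flip d else d)" if "R c d" "\<not> (c = one \<and> d = one)" for c d
        proof -
          obtain e' where "e' \<in> W" "Z n e'" "S (suc n) e e'" "a \<cdot> e' \<cdot> n = c" "b \<cdot> e' \<cdot> n = d"
            using \<open>R c d\<close> unfolding R_def by blast
          with carry[of e'] S_trans that(2) show ?thesis unfolding R_def by metis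
        qed
        have r00: "R zero zero" unfolding R_def
          by (rule bexI[of _ e]) (use e in \<open>auto simp: Z_def S_def\<close>)
        have r10: "R one zero" using next'[OF r00] by simp
        have r01: "R zero one" using next'[OF r10] by simp
        have r11: "R one one" using next'[OF r01] by simp
        have "R (x \<cdot> n) (y \<cdot> n)"
          using bin_cases[OF xy(1) n(1)] bin_cases[OF xy(2) n(1)] r00 r10 r01 r11 by auto
        then obtain e1 where e1: "e1 \<in> W" "Z n e1" "S (suc n) e e1" "a \<cdot> e1 \<cdot> n = x \<cdot> n" "b \<cdot> e1 \<cdot> n = y \<cdot> n"
          unfolding R_def by blast
        obtain e2 where e2: "e2 \<in> W" "\<forall>j\<in>El n. a \<cdot> e2 \<cdot> j = x \<cdot> j \<and> b \<cdot> e2 \<cdot> j = y \<cdot> j" "S n e1 e2"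
          using IH[OF e1(1,2) xy] by blast
        have "a \<cdot> e2 \<cdot> n = x \<cdot> n" "b \<cdot> e2 \<cdot> n = y \<cdot> n"
          using e2(3) e1 n(1) unfolding S_def by auto
        then show "\<exists>e'\<in>W. (\<forall>j\<in>El (suc n). a \<cdot> e' \<cdot> j = x \<cdot> j \<and> b \<cdot> e' \<cdot> j = y \<cdot> j) \<and> S (suc n) e e'"
          using e2 S_trans[OF e1(3) S_suc[OF e2(3)]] by (intro bexI[of _ e2]) auto
      qed
    qed
  qed
  show thesis
  proof (rule that[OF bin])
    fix x y n assume xy: "bin x" "bin y" and n: "n \<in> W"
    \<comment> \<open>The extra one at position n forces n below the number of the state, by
      \<open>supp\<close>.\<close>
    define t where "t k = (if k = n then one else x \<cdot> k)" for k
    have "tdef (\<lambda>e. t (e 0))" unfolding t_def by (intro dfn_intros)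
    moreover have "t k \<in> El two" if "k \<in> W" for k
      unfolding t_def using fn_app[OF xy(1) that] by simp
    ultimately have t: "bin (lam two t)" "\<And>k. k \<in> W \<Longrightarrow> lam two t \<cdot> k = t k"
      using lam[of t two] by blast+
    have "Z (suc n) zero" unfolding Z_def using start W_El[OF suc_W[OF n]] by blast
    then obtain e where e: "e \<in> W" "\<forall>j\<in>El (suc n). a \<cdot> e \<cdot> j = lam two t \<cdot> j \<and> b \<cdot> e \<cdot> j = y \<cdot> j"
      using Q[OF suc_W[OF n]] t(1) xy(2) unfolding Q_def by (meson zero_W)
    have "a \<cdot> e \<cdot> n = one" using e(2) t(2)[OF n] unfolding t_def by simp
    then have "n \<in> El e" using supp[OF e(1) n] in_iff[OF n e(1)] by auto
    moreover have "a \<cdot> e \<cdot> k = x \<cdot> k \<and> b \<cdot> e \<cdot> k = y \<cdot> k" if "k \<in> El n" for k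
      using e(2) that t(2)[OF W_El[OF n that]] irrefl unfolding t_def by auto
    ultimately show "\<exists>e\<in>W. n \<in> El e \<and> (\<forall>k\<in>El n. a \<cdot> e \<cdot> k = x \<cdot> k \<and> b \<cdot> e \<cdot> k = y \<cdot> k)"
      using e(1) by blast
  qed
qed

end

section \<open>Strategies in a Banach--Mazur game\<close>

context zf_omega
begin

definition agree :: "'v \<Rightarrow> 'v \<Rightarrow> 'v \<Rightarrow> bool" where
  "agree n x y \<longleftrightarrow> (\<forall>k\<in>El n. x \<cdot> k = y \<cdot> k)"

lemma dfn_agree [dfn_intros]: "tdef n \<Longrightarrow> tdef x \<Longrightarrow> tdef y \<Longrightarrow> dfn (\<lambda>e. agree (n e) (x e) (y e))"
  by (rule dfn_subst3, unfold agree_def, intro dfn_intros)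

lemma agree_refl [simp]: "agree n x x" by (simp add: agree_def)
lemma agree_sym: "agree n x y \<Longrightarrow> agree n y x" by (simp add: agree_def)
lemma agree_trans: "agree n x y \<Longrightarrow> agree n y z \<Longrightarrow> agree n x z" by (simp add: agree_def)
lemma agree_mono: "agree n x y \<Longrightarrow> El m \<subseteq> El n \<Longrightarrow> agree m x y" by (auto simp: agree_def)

abbreviation run :: "'v \<Rightarrow> bool" where "run r \<equiv> fn r w w"

end

locale coded = zf_omega mem w for mem :: "'v \<Rightarrow> 'v \<Rightarrow> bool" and w :: 'v +
  fixes cx cy :: 'v
  assumes bin_c: "e \<in> W \<Longrightarrow> bin (cx \<cdot> e)" "e \<in> W \<Longrightarrow> bin (cy \<cdot> e)"
    and code_ex: "bin x \<Longrightarrow> bin y \<Longrightarrow> n \<in> W \<Longrightarrow> \<exists>e\<in>W. n \<in> El e \<and> agree n (cx \<cdot> e) x \<and> agree n (cy \<cdot> e) y"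
begin

text \<open>
  The move \<open>e\<close> fixes the positions below the number \<open>e\<close> that no earlier move has fixed, with the
  digits found there in \<open>cx \<cdot> e\<close> and \<open>cy \<cdot> e\<close>.
\<close>

definition decodes :: "'v \<Rightarrow> 'v \<Rightarrow> 'v \<Rightarrow> bool" where
  "decodes r x y \<longleftrightarrow> (\<forall>k\<in>W. \<exists>j\<in>W. k \<in> El (r \<cdot> j) \<and> (\<forall>j'\<in>El j. k \<notin> El (r \<cdot> j')) \<and>
     x \<cdot> k = cx \<cdot> (r \<cdot> j) \<cdot> k \<and> y \<cdot> k = cy \<cdot> (r \<cdot> j) \<cdot> k)"

text \<open>The turn that fixes k is the first one whose move exceeds k, hence is determined by the
  run.\<close>

lemma decodes_unique:
  assumes "decodes r x y" "decodes r x' y'" "bin x" "bin y" "bin x'" "bin y'"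
  shows "x = x'" "y = y'"
proof -
  have "x \<cdot> k = x' \<cdot> k \<and> y \<cdot> k = y' \<cdot> k" if k: "k \<in> W" for k
  proof -
    obtain j where j: "j \<in> W" "k \<in> El (r \<cdot> j)" "\<forall>j'\<in>El j. k \<notin> El (r \<cdot> j')"
      "x \<cdot> k = cx \<cdot> (r \<cdot> j) \<cdot> k" "y \<cdot> k = cy \<cdot> (r \<cdot> j) \<cdot> k"
      using assms(1) k unfolding decodes_def by blast
    obtain i where i: "i \<in> W" "k \<in> El (r \<cdot> i)" "\<forall>j'\<in>El i. k \<notin> El (r \<cdot> j')"
      "x' \<cdot> k = cx \<cdot> (r \<cdot> i) \<cdot> k" "y' \<cdot> k = cy \<cdot> (r \<cdot> i) \<cdot> k"
      using assms(2) k unfolding decodes_def by blast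
    have "i = j" using W_linear[OF i(1) j(1)] i j by blast
    with i j show ?thesis by simp
  qed
  with assms show "x = x'" "y = y'" by (auto intro: fn_ext)
qed

lemma dfn_decodes [dfn_intros]: "tdef r \<Longrightarrow> tdef x \<Longrightarrow> tdef y \<Longrightarrow> dfn (\<lambda>e. decodes (r e) (x e) (y e))"
  by (rule dfn_subst3, unfold decodes_def, intro dfn_intros)

end

text \<open>
  The player following \<open>\<tau>\<close> moves at the turns in \<open>T\<close>. The opponent's first turn is \<open>i0\<close> (0 or 1), and
  \<open>n0\<close> bounds what \<open>\<tau>\<close> has played before. Positions below \<open>n0\<close> are ignored in \<open>consistent\<close>, so that
  such an opening does not restrict to an open set.
\<close>

locale strategy = coded mem w cx cy for mem :: "'v \<Rightarrow> 'v \<Rightarrow> bool" and w cx cy :: 'v +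
  fixes T \<tau> Dq n0 i0 r0 :: 'v
  assumes finseqs: "is_finseqs mem w Dq" and \<tau>: "fn \<tau> Dq w"
    and T: "El T \<subseteq> W" "\<And>n. n \<in> W \<Longrightarrow> suc n \<in> El T \<longleftrightarrow> n \<notin> El T"
    and i0: "i0 \<in> W" "i0 \<notin> El T" "El i0 \<subseteq> El T" "run r0" "n0 \<in> W"
      "\<And>j. j \<in> El i0 \<Longrightarrow> El (r0 \<cdot> j) \<subseteq> El n0"
      "\<And>j. j \<in> El i0 \<Longrightarrow> r0 \<cdot> j = \<tau> \<cdot> restr r0 j"
begin

lemma \<tau>_W: "run r \<Longrightarrow> n \<in> W \<Longrightarrow> restr r n \<in> El Dq" "run r \<Longrightarrow> n \<in> W \<Longrightarrow> \<tau> \<cdot> restr r n \<in> W"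
proof -
  assume "run r" "n \<in> W"
  then show "restr r n \<in> El Dq" using fn_restr finseqs unfolding is_finseqs_def by blast
  then show "\<tau> \<cdot> restr r n \<in> W" by (rule fn_app[OF \<tau>])
qed

definition consistent :: "'v \<Rightarrow> 'v \<Rightarrow> 'v \<Rightarrow> 'v \<Rightarrow> bool" where
  "consistent i r x y \<longleftrightarrow> (\<forall>j\<in>El i. \<forall>k\<in>El (r \<cdot> j). k \<notin> El n0 \<and> (\<forall>j'\<in>El j. k \<notin> El (r \<cdot> j')) \<longrightarrow>
     x \<cdot> k = cx \<cdot> (r \<cdot> j) \<cdot> k \<and> y \<cdot> k = cy \<cdot> (r \<cdot> j) \<cdot> k)"

text \<open>
  At turn \<open>j\<close> the opponent can play \<open>a\<close> so that this move and the answer of \<open>\<tau>\<close> are bounded by \<open>m\<close> and agree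
  with \<open>(x, y)\<close>.
\<close>

definition good :: "'v \<Rightarrow> 'v \<Rightarrow> 'v \<Rightarrow> 'v \<Rightarrow> 'v \<Rightarrow> 'v \<Rightarrow> bool" where
  "good j m a r x y \<longleftrightarrow> El a \<subseteq> El m \<and> j \<in> El a \<and> (\<exists>r'. run r' \<and> agree j r' r \<and> r' \<cdot> j = a \<and>
     r' \<cdot> suc j = \<tau> \<cdot> restr r' (suc j) \<and> El (r' \<cdot> suc j) \<subseteq> El m \<and> consistent (suc (suc j)) r' x y)"

text \<open>
  The opponent minimises the bound \<open>m\<close> before the move. Taking simply the least move that works
  would not do: whether a smaller move works may depend on digits far beyond those seen so far.
\<close>

definition greedy_step :: "'v \<Rightarrow> 'v \<Rightarrow> 'v \<Rightarrow> 'v \<Rightarrow> bool" where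
  "greedy_step j r x y \<longleftrightarrow> (\<exists>m\<in>W. good j m (r \<cdot> j) r x y \<and> (\<forall>m'\<in>El m. \<forall>a\<in>W. \<not> good j m' a r x y) \<and>
     (\<forall>a\<in>El (r \<cdot> j). \<not> good j m a r x y))"

text \<open>A play of length \<open>i\<close> is represented by a total run of which only the moves
  before turn \<open>i\<close> matter.\<close>

definition greedy :: "'v \<Rightarrow> 'v \<Rightarrow> 'v \<Rightarrow> 'v \<Rightarrow> bool" where
  "greedy i r x y \<longleftrightarrow> run r \<and> (\<forall>j\<in>El i. j \<in> El T \<longrightarrow> r \<cdot> j = \<tau> \<cdot> restr r j) \<and> consistent i r x y \<and>
     (\<forall>j\<in>El i. j \<notin> El T \<longrightarrow> greedy_step j r x y)"

definition bounded :: "'v \<Rightarrow> 'v \<Rightarrow> 'v \<Rightarrow> bool" where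
  "bounded i r n \<longleftrightarrow> (\<forall>j\<in>El i. El (r \<cdot> j) \<subseteq> El n)"

text \<open>This is the dense open set number \<open>i\<close>: the first \<open>n\<close> digits
  suffice to see a greedy play of length at least \<open>i\<close>. As it stops at a turn of the
  opponent, each of the opponent's moves has been answered.\<close>

definition reach :: "'v \<Rightarrow> 'v \<Rightarrow> 'v \<Rightarrow> 'v \<Rightarrow> bool" where
  "reach i x y n \<longleftrightarrow> (\<exists>i'\<in>W. El i \<subseteq> El i' \<and> i' \<notin> El T \<and> (\<exists>r. greedy i' r x y \<and> bounded i' r n))"

lemma dfn_consistent [dfn_intros]:
  "tdef i \<Longrightarrow> tdef r \<Longrightarrow> tdef x \<Longrightarrow> tdef y \<Longrightarrow> dfn (\<lambda>e. consistent (i e) (r e) (x e) (y e))"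
  by (rule dfn_subst4, unfold consistent_def, intro dfn_intros)

lemma dfn_good_m: "dfn (\<lambda>e. \<exists>a\<in>W. good j (e 0) a r x y)"
  unfolding good_def by (intro dfn_intros)

lemma dfn_good_a: "dfn (\<lambda>e. good j m (e 0) r x y)"
  unfolding good_def by (intro dfn_intros)

lemma dfn_greedy [dfn_intros]:
  "tdef i \<Longrightarrow> tdef r \<Longrightarrow> tdef x \<Longrightarrow> tdef y \<Longrightarrow> dfn (\<lambda>e. greedy (i e) (r e) (x e) (y e))"
  by (rule dfn_subst4, unfold greedy_def greedy_step_def good_def, intro dfn_intros)

lemma dfn_reach [dfn_intros]:
  "tdef i \<Longrightarrow> tdef r \<Longrightarrow> tdef x \<Longrightarrow> tdef y \<Longrightarrow> dfn (\<lambda>e. reach (i e) (r e) (x e) (y e))"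
  by (rule dfn_subst4, unfold reach_def bounded_def, intro dfn_intros)

section \<open>Greedy plays: openness, uniqueness and density\<close>

lemma consistent_cong:
  assumes "consistent i r x y" "bounded i r n" "agree n x x'" "agree n y y'"
  shows "consistent i r x' y'"
proof -
  have "x \<cdot> k = x' \<cdot> k \<and> y \<cdot> k = y' \<cdot> k" if "j \<in> El i" "k \<in> El (r \<cdot> j)" for j k
    using assms(2-) that unfolding bounded_def agree_def by blast
  with assms(1) show ?thesis unfolding consistent_def by metis
qed

lemma consistent_mono: "consistent i r x y \<Longrightarrow> El j \<subseteq> El i \<Longrightarrow> consistent j r x y"
  unfolding consistent_def by blast

text \<open>If \<open>m\<close> and the earlier moves are at most \<open>n\<close>, the moves
  concerned fix no position from \<open>n\<close> on, so only the first \<open>n\<close> digits of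
  the pair are consulted.\<close>

lemma good_cong:
  assumes "good j m a r x y" "El m \<subseteq> El n" "j \<in> W" "bounded j r n" "agree n x x'" "agree n y y'"
  shows "good j m a r x' y'"
proof -
  obtain r' where r': "run r'" "agree j r' r" "r' \<cdot> j = a" "r' \<cdot> suc j = \<tau> \<cdot> restr r' (suc j)"
    "El (r' \<cdot> suc j) \<subseteq> El m" "consistent (suc (suc j)) r' x y" and a: "El a \<subseteq> El m" "j \<in> El a"
    using assms(1) unfolding good_def by blast
  have "bounded (suc (suc j)) r' n"
    using r' a assms(2,4) unfolding bounded_def agree_def by auto
  from consistent_cong[OF r'(6) this assms(5,6)] r' a show ?thesis unfolding good_def by blast
qed

lemma good_agree: "good j m a r x y \<Longrightarrow> agree j r r' \<Longrightarrow> good j m a r' x y"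
  unfolding good_def using agree_trans by blast

text \<open>Turns alternate, and \<open>i\<close> belongs to the opponent, so \<open>i\<close>
  cannot be the turn right after \<open>j\<close>.\<close>

lemma greedy_suc:
  assumes "i \<in> W" "i \<notin> El T" "j \<in> El i" "j \<notin> El T"
  shows "suc j \<in> El i" "suc j \<in> El T" "El (suc (suc j)) \<subseteq> El i"
proof -
  have j: "j \<in> W" using assms W_El by blast
  then show "suc j \<in> El T" using T assms by blast
  with suc_mono[OF assms(1,3)] assms(2) show "suc j \<in> El i" by auto
  then show "El (suc (suc j)) \<subseteq> El i" using W_trans[OF assms(1), of "suc j"] by auto
qed

text \<open>The play itself shows that the bound \<open>n\<close> would do at turn \<open>j\<close>;
  hence the minimal bound is at most \<open>n\<close>.\<close>

lemma greedy_step_bound: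
  assumes G: "greedy i r x y" and i: "i \<in> W" "i \<notin> El T" and j: "j \<in> El i" "j \<notin> El T" and n: "n \<in> W" "bounded i r n"
  obtains m where "m \<in> W" "El m \<subseteq> El n" "good j m (r \<cdot> j) r x y"
    "\<forall>m'\<in>El m. \<forall>a\<in>W. \<not> good j m' a r x y" "\<forall>a\<in>El (r \<cdot> j). \<not> good j m a r x y"
proof -
  obtain m where m: "m \<in> W" "good j m (r \<cdot> j) r x y"
    "\<forall>m'\<in>El m. \<forall>a\<in>W. \<not> good j m' a r x y" "\<forall>a\<in>El (r \<cdot> j). \<not> good j m a r x y"
    using G j unfolding greedy_def greedy_step_def by blast
  have r: "run r" using G unfolding greedy_def by blast
  have jW: "j \<in> W" using i j W_El by blast
  note s = greedy_suc[OF i j]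
  have "good j n (r \<cdot> j) r x y"
    unfolding good_def
  proof (intro conjI exI[of _ r])
    show "El (r \<cdot> j) \<subseteq> El n" "El (r \<cdot> suc j) \<subseteq> El n" using n(2) j(1) s(1) unfolding bounded_def by blast+
    show "j \<in> El (r \<cdot> j)" using m(2) unfolding good_def by blast
    show "r \<cdot> suc j = \<tau> \<cdot> restr r (suc j)" using G s unfolding greedy_def by blast
    show "consistent (suc (suc j)) r x y" using G s(3) consistent_mono unfolding greedy_def by blast
  qed (simp_all add: r)
  then have "n \<notin> El m" using m(3) fn_app[OF r jW] by blast
  then have "El m \<subseteq> El n" using not_in_iff n(1) m(1) by blast
  with m that show thesis by blast
qed

text \<open>The minimality conditions compare only candidates with bounds up to \<open>m\<close>,
  hence up to \<open>n\<close>, and for these goodness is insensitive to digits from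
  \<open>n\<close> on.\<close>

lemma greedy_cong:
  assumes G: "greedy i r x y" and i: "i \<in> W" "i \<notin> El T" and n: "n \<in> W" "bounded i r n"
    and agree: "agree n x x'" "agree n y y'"
  shows "greedy i r x' y'"
proof -
  have "greedy_step j r x' y'" if j: "j \<in> El i" "j \<notin> El T" for j
  proof -
    obtain m where m: "m \<in> W" "El m \<subseteq> El n" "good j m (r \<cdot> j) r x y"
      "\<forall>m'\<in>El m. \<forall>a\<in>W. \<not> good j m' a r x y" "\<forall>a\<in>El (r \<cdot> j). \<not> good j m a r x y"
      by (rule greedy_step_bound[OF G i j n])
    have jW: "j \<in> W" using i j W_El by blast
    have b: "bounded j r n" using n(2) W_trans[OF i(1) j(1)] unfolding bounded_def by blast
    have eq: "good j m' a r x y \<longleftrightarrow> good j m' a r x' y'" if "El m' \<subseteq> El n" for m' a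
      using good_cong[OF _ that jW b] agree agree_sym by blast
    have "El m' \<subseteq> El n" if "m' \<in> El m" for m' using W_trans[OF m(1) that] m(2) by blast
    with m eq show ?thesis unfolding greedy_step_def by blast
  qed
  moreover have "consistent i r x' y'" using G consistent_cong[OF _ n(2) agree] unfolding greedy_def by blast
  ultimately show ?thesis using G unfolding greedy_def by blast
qed

text \<open>Strong induction on the turn: a move of \<tau> is determined by the earlier moves, a
  move of the opponent by minimality of the bound and then of the move.\<close>

lemma greedy_unique:
  assumes G: "greedy i r x y" "greedy i' r' x y" and i: "i \<in> W" "i' \<in> W" and j: "j \<in> El i" "j \<in> El i'"
  shows "r \<cdot> j = r' \<cdot> j"
proof -
  have r: "run r" "run r'" using G unfolding greedy_def by blast+
  have "dfn (\<lambda>e. e 0 \<in> El i \<longrightarrow> e 0 \<in> El i' \<longrightarrow> r \<cdot> e 0 = r' \<cdot> e 0)" by (intro dfn_intros)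
  from this W_El[OF i(1) j(1)] have "j \<in> El i \<longrightarrow> j \<in> El i' \<longrightarrow> r \<cdot> j = r' \<cdot> j"
  proof (rule strong_induct[where P = "\<lambda>j. j \<in> El i \<longrightarrow> j \<in> El i' \<longrightarrow> r \<cdot> j = r' \<cdot> j"], intro impI)
    fix j assume jW: "j \<in> W" and IH: "\<And>k. k \<in> El j \<Longrightarrow> k \<in> El i \<longrightarrow> k \<in> El i' \<longrightarrow> r \<cdot> k = r' \<cdot> k"
      and j: "j \<in> El i" "j \<in> El i'"
    have eq: "r \<cdot> k = r' \<cdot> k" if "k \<in> El j" for k
      using IH[OF that] W_trans[OF i(1) j(1)] W_trans[OF i(2) j(2)] that by blast
    then have agree: "agree j r r'" "agree j r' r" by (auto simp: agree_def)
    show "r \<cdot> j = r' \<cdot> j"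
    proof (cases "j \<in> El T")
      case True
      then show ?thesis using G j restr_cong[OF r jW eq] unfolding greedy_def by auto
    next
      case False
      have rj: "r \<cdot> j \<in> W" "r' \<cdot> j \<in> W" using fn_app r jW by blast+
      obtain m where m: "m \<in> W" "good j m (r \<cdot> j) r x y"
        "\<forall>m'\<in>El m. \<forall>a\<in>W. \<not> good j m' a r x y" "\<forall>a\<in>El (r \<cdot> j). \<not> good j m a r x y"
        using G(1) j False unfolding greedy_def greedy_step_def by blast
      obtain m' where m': "m' \<in> W" "good j m' (r' \<cdot> j) r' x y"
        "\<forall>m\<in>El m'. \<forall>a\<in>W. \<not> good j m a r' x y" "\<forall>a\<in>El (r' \<cdot> j). \<not> good j m' a r' x y"
        using G(2) j False unfolding greedy_def greedy_step_def by blast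
      have "m = m'"
        using W_linear[OF m(1) m'(1)] m m' good_agree agree rj by metis
      then show ?thesis using W_linear[OF rj] m m' good_agree agree by metis
    qed
  qed
  with j show ?thesis by blast
qed

text \<open>One continuation is obtained by playing a code of a long segment of (x, y) and changing
  the pair beyond \<open>n\<close> to match that move and the answer of \<tau>. For the new pair the
  greedy move may be a different one, but its bound is no larger.\<close>

lemma greedy_extend:
  assumes G: "greedy i r x y" and i: "i \<in> W" "i \<notin> El T" and n: "n \<in> W" "bounded i r n" and xy: "bin x" "bin y"
  obtains x' y' n' r' where "bin x'" "bin y'" "agree n x x'" "agree n y y'" "n' \<in> W" "El n \<subseteq> El n'"
    "greedy (suc (suc i)) r' x' y'" "bounded (suc (suc i)) r' n'"
proof -
  have r: "run r" using G unfolding greedy_def by blast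
  obtain n1 where n1: "n1 \<in> W" "El n \<subseteq> El n1" "El i \<subseteq> El n1" by (rule W_max[OF n(1) i(1)])
  obtain e where e: "e \<in> W" "n1 \<in> El e" "agree n1 (cx \<cdot> e) x" "agree n1 (cy \<cdot> e) y"
    using code_ex[OF xy n1(1)] by blast
  have n1e: "El n1 \<subseteq> El e" using W_trans e by blast
  have ie: "i \<in> El e" using not_in_iff[OF i(1) e(1)] n1(3) e(2) irrefl[of n1] by auto
  define t1 where "t1 j = (if j = i then e else r \<cdot> j)" for j
  have t1: "tdef (\<lambda>e. t1 (e 0))" unfolding t1_def by (intro dfn_intros)
  have t1W: "t1 j \<in> W" if "j \<in> W" for j unfolding t1_def using e(1) fn_app[OF r that] by simp
  have r1: "run (lam w t1)" "\<And>j. j \<in> W \<Longrightarrow> lam w t1 \<cdot> j = t1 j" using lam[OF t1 t1W] by blast+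
  define v where "v = \<tau> \<cdot> restr (lam w t1) (suc i)"
  have v: "v \<in> W" unfolding v_def using \<tau>_W[OF r1(1)] i(1) by simp
  define t2 where "t2 j = (if j = suc i then v else t1 j)" for j
  have t2: "tdef (\<lambda>e. t2 (e 0))" unfolding t2_def t1_def by (intro dfn_intros)
  have t2W: "t2 j \<in> W" if "j \<in> W" for j unfolding t2_def using v t1W[OF that] by simp
  define r2 where "r2 = lam w t2"
  have r2: "run r2" "\<And>j. j \<in> W \<Longrightarrow> r2 \<cdot> j = t2 j" unfolding r2_def using lam[OF t2 t2W] by blast+
  have r2i: "r2 \<cdot> i = e" "r2 \<cdot> suc i = v" using r2(2) i(1) by (auto simp: t2_def t1_def)
  have r2j: "r2 \<cdot> j = r \<cdot> j" if "j \<in> El i" for j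
  proof -
    have "j \<noteq> i" "j \<noteq> suc i" using that irrefl[of i] asym[of "suc i" i] by auto
    then show ?thesis using r2(2)[OF W_El[OF i(1) that]] by (simp add: t2_def t1_def)
  qed
  have r12: "restr (lam w t1) (suc i) = restr r2 (suc i)"
  proof (rule restr_cong[OF r1(1) r2(1)])
    show "suc i \<in> W" using i by simp
    show "lam w t1 \<cdot> k = r2 \<cdot> k" if "k \<in> El (suc i)" for k
    proof -
      have "k \<noteq> suc i" "k \<in> W" using that irrefl[of "suc i"] W_El[OF suc_W[OF i(1)] that] by auto
      then show ?thesis using r1(2) r2(2) by (simp add: t2_def)
    qed
  qed
  obtain n2 where n2: "n2 \<in> W" "El e \<subseteq> El n2" "El v \<subseteq> El n2" by (rule W_max[OF e(1) v])
  have nn2: "El n \<subseteq> El n2" using n1(2) n1e n2 by blast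
  \<comment> \<open>Below \<open>e\<close> the digits are those of the move, from \<open>e\<close>
    on those of the answer \<open>v\<close>; past both of them any digits would do.\<close>
  define s where "s c k = (if k \<in> El e then c \<cdot> e \<cdot> k else c \<cdot> v \<cdot> k)" for c k
  have s: "tdef (\<lambda>e. s c (e 0))" for c unfolding s_def by (intro dfn_intros)
  have s2: "s cx k \<in> El two" "s cy k \<in> El two" if "k \<in> W" for k
    unfolding s_def using fn_app[OF bin_c(1) that] fn_app[OF bin_c(2) that] e(1) v by auto
  define x2 where "x2 = lam two (s cx)"
  define y2 where "y2 = lam two (s cy)"
  have x2: "bin x2" "\<And>k. k \<in> W \<Longrightarrow> x2 \<cdot> k = s cx k" unfolding x2_def using lam[OF s s2(1)] by blast+
  have y2: "bin y2" "\<And>k. k \<in> W \<Longrightarrow> y2 \<cdot> k = s cy k" unfolding y2_def using lam[OF s s2(2)] by blast+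
  have a2: "agree n x x2" "agree n y y2"
    unfolding agree_def
  proof safe
    fix k assume k: "k \<in> El n"
    then have "k \<in> W" "k \<in> El n1" "k \<in> El e" using W_El[OF n(1)] n1(2) n1e by auto
    then show "x \<cdot> k = x2 \<cdot> k" "y \<cdot> k = y2 \<cdot> k"
      using x2(2) y2(2) e(3,4) by (auto simp: s_def agree_def)
  qed
  have G2: "greedy i r x2 y2" by (rule greedy_cong[OF G i n a2])
  have "consistent (suc (suc i)) r2 x2 y2"
    unfolding consistent_def
  proof (intro ballI impI)
    fix j k assume j: "j \<in> El (suc (suc i))" and k: "k \<in> El (r2 \<cdot> j)"
      and nc: "k \<notin> El n0 \<and> (\<forall>j'\<in>El j. k \<notin> El (r2 \<cdot> j'))"
    have jW: "j \<in> W" using W_El[OF _ j] i by simp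
    have kW: "k \<in> W" using W_El[OF fn_app[OF r2(1) jW] k] .
    consider "j = suc i" | "j = i" | "j \<in> El i" using j by auto
    then show "x2 \<cdot> k = cx \<cdot> (r2 \<cdot> j) \<cdot> k \<and> y2 \<cdot> k = cy \<cdot> (r2 \<cdot> j) \<cdot> k"
    proof cases
      case 1
      then have "k \<notin> El e" using nc r2i by auto
      then show ?thesis using 1 x2(2) y2(2) kW by (simp add: s_def r2i)
    next
      case 2
      then show ?thesis using k x2(2) y2(2) kW by (simp add: s_def r2i)
    next
      case 3
      have "\<forall>j'\<in>El j. k \<notin> El (r \<cdot> j')" using nc r2j W_trans[OF i(1) 3] by (metis subsetD)
      then show ?thesis using G2 3 k nc r2j[OF 3] unfolding greedy_def consistent_def by metis
    qed
  qed
  then have "good i n2 e r x2 y2"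
    unfolding good_def using n2 ie r2(1) r2i r12 v_def r2j by (auto simp: agree_def intro!: exI[of _ r2])
  then have "\<exists>a\<in>W. good i n2 a r x2 y2" using e(1) by blast
  \<comment> \<open>The move \<open>e\<close> has only shown that the search is nonempty. The
    extended play is the witness \<open>r3\<close> of the least choice, not
    \<open>r2\<close>.\<close>
  then obtain m where m: "m \<in> W" "\<exists>a\<in>W. good i m a r x2 y2"
    "\<And>k. k \<in> El m \<Longrightarrow> \<not> (\<exists>a\<in>W. good i k a r x2 y2)"
    using least[of "\<lambda>m. \<exists>a\<in>W. good i m a r x2 y2", OF dfn_good_m n2(1)] by blast
  have mn2: "El m \<subseteq> El n2" using m(3) \<open>\<exists>a\<in>W. good i n2 a r x2 y2\<close> not_in_iff[OF n2(1) m(1)] by blast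
  obtain a where a: "a \<in> W" "good i m a r x2 y2" "\<And>k. k \<in> El a \<Longrightarrow> \<not> good i m k r x2 y2"
    using m(2) least[of "\<lambda>a. good i m a r x2 y2", OF dfn_good_a] by blast
  obtain r3 where r3: "run r3" "agree i r3 r" "r3 \<cdot> i = a" "r3 \<cdot> suc i = \<tau> \<cdot> restr r3 (suc i)"
    "El (r3 \<cdot> suc i) \<subseteq> El m" "consistent (suc (suc i)) r3 x2 y2" and am: "El a \<subseteq> El m"
    using a(2) unfolding good_def by blast
  have good_eq: "good j m' a r x2 y2 \<longleftrightarrow> good j m' a r3 x2 y2" if "El j \<subseteq> El i" for j m' a
    using good_agree agree_mono[OF r3(2) that] agree_sym by blast
  have "greedy (suc (suc i)) r3 x2 y2"
    unfolding greedy_def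
  proof (intro conjI ballI impI)
    fix j assume j: "j \<in> El (suc (suc i))"
    have jW: "j \<in> W" using W_El[OF _ j] i by simp
    consider "j = suc i" | "j = i" | "j \<in> El i" using j by auto
    note c = this
    show "r3 \<cdot> j = \<tau> \<cdot> restr r3 j" if "j \<in> El T"
      using c
    proof cases
      case 3
      have "restr r3 j = restr r j"
        by (rule restr_cong[OF r3(1) r jW]) (use r3(2) W_trans[OF i(1) 3] in \<open>auto simp: agree_def\<close>)
      then show ?thesis using G2 3 that r3(2) unfolding greedy_def agree_def by simp
    qed (use r3 i that in auto)
    show "greedy_step j r3 x2 y2" if "j \<notin> El T"
      using c
    proof cases
      case 1
      then show ?thesis using that T(2)[OF i(1)] i(2) by blast
    next
      case 2
      then show ?thesis unfolding greedy_step_def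
        using m a r3(3) good_eq[OF order_refl] by metis
    next
      case 3
      have "r3 \<cdot> j = r \<cdot> j" using r3(2) 3 unfolding agree_def by blast
      moreover have "greedy_step j r x2 y2" using G2 3 that unfolding greedy_def by blast
      ultimately show ?thesis
        unfolding greedy_step_def using good_eq[OF W_trans[OF i(1) 3]] by simp
    qed
  qed (use r3 in auto)
  moreover have "bounded (suc (suc i)) r3 n2"
    unfolding bounded_def
  proof
    fix j assume "j \<in> El (suc (suc i))"
    then consider "j = suc i" | "j = i" | "j \<in> El i" by auto
    then show "El (r3 \<cdot> j) \<subseteq> El n2"
    proof cases
      case 3
      then show ?thesis using r3(2) n(2) nn2 unfolding agree_def bounded_def by auto
    qed (use r3 am mn2 in auto)
  qed
  ultimately show thesis using that x2(1) y2(1) a2 n2(1) nn2 by blast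
qed

lemma reach_cong: "reach i x y n \<Longrightarrow> n \<in> W \<Longrightarrow> agree n x x' \<Longrightarrow> agree n y y' \<Longrightarrow> reach i x' y' n"
  unfolding reach_def using greedy_cong by blast

lemma reach_mono: "reach i x y n \<Longrightarrow> El n \<subseteq> El n' \<Longrightarrow> El i' \<subseteq> El i \<Longrightarrow> reach i' x y n'"
  unfolding reach_def bounded_def by (meson order_trans)

text \<open>Induction on \<open>i\<close> with \<open>greedy_extend\<close>, which adds two turns.
  At the start the play is the opening \<open>r0\<close>, and the bound is raised to
  \<open>n0\<close> to cover it.\<close>

lemma reach_dense:
  assumes "i \<in> W" "bin x" "bin y" "n \<in> W"
  shows "\<exists>x' y' n'. bin x' \<and> bin y' \<and> n' \<in> W \<and> El n \<subseteq> El n' \<and> agree n x x' \<and> agree n y y' \<and> reach i x' y' n'"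
proof -
  have "dfn (\<lambda>e. \<exists>x' y' n'. bin x' \<and> bin y' \<and> n' \<in> W \<and> El n \<subseteq> El n' \<and> agree n x x' \<and> agree n y y' \<and> reach (e 0) x' y' n')"
    by (intro dfn_intros)
  from this assms(1) show ?thesis
  proof (rule W_induct[where P = "\<lambda>i. \<exists>x' y' n'. bin x' \<and> bin y' \<and> n' \<in> W \<and> El n \<subseteq> El n' \<and> agree n x x' \<and> agree n y y' \<and> reach i x' y' n'"])
    obtain n1 where n1: "n1 \<in> W" "El n \<subseteq> El n1" "El n0 \<subseteq> El n1" by (rule W_max[OF assms(4) i0(5)])
    have "greedy i0 r0 x y" unfolding greedy_def consistent_def using i0 by blast
    moreover have "bounded i0 r0 n1" using i0(6) n1(3) unfolding bounded_def by blast
    ultimately have "reach zero x y n1" unfolding reach_def using i0 by auto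
    then show "\<exists>x' y' n'. bin x' \<and> bin y' \<and> n' \<in> W \<and> El n \<subseteq> El n' \<and> agree n x x' \<and> agree n y y' \<and> reach zero x' y' n'"
      using n1 assms by (metis agree_refl)
  next
    fix i assume i: "i \<in> W" and IH: "\<exists>x' y' n'. bin x' \<and> bin y' \<and> n' \<in> W \<and> El n \<subseteq> El n' \<and> agree n x x' \<and> agree n y y' \<and> reach i x' y' n'"
    then obtain x1 y1 n1 i' r where 1: "bin x1" "bin y1" "n1 \<in> W" "El n \<subseteq> El n1" "agree n x x1" "agree n y y1"
      and i': "i' \<in> W" "El i \<subseteq> El i'" "i' \<notin> El T" "greedy i' r x1 y1" "bounded i' r n1"
      unfolding reach_def by blast
    obtain x2 y2 n2 r2 where 2: "bin x2" "bin y2" "agree n1 x1 x2" "agree n1 y1 y2" "n2 \<in> W" "El n1 \<subseteq> El n2"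
      "greedy (suc (suc i')) r2 x2 y2" "bounded (suc (suc i')) r2 n2"
      by (rule greedy_extend[OF i'(4,1,3) 1(3) i'(5) 1(1,2)])
    have "i \<in> El (suc i')" using W_linear[OF i i'(1)] i'(2) irrefl[of i'] by (metis El_suc insertCI subsetD)
    then have "El (suc i) \<subseteq> El (suc (suc i'))" using i'(2) by auto
    moreover have "suc (suc i') \<notin> El T" using i' T(2) by simp
    ultimately have "reach (suc i) x2 y2 n2" unfolding reach_def using 2 i'(1) suc_W by blast
    moreover have "agree n x x2" "agree n y y2"
      using agree_trans 1(5,6) agree_mono[OF 2(3) 1(4)] agree_mono[OF 2(4) 1(4)] by blast+
    ultimately show "\<exists>x' y' n'. bin x' \<and> bin y' \<and> n' \<in> W \<and> El n \<subseteq> El n' \<and> agree n x x' \<and> agree n y y' \<and> reach (suc i) x' y' n'"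
      using 2 1(4) by (meson order_trans)
  qed
qed

text \<open>Greedy plays of different lengths agree and thus form one run. Its moves cover every
  position because the opponent's move at turn j exceeds j. Below \<open>n0\<close> the opening may
  have fixed digits other than those of (x, y).\<close>

lemma reach_limit:
  assumes xy: "bin x" "bin y" and D: "\<And>i. i \<in> W \<Longrightarrow> \<exists>n\<in>W. reach i x y n"
  obtains r x' y' where "run r" "follows mem (El T) \<tau> r" "bin x'" "bin y'" "decodes r x' y'"
    "\<And>k. k \<in> W \<Longrightarrow> k \<notin> El n0 \<Longrightarrow> x' \<cdot> k = x \<cdot> k \<and> y' \<cdot> k = y \<cdot> k"
proof -
  have ex: "\<exists>i r. i \<in> W \<and> k \<in> El i \<and> greedy i r x y" if "k \<in> W" for k
    using D[OF suc_W[OF that]] unfolding reach_def by auto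
  define t where "t k = the1 (\<lambda>v. \<exists>i r. i \<in> W \<and> k \<in> El i \<and> greedy i r x y \<and> v = r \<cdot> k)" for k
  have t: "t k = r \<cdot> k" if "i \<in> W" "k \<in> El i" "greedy i r x y" for i k r
    unfolding t_def
  proof (rule the1_eq)
    show "\<exists>i r'. i \<in> W \<and> k \<in> El i \<and> greedy i r' x y \<and> r \<cdot> k = r' \<cdot> k" using that by blast
    show "v = r \<cdot> k" if "\<exists>i r. i \<in> W \<and> k \<in> El i \<and> greedy i r x y \<and> v = r \<cdot> k" for v
      using that greedy_unique \<open>i \<in> W\<close> \<open>k \<in> El i\<close> \<open>greedy i r x y\<close> by blast
  qed
  have td: "tdef (\<lambda>e. t (e 0))" unfolding t_def by (intro dfn_intros)
  have tW: "t k \<in> W" if k: "k \<in> W" for k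
  proof -
    obtain i r where "i \<in> W" "k \<in> El i" "greedy i r x y" using ex[OF k] by blast
    with t fn_app[of r w w k] k show ?thesis unfolding greedy_def by simp
  qed
  define r where "r = lam w t"
  have r: "run r" "\<And>k. k \<in> W \<Longrightarrow> r \<cdot> k = t k" unfolding r_def using lam[OF td tW] by blast+
  have rr: "r \<cdot> k = r' \<cdot> k" if "i \<in> W" "k \<in> El i" "greedy i r' x y" for i k r'
    using t[OF that] r(2)[OF W_El[OF that(1,2)]] by simp
  have "follows mem (El T) \<tau> r"
    unfolding follows_def is_restr_iff
  proof
    fix n assume n: "n \<in> El T"
    then have nW: "n \<in> W" using T by blast
    then obtain i r' where i: "i \<in> W" "n \<in> El i" "greedy i r' x y" using ex by blast
    have "restr r n = restr r' n"
      by (rule restr_cong[of _ w]) (use i r(1) nW rr[OF i(1) _ i(3)] W_trans[OF i(1,2)] in \<open>auto simp: greedy_def\<close>)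
    then have "r \<cdot> n = \<tau> \<cdot> restr r n" using i n rr[OF i] unfolding greedy_def by simp
    then show "\<exists>s v. s = restr r n \<and> rel mem \<tau> s v \<and> rel mem r n v"
      using fn_rel[OF \<tau>] fn_rel[OF r(1)] \<tau>_W(1)[OF r(1) nW] nW by blast
  qed
  have cov_ex: "\<exists>j\<in>W. k \<in> El (r \<cdot> j) \<and> (\<forall>j'\<in>El j. k \<notin> El (r \<cdot> j'))" if k: "k \<in> W" for k
  proof -
    \<comment> \<open>An opponent's turn not before k: either k or its successor.\<close>
    obtain j where j: "j \<in> W" "j \<notin> El T" "El k \<subseteq> El j"
    proof (cases "k \<in> El T")
      case True
      then have "suc k \<notin> El T" using T(2)[OF k] by blast
      then show ?thesis using that[of "suc k"] k by auto
    qed (use that k in blast)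
    obtain i r' where i: "i \<in> W" "j \<in> El i" "greedy i r' x y" using ex[OF j(1)] by blast
    then have "j \<in> El (r' \<cdot> j)" using j(2) unfolding greedy_def greedy_step_def good_def by blast
    then have "j \<in> El (r \<cdot> j)" using rr[OF i] by simp
    then have "k \<in> El (r \<cdot> j)"
      using j(3) not_in_iff[OF k fn_app[OF r(1) j(1)]] irrefl[of j] by auto
    moreover have "dfn (\<lambda>e. k \<in> El (r \<cdot> e 0))" by (intro dfn_intros)
    ultimately show ?thesis using least[of "\<lambda>j. k \<in> El (r \<cdot> j)"] j(1) by metis
  qed
  define cov where "cov k = the1 (\<lambda>j. j \<in> W \<and> k \<in> El (r \<cdot> j) \<and> (\<forall>j'\<in>El j. k \<notin> El (r \<cdot> j')))" for k
  have cov: "cov k \<in> W" "k \<in> El (r \<cdot> cov k)" "\<forall>j'\<in>El (cov k). k \<notin> El (r \<cdot> j')" if k: "k \<in> W" for k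
  proof -
    obtain j where j: "j \<in> W" "k \<in> El (r \<cdot> j)" "\<forall>j'\<in>El j. k \<notin> El (r \<cdot> j')"
      using cov_ex[OF k] by blast
    have "cov k = j" unfolding cov_def by (rule the1_eq) (use j W_linear in blast)+
    with j show "cov k \<in> W" "k \<in> El (r \<cdot> cov k)" "\<forall>j'\<in>El (cov k). k \<notin> El (r \<cdot> j')" by simp_all
  qed
  have tdc: "tdef (\<lambda>e. c \<cdot> (r \<cdot> cov (e 0)) \<cdot> e 0)" for c unfolding cov_def by (intro dfn_intros)
  have rcW: "r \<cdot> cov k \<in> W" if "k \<in> W" for k using fn_app[OF r(1)] cov(1) that by blast
  have cW: "cx \<cdot> (r \<cdot> cov k) \<cdot> k \<in> El two" "cy \<cdot> (r \<cdot> cov k) \<cdot> k \<in> El two" if k: "k \<in> W" for k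
    using fn_app[OF bin_c(1)[OF rcW[OF k]] k] fn_app[OF bin_c(2)[OF rcW[OF k]] k] .
  define x' where "x' = lam two (\<lambda>k. cx \<cdot> (r \<cdot> cov k) \<cdot> k)"
  define y' where "y' = lam two (\<lambda>k. cy \<cdot> (r \<cdot> cov k) \<cdot> k)"
  have x': "bin x'" "\<And>k. k \<in> W \<Longrightarrow> x' \<cdot> k = cx \<cdot> (r \<cdot> cov k) \<cdot> k"
    unfolding x'_def using lam[OF tdc cW(1)] by blast+
  have y': "bin y'" "\<And>k. k \<in> W \<Longrightarrow> y' \<cdot> k = cy \<cdot> (r \<cdot> cov k) \<cdot> k"
    unfolding y'_def using lam[OF tdc cW(2)] by blast+
  have "decodes r x' y'"
    unfolding decodes_def using cov x'(2) y'(2) by blast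
  moreover have "x' \<cdot> k = x \<cdot> k \<and> y' \<cdot> k = y \<cdot> k" if k: "k \<in> W" "k \<notin> El n0" for k
  proof -
    obtain i r' where i: "i \<in> W" "cov k \<in> El i" "greedy i r' x y" using ex[OF cov(1)[OF k(1)]] by blast
    have "r \<cdot> j = r' \<cdot> j" if "j \<in> El (suc (cov k))" for j
      using rr[OF i(1) _ i(3)] that i(2) W_trans[OF i(1,2)] by auto
    then have "k \<in> El (r' \<cdot> cov k)" "\<forall>j'\<in>El (cov k). k \<notin> El (r' \<cdot> j')" "r \<cdot> cov k = r' \<cdot> cov k"
      using cov(2,3)[OF k(1)] by auto
    then show ?thesis using i(2,3) k x'(2) y'(2) unfolding greedy_def consistent_def by simp
  qed
  ultimately show thesis using that r(1) \<open>follows mem (El T) \<tau> r\<close> x'(1) y'(1) by blast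
qed

end

section \<open>Fusion\<close>

context zf_omega
begin

lemma dfn_E0 [dfn_intros]: "tdef x \<Longrightarrow> tdef y \<Longrightarrow> dfn (\<lambda>e. E0 mem w (x e) (y e))"
  by (rule dfn_subst2, unfold E0_def, intro dfn_intros)

lemma E0_iff:
  assumes "bin x" "bin y"
  shows "E0 mem w x y \<longleftrightarrow> (\<exists>n\<in>W. \<forall>k\<in>W. n \<in> El k \<longrightarrow> x \<cdot> k = y \<cdot> k)"
  unfolding E0_def using fn_rel[OF assms(1)] fn_rel[OF assms(2)] by simp

text \<open>
  \<open>D i x y n\<close> says that the basic neighbourhood of \<open>(x, y)\<close> given by the first \<open>n\<close> digits lies in the \<open>i\<close>th set of a
  decreasing sequence of dense open sets.
\<close>

definition dense_family :: "('v \<Rightarrow> 'v \<Rightarrow> 'v \<Rightarrow> 'v \<Rightarrow> bool) \<Rightarrow> bool" where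
  "dense_family D \<longleftrightarrow> dfn (\<lambda>e. D (e 0) (e (Suc 0)) (e (Suc (Suc 0))) (e (Suc (Suc (Suc 0))))) \<and>
     (\<forall>i x y n x' y'. n \<in> W \<longrightarrow> D i x y n \<longrightarrow> agree n x x' \<longrightarrow> agree n y y' \<longrightarrow> D i x' y' n) \<and>
     (\<forall>i x y n i' n'. D i x y n \<longrightarrow> El n \<subseteq> El n' \<longrightarrow> El i' \<subseteq> El i \<longrightarrow> D i' x y n') \<and>
     (\<forall>i\<in>W. \<forall>x y. \<forall>n\<in>W. bin x \<longrightarrow> bin y \<longrightarrow>
       (\<exists>x' y'. \<exists>n'\<in>W. bin x' \<and> bin y' \<and> El n \<subseteq> El n' \<and> agree n x x' \<and> agree n y y' \<and> D i x' y' n'))"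

lemma dense_familyI:
  assumes "dfn (\<lambda>e. D (e 0) (e (Suc 0)) (e (Suc (Suc 0))) (e (Suc (Suc (Suc 0)))))"
    "\<And>i x y n x' y'. n \<in> W \<Longrightarrow> D i x y n \<Longrightarrow> agree n x x' \<Longrightarrow> agree n y y' \<Longrightarrow> D i x' y' n"
    "\<And>i x y n i' n'. D i x y n \<Longrightarrow> El n \<subseteq> El n' \<Longrightarrow> El i' \<subseteq> El i \<Longrightarrow> D i' x y n'"
    "\<And>i x y n. i \<in> W \<Longrightarrow> n \<in> W \<Longrightarrow> bin x \<Longrightarrow> bin y \<Longrightarrow>
       \<exists>x' y'. \<exists>n'\<in>W. bin x' \<and> bin y' \<and> El n \<subseteq> El n' \<and> agree n x x' \<and> agree n y y' \<and> D i x' y' n'"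
  shows "dense_family D"
  unfolding dense_family_def
proof (intro conjI ballI allI impI)
  show "dfn (\<lambda>e. D (e 0) (e (Suc 0)) (e (Suc (Suc 0))) (e (Suc (Suc (Suc 0)))))" by (rule assms(1))
qed (fact assms(2-))+

lemma
  assumes "dense_family D"
  shows dense_family_dfn: "dfn (\<lambda>e. D (e 0) (e (Suc 0)) (e (Suc (Suc 0))) (e (Suc (Suc (Suc 0)))))"
    and dense_family_cong: "n \<in> W \<Longrightarrow> D i x y n \<Longrightarrow> agree n x x' \<Longrightarrow> agree n y y' \<Longrightarrow> D i x' y' n"
    and dense_family_mono: "D i x y n \<Longrightarrow> El n \<subseteq> El n' \<Longrightarrow> El i' \<subseteq> El i \<Longrightarrow> D i' x y n'"
    and dense_family_dense: "i \<in> W \<Longrightarrow> n \<in> W \<Longrightarrow> bin x \<Longrightarrow> bin y \<Longrightarrow>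
       \<exists>x' y'. \<exists>n'\<in>W. bin x' \<and> bin y' \<and> El n \<subseteq> El n' \<and> agree n x x' \<and> agree n y y' \<and> D i x' y' n'"
proof -
  note * = assms[unfolded dense_family_def]
  show "dfn (\<lambda>e. D (e 0) (e (Suc 0)) (e (Suc (Suc 0))) (e (Suc (Suc (Suc 0)))))"
    by (rule *[THEN conjunct1])
qed (erule (3) assms[unfolded dense_family_def, THEN conjunct2, THEN conjunct1, rule_format]
    | erule (2) assms[unfolded dense_family_def, THEN conjunct2, THEN conjunct2, THEN conjunct1, rule_format]
    | erule (3) assms[unfolded dense_family_def, THEN conjunct2, THEN conjunct2, THEN conjunct2, rule_format])+

text \<open>Extend into the first set and then into the second; openness of the first keeps the
  result inside it.\<close>

lemma dense_family_conj:
  assumes "dense_family D" "dense_family D'"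
  shows "dense_family (\<lambda>i x y n. D i x y n \<and> D' i x y n)"
proof (rule dense_familyI)
  show "dfn (\<lambda>e. D (e 0) (e (Suc 0)) (e (Suc (Suc 0))) (e (Suc (Suc (Suc 0)))) \<and>
      D' (e 0) (e (Suc 0)) (e (Suc (Suc 0))) (e (Suc (Suc (Suc 0)))))"
    by (rule dfn_conj[OF dense_family_dfn[OF assms(1)] dense_family_dfn[OF assms(2)]])
  show "D i x' y' n \<and> D' i x' y' n"
    if "n \<in> W" "D i x y n \<and> D' i x y n" "agree n x x'" "agree n y y'" for i x y n x' y'
    using that dense_family_cong[OF assms(1)] dense_family_cong[OF assms(2)] by blast
  show "D i' x y n' \<and> D' i' x y n'"
    if "D i x y n \<and> D' i x y n" "El n \<subseteq> El n'" "El i' \<subseteq> El i" for i x y n i' n'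
    using that dense_family_mono[OF assms(1)] dense_family_mono[OF assms(2)] by blast
  fix i x y n assume i: "i \<in> W" and n: "n \<in> W" and xy: "bin x" "bin y"
  obtain x1 y1 n1 where 1: "n1 \<in> W" "bin x1" "bin y1" "El n \<subseteq> El n1" "agree n x x1" "agree n y y1" "D i x1 y1 n1"
    using dense_family_dense[OF assms(1) i n xy] by blast
  obtain x2 y2 n2 where 2: "n2 \<in> W" "bin x2" "bin y2" "El n1 \<subseteq> El n2" "agree n1 x1 x2" "agree n1 y1 y2" "D' i x2 y2 n2"
    using dense_family_dense[OF assms(2) i 1(1-3)] by blast
  have "D i x2 y2 n2"
    by (rule dense_family_mono[OF assms(1) dense_family_cong[OF assms(1) 1(1,7) 2(5,6)] 2(4) order_refl])
  moreover have "agree n x x2" "agree n y y2"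
    using agree_trans[OF 1(5) agree_mono[OF 2(5) 1(4)]] agree_trans[OF 1(6) agree_mono[OF 2(6) 1(4)]] .
  moreover have "El n \<subseteq> El n2" using 1(4) 2(4) by blast
  ultimately show "\<exists>x' y'. \<exists>n'\<in>W. bin x' \<and> bin y' \<and> El n \<subseteq> El n' \<and> agree n x x' \<and> agree n y y' \<and> D i x' y' n' \<and> D' i x' y' n'"
    using 2 by blast
qed

lemma dense_family_swap:
  assumes "dense_family D"
  shows "dense_family (\<lambda>i x y. D i y x)"
proof (rule dense_familyI)
  show "dfn (\<lambda>e. D (e 0) (e (Suc (Suc 0))) (e (Suc 0)) (e (Suc (Suc (Suc 0)))))"
    by (intro dfn_subst4[OF dense_family_dfn[OF assms]] dfn_intros)
  show "D i y' x' n" if "n \<in> W" "D i y x n" "agree n x x'" "agree n y y'" for i x y n x' y'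
    using that dense_family_cong[OF assms] by blast
  show "D i' y x n'" if "D i y x n" "El n \<subseteq> El n'" "El i' \<subseteq> El i" for i x y n i' n'
    using that dense_family_mono[OF assms] by blast
  show "\<exists>x' y'. \<exists>n'\<in>W. bin x' \<and> bin y' \<and> El n \<subseteq> El n' \<and> agree n x x' \<and> agree n y y' \<and> D i y' x' n'"
    if "i \<in> W" "n \<in> W" "bin x" "bin y" for i x y n
    using dense_family_dense[OF assms that(1,2,4,3)] by blast
qed

definition upd :: "'v \<Rightarrow> 'v \<Rightarrow> 'v \<Rightarrow> 'v" where
  "upd x j a = lam two (\<lambda>k. if k = j then a else x \<cdot> k)"

lemma upd:
  assumes "bin x" "a \<in> El two"
  shows "bin (upd x j a)" "k \<in> W \<Longrightarrow> upd x j a \<cdot> k = (if k = j then a else x \<cdot> k)"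
proof -
  have "tdef (\<lambda>e. if e 0 = j then a else x \<cdot> e 0)" by (intro dfn_intros)
  moreover have "(if k = j then a else x \<cdot> k) \<in> El two" if "k \<in> W" for k
    using fn_app[OF assms(1) that] assms(2) by auto
  ultimately show "bin (upd x j a)" "k \<in> W \<Longrightarrow> upd x j a \<cdot> k = (if k = j then a else x \<cdot> k)"
    unfolding upd_def using lam[of "\<lambda>k. if k = j then a else x \<cdot> k" two] by blast+
qed

text \<open>
  One extension of \<open>(u, v)\<close> works for all initial segments of length \<open>j\<close>: by induction on \<open>j\<close>, treating the four
  possible pairs of last digits one after the other.
\<close>

lemma dense_family_uniform:
  assumes D: "dense_family D" and i: "i \<in> W" and j: "j \<in> W" and uv: "bin u" "bin v" and n: "n \<in> W" "El j \<subseteq> El n"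
  shows "\<exists>u' v'. \<exists>n'\<in>W. bin u' \<and> bin v' \<and> El n \<subseteq> El n' \<and> agree n u u' \<and> agree n v v' \<and>
    (\<forall>x y. bin x \<longrightarrow> bin y \<longrightarrow> (\<forall>k\<in>El n'. k \<notin> El j \<longrightarrow> x \<cdot> k = u' \<cdot> k \<and> y \<cdot> k = v' \<cdot> k) \<longrightarrow> D i x y n')"
proof -
  define P where "P j \<longleftrightarrow> (\<forall>u v. \<forall>n\<in>W. bin u \<longrightarrow> bin v \<longrightarrow> El j \<subseteq> El n \<longrightarrow>
    (\<exists>u' v'. \<exists>n'\<in>W. bin u' \<and> bin v' \<and> El n \<subseteq> El n' \<and> agree n u u' \<and> agree n v v' \<and>
    (\<forall>x y. bin x \<longrightarrow> bin y \<longrightarrow> (\<forall>k\<in>El n'. k \<notin> El j \<longrightarrow> x \<cdot> k = u' \<cdot> k \<and> y \<cdot> k = v' \<cdot> k) \<longrightarrow> D i x y n')))" for j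
  note d = dense_family_dfn[OF D] and cong = dense_family_cong[OF D] and mono = dense_family_mono[OF D _ _ order_refl]
    and dense = dense_family_dense[OF D i]
  have "dfn (\<lambda>e. P (e 0))" unfolding P_def by (intro dfn_intros dfn_subst4[OF d])
  from this j have "P j"
  proof (rule W_induct[where P = P])
    show "P zero" unfolding P_def
    proof (intro allI ballI impI)
      fix u v n assume n: "n \<in> W" and uv: "bin u" "bin v"
      obtain u' v' n' where 1: "n' \<in> W" "bin u'" "bin v'" "El n \<subseteq> El n'" "agree n u u'" "agree n v v'" "D i u' v' n'"
        using dense[OF n uv] by blast
      have "D i x y n'" if "\<forall>k\<in>El n'. k \<notin> El zero \<longrightarrow> x \<cdot> k = u' \<cdot> k \<and> y \<cdot> k = v' \<cdot> k" for x y
        by (rule cong[OF 1(1,7)]) (use that in \<open>auto simp: agree_def\<close>)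
      with 1 show "\<exists>u' v'. \<exists>n'\<in>W. bin u' \<and> bin v' \<and> El n \<subseteq> El n' \<and> agree n u u' \<and> agree n v v' \<and>
        (\<forall>x y. bin x \<longrightarrow> bin y \<longrightarrow> (\<forall>k\<in>El n'. k \<notin> El zero \<longrightarrow> x \<cdot> k = u' \<cdot> k \<and> y \<cdot> k = v' \<cdot> k) \<longrightarrow> D i x y n')"
        by blast
    qed
  next
    fix j assume j: "j \<in> W" and IH: "P j"
    \<comment> \<open>(u, v) with bound n already works for those x, y whose digits at
      \<open>j\<close> form a pair in \<open>L\<close>. This set grows from empty to all four
      pairs.\<close>
    define H where "H L u v n \<longleftrightarrow> bin u \<and> bin v \<and> n \<in> W \<and> El (suc j) \<subseteq> El n \<and> (\<forall>x y. bin x \<longrightarrow> bin y \<longrightarrow>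
      (\<forall>k\<in>El n. k \<notin> El (suc j) \<longrightarrow> x \<cdot> k = u \<cdot> k \<and> y \<cdot> k = v \<cdot> k) \<longrightarrow> (x \<cdot> j, y \<cdot> j) \<in> L \<longrightarrow> D i x y n)" for L u v n
    have step: "\<exists>u' v' n'. H (insert (a, b) L) u' v' n' \<and> El n \<subseteq> El n' \<and> agree n u u' \<and> agree n v v'"
      if H: "H L u v n" and ab: "a \<in> El two" "b \<in> El two" for L u v n a b
    proof -
      have 0: "bin u" "bin v" "n \<in> W" "El (suc j) \<subseteq> El n" using H unfolding H_def by blast+
      \<comment> \<open>The induction hypothesis also prescribes x and y at position
        \<open>j\<close>. The digits there are therefore set to \<open>a\<close> and
        \<open>b\<close>, and restored afterwards so that the result still extends (u, v).\<close>
      note u1 = upd[OF 0(1) ab(1), where j = j] and v1 = upd[OF 0(2) ab(2), where j = j]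
      obtain u' v' n' where 1: "n' \<in> W" "bin u'" "bin v'" "El n \<subseteq> El n'" "agree n (upd u j a) u'" "agree n (upd v j b) v'"
        and *: "\<And>x y. bin x \<Longrightarrow> bin y \<Longrightarrow> (\<forall>k\<in>El n'. k \<notin> El j \<longrightarrow> x \<cdot> k = u' \<cdot> k \<and> y \<cdot> k = v' \<cdot> k) \<Longrightarrow> D i x y n'"
        using IH[unfolded P_def, rule_format, OF 0(3) u1(1) v1(1)] 0(4) by auto
      have ujt: "u \<cdot> j \<in> El two" "v \<cdot> j \<in> El two" using fn_app 0 j by blast+
      note u2 = upd[OF 1(2) ujt(1), where j = j] and v2 = upd[OF 1(3) ujt(2), where j = j]
      have jn: "j \<in> El n" using 0(4) by simp
      have u'j: "u' \<cdot> j = a" "v' \<cdot> j = b" using 1(5,6) jn u1(2)[OF j] v1(2)[OF j] by (simp_all add: agree_def)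
      have agree: "agree n u (upd u' j (u \<cdot> j))" "agree n v (upd v' j (v \<cdot> j))"
        unfolding agree_def
      proof safe
        fix k assume k: "k \<in> El n"
        then have "k \<in> W" using W_El 0(3) by blast
        with 1(5,6) k u1(2)[of k] u2(2)[of k] v1(2)[of k] v2(2)[of k]
        show "u \<cdot> k = upd u' j (u \<cdot> j) \<cdot> k" "v \<cdot> k = upd v' j (v \<cdot> j) \<cdot> k"
          by (auto simp: agree_def split: if_splits)
      qed
      have "D i x y n'" if xy: "bin x" "bin y" and eq: "\<forall>k\<in>El n'. k \<notin> El (suc j) \<longrightarrow>
          x \<cdot> k = upd u' j (u \<cdot> j) \<cdot> k \<and> y \<cdot> k = upd v' j (v \<cdot> j) \<cdot> k"
        and L: "(x \<cdot> j, y \<cdot> j) \<in> insert (a, b) L" for x y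
      proof (cases "(x \<cdot> j, y \<cdot> j) = (a, b)")
        case True
        show ?thesis
        proof (rule *[OF xy], intro ballI impI)
          fix k assume k: "k \<in> El n'" "k \<notin> El j"
          have "k \<in> W" using W_El 1(1) k by blast
          then show "x \<cdot> k = u' \<cdot> k \<and> y \<cdot> k = v' \<cdot> k"
            using eq k True u'j u2(2) v2(2) by (cases "k = j") auto
        qed
      next
        case False
        have "\<forall>k\<in>El n. k \<notin> El (suc j) \<longrightarrow> x \<cdot> k = u \<cdot> k \<and> y \<cdot> k = v \<cdot> k"
          using eq agree 1(4) unfolding agree_def by auto
        then have "D i x y n" using H False L xy unfolding H_def by blast
        then show ?thesis using mono 1(4) by blast
      qed
      then have "H (insert (a, b) L) (upd u' j (u \<cdot> j)) (upd v' j (v \<cdot> j)) n'"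
        unfolding H_def using u2(1) v2(1) 1(1,4) 0(4) by auto
      with agree 1(4) show ?thesis by blast
    qed
    show "P (suc j)" unfolding P_def
    proof (intro allI ballI impI)
      fix u v n assume n: "n \<in> W" and uv: "bin u" "bin v" and jn: "El (suc j) \<subseteq> El n"
      have t: "zero \<in> El two" "one \<in> El two" by simp_all
      have "H {} u v n" using n uv jn unfolding H_def by simp
      from step[OF this t(1) t(1)] obtain u1 v1 n1 where
        1: "H {(zero, zero)} u1 v1 n1" "El n \<subseteq> El n1" "agree n u u1" "agree n v v1" by blast
      from step[OF 1(1) t(1) t(2)] obtain u2 v2 n2 where
        2: "H {(zero, one), (zero, zero)} u2 v2 n2" "El n1 \<subseteq> El n2" "agree n1 u1 u2" "agree n1 v1 v2" by blast
      from step[OF 2(1) t(2) t(1)] obtain u3 v3 n3 where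
        3: "H {(one, zero), (zero, one), (zero, zero)} u3 v3 n3" "El n2 \<subseteq> El n3" "agree n2 u2 u3" "agree n2 v2 v3" by blast
      from step[OF 3(1) t(2) t(2)] obtain u4 v4 n4 where
        4: "H {(one, one), (one, zero), (zero, one), (zero, zero)} u4 v4 n4" "El n3 \<subseteq> El n4" "agree n3 u3 u4" "agree n3 v3 v4" by blast
      have le: "El n \<subseteq> El n2" "El n \<subseteq> El n3" "El n \<subseteq> El n4" using 1 2 3 4 by blast+
      have "agree n u u4" "agree n v v4"
        using 1(2-) 2(2-) 3(2-) 4(2-) le unfolding agree_def by (metis subsetD)+
      moreover have "D i x y n4" if "bin x" "bin y"
        "\<forall>k\<in>El n4. k \<notin> El (suc j) \<longrightarrow> x \<cdot> k = u4 \<cdot> k \<and> y \<cdot> k = v4 \<cdot> k" for x y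
        using 4(1) that bin_cases[OF that(1) j] bin_cases[OF that(2) j] unfolding H_def by auto
      ultimately show "\<exists>u' v'. \<exists>n'\<in>W. bin u' \<and> bin v' \<and> El n \<subseteq> El n' \<and> agree n u u' \<and> agree n v v' \<and>
        (\<forall>x y. bin x \<longrightarrow> bin y \<longrightarrow> (\<forall>k\<in>El n'. k \<notin> El (suc j) \<longrightarrow> x \<cdot> k = u' \<cdot> k \<and> y \<cdot> k = v' \<cdot> k) \<longrightarrow> D i x y n')"
        using 4(1) le(3) unfolding H_def by blast
    qed
  qed
  then show ?thesis using uv n unfolding P_def by blast
qed

end

section \<open>The reduction built from blocks\<close>

context coded
begin

lemma fusion:
  assumes D0: "dense_family D0"
  obtains p where "tdef (\<lambda>e. p (e 0))" "\<And>x. bin x \<Longrightarrow> bin (p x)"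
    "\<And>x y. bin x \<Longrightarrow> bin y \<Longrightarrow> E0 mem w (p x) (p y) \<longleftrightarrow> E0 mem w x y"
    "\<And>x y i. bin x \<Longrightarrow> bin y \<Longrightarrow> \<not> E0 mem w x y \<Longrightarrow> i \<in> W \<Longrightarrow> \<exists>n\<in>W. D0 i (p x) (p y) n"
proof -
  \<comment> \<open>Where x and y differ, either of them may carry the first word of the block, so
    both orders have to be forced.\<close>
  define D where "D i x y n \<longleftrightarrow> D0 i x y n \<and> D0 i y x n" for i x y n
  have D: "dense_family D" using dense_family_conj[OF D0 dense_family_swap[OF D0]] unfolding D_def .
  note d = dense_family_dfn[OF D]
  \<comment> \<open>the code \<open>a\<close> provides the two words of a block that occupies the positions from \<open>m\<close> up to \<open>a\<close>\<close>
  define ok where "ok m a \<longleftrightarrow> m \<in> El a \<and> cx \<cdot> a \<cdot> m \<noteq> cy \<cdot> a \<cdot> m \<and>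
    (\<forall>x y. bin x \<longrightarrow> bin y \<longrightarrow> (\<forall>k\<in>El a. k \<notin> El m \<longrightarrow> x \<cdot> k = cx \<cdot> a \<cdot> k \<and> y \<cdot> k = cy \<cdot> a \<cdot> k) \<longrightarrow> D m x y a)" for m a
  have dfn_ok: "dfn (\<lambda>e. ok (s e) (t e))" if "tdef s" "tdef t" for s t
    by (rule dfn_subst2[OF _ that], unfold ok_def, intro dfn_intros dfn_subst4[OF d])
  have ex_ok: "\<exists>a\<in>W. ok m a" if m: "m \<in> W" for m
  proof -
    \<comment> \<open>Opposite constant sequences, kept up to and including position
      \<open>m\<close>, make the two words differ at the start of the block.\<close>
    define u where "u = lam two (\<lambda>_. zero)"
    define v where "v = lam two (\<lambda>_. one)"
    have u: "bin u" "u \<cdot> m = zero" and v: "bin v" "v \<cdot> m = one"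
      unfolding u_def v_def using lam[OF tdef_const[of zero], of two] lam[OF tdef_const[of one], of two] m by auto
    have ms: "El m \<subseteq> El (suc m)" by auto
    obtain u' v' n where 1: "n \<in> W" "bin u'" "bin v'" "El (suc m) \<subseteq> El n" "agree (suc m) u u'" "agree (suc m) v v'"
      and *: "\<And>x y. bin x \<Longrightarrow> bin y \<Longrightarrow> (\<forall>k\<in>El n. k \<notin> El m \<longrightarrow> x \<cdot> k = u' \<cdot> k \<and> y \<cdot> k = v' \<cdot> k) \<Longrightarrow> D m x y n"
      using dense_family_uniform[OF D m m u(1) v(1) suc_W[OF m] ms] by blast
    obtain a where a: "a \<in> W" "n \<in> El a" "agree n (cx \<cdot> a) u'" "agree n (cy \<cdot> a) v'"
      using code_ex[OF 1(2,3,1)] by blast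
    have na: "El n \<subseteq> El a" using W_trans a by blast
    have mn: "m \<in> El n" using 1(4) by simp
    have "cx \<cdot> a \<cdot> m = zero" "cy \<cdot> a \<cdot> m = one"
      using 1(5,6) a(3,4) mn u(2) v(2) unfolding agree_def by auto
    moreover have "D m x y a" if "bin x" "bin y" "\<forall>k\<in>El a. k \<notin> El m \<longrightarrow> x \<cdot> k = cx \<cdot> a \<cdot> k \<and> y \<cdot> k = cy \<cdot> a \<cdot> k" for x y
    proof -
      have "D m x y n" by (rule *) (use that na a(3,4) in \<open>auto simp: agree_def\<close>)
      then show ?thesis by (rule dense_family_mono[OF D _ na order_refl])
    qed
    ultimately have "ok m a" unfolding ok_def using na mn by auto
    with a(1) show ?thesis by blast
  qed
  \<comment> \<open>The least code makes the construction of the blocks a definable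
    recursion.\<close>
  define nx where "nx m = the1 (\<lambda>a. a \<in> W \<and> ok m a \<and> (\<forall>b\<in>El a. \<not> ok m b))" for m
  have nx: "nx m \<in> W" "ok m (nx m)" if m: "m \<in> W" for m
  proof -
    obtain b where b: "b \<in> W" "ok m b" using ex_ok[OF m] by blast
    have "dfn (\<lambda>e. ok m (e 0))" by (intro dfn_ok dfn_intros)
    then obtain a where a: "a \<in> W" "ok m a" "\<forall>b\<in>El a. \<not> ok m b"
      using least[of "\<lambda>a. ok m a"] b by metis
    have "nx m = a" unfolding nx_def by (rule the1_eq) (use a W_linear in blast)+
    with a show "nx m \<in> W" "ok m (nx m)" by simp_all
  qed
  have "tdef (\<lambda>e. nx (e 0))" unfolding nx_def by (intro dfn_intros dfn_ok)
  then obtain g where g: "run g" "g \<cdot> zero = zero" "\<And>n. n \<in> W \<Longrightarrow> g \<cdot> suc n = nx (g \<cdot> n)"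
    using recursion[of nx zero w] nx(1) by (metis zero_W)
  have gW: "g \<cdot> j \<in> W" if "j \<in> W" for j using fn_app[OF g(1) that] .
  have ok_g: "ok (g \<cdot> j) (g \<cdot> suc j)" if "j \<in> W" for j using nx(2)[OF gW[OF that]] g(3)[OF that] by simp
  have g_less: "g \<cdot> j \<in> El (g \<cdot> suc j)" if "j \<in> W" for j using ok_g[OF that] unfolding ok_def by blast
  have g_ge: "El j \<subseteq> El (g \<cdot> j)" if "j \<in> W" for j
  proof -
    have "dfn (\<lambda>e. El (e 0) \<subseteq> El (g \<cdot> e 0))" by (intro dfn_intros)
    from this that show ?thesis
    proof (rule W_induct[where P = "\<lambda>j. El j \<subseteq> El (g \<cdot> j)"])
      fix j assume j: "j \<in> W" "El j \<subseteq> El (g \<cdot> j)"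
      have gj: "g \<cdot> suc j \<in> W" using gW j by simp
      have "j \<in> El (g \<cdot> suc j)"
        using not_in_iff[OF j(1) gj] g_less[OF j(1)] j(2) irrefl[of "g \<cdot> j"] by auto
      then show "El (suc j) \<subseteq> El (g \<cdot> suc j)" using W_trans[OF gj] by auto
    qed simp
  qed
  have g_mono: "El (g \<cdot> suc j) \<subseteq> El (g \<cdot> i)" if "i \<in> W" "j \<in> El i" for i j
  proof -
    have "dfn (\<lambda>e. \<forall>j\<in>El (e 0). El (g \<cdot> suc j) \<subseteq> El (g \<cdot> e 0))" by (intro dfn_intros)
    from this that(1) have "\<forall>j\<in>El i. El (g \<cdot> suc j) \<subseteq> El (g \<cdot> i)"
    proof (rule W_induct[where P = "\<lambda>i. \<forall>j\<in>El i. El (g \<cdot> suc j) \<subseteq> El (g \<cdot> i)"])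
      fix i assume i: "i \<in> W" "\<forall>j\<in>El i. El (g \<cdot> suc j) \<subseteq> El (g \<cdot> i)"
      then show "\<forall>j\<in>El (suc i). El (g \<cdot> suc j) \<subseteq> El (g \<cdot> suc i)"
        using W_trans[OF gW[OF suc_W[OF i(1)]] g_less[OF i(1)]] by auto
    qed simp
    with that show ?thesis by blast
  qed
  have block_unique: "i = j" if "i \<in> W" "j \<in> W" "k \<in> El (g \<cdot> suc i)" "k \<notin> El (g \<cdot> i)" "k \<in> El (g \<cdot> suc j)" "k \<notin> El (g \<cdot> j)" for i j k
    using W_linear[OF that(1,2)] g_mono[OF that(1), of j] g_mono[OF that(2), of i] that by blast
  define bl where "bl k = the1 (\<lambda>j. j \<in> W \<and> k \<in> El (g \<cdot> suc j) \<and> k \<notin> El (g \<cdot> j))" for k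
  have bl_eq: "bl k = j" if "j \<in> W" "k \<in> El (g \<cdot> suc j)" "k \<notin> El (g \<cdot> j)" for j k
    unfolding bl_def by (rule the1_eq) (use that block_unique in blast)+
  have bl: "bl k \<in> W" "k \<in> El (g \<cdot> suc (bl k))" "k \<notin> El (g \<cdot> bl k)" if k: "k \<in> W" for k
  proof -
    have "k \<in> El (g \<cdot> suc k)" using g_ge[OF suc_W[OF k]] by auto
    moreover have "dfn (\<lambda>e. k \<in> El (g \<cdot> suc (e 0)))" by (intro dfn_intros)
    ultimately obtain j where j: "j \<in> W" "k \<in> El (g \<cdot> suc j)" "\<And>i. i \<in> El j \<Longrightarrow> k \<notin> El (g \<cdot> suc i)"
      using least[of "\<lambda>j. k \<in> El (g \<cdot> suc j)"] k by metis
    have "k \<notin> El (g \<cdot> j)" using j(1)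
    proof (cases rule: W_cases)
      case 1
      then show ?thesis using g(2) by simp
    next
      case (2 i)
      then show ?thesis using j(3)[of i] by simp
    qed
    with bl_eq j show "bl k \<in> W" "k \<in> El (g \<cdot> suc (bl k))" "k \<notin> El (g \<cdot> bl k)" by auto
  qed
  define c where "c b = (if b = zero then cx else cy)" for b
  define q where "q x k = c (x \<cdot> bl k) \<cdot> (g \<cdot> suc (bl k)) \<cdot> k" for x k
  define p where "p x = lam two (q x)" for x
  have tdef_c: "tdef (\<lambda>e. c (s e))" if "tdef s" for s
    by (rule tdef_subst1[OF _ that], unfold c_def, intro dfn_intros)
  have tdef_q: "tdef (\<lambda>e. q x (e 0))" for x unfolding q_def bl_def by (intro dfn_intros tdef_c)
  have q2: "q x k \<in> El two" if "bin x" "k \<in> W" for x k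
    unfolding q_def c_def using fn_app[OF bin_c(1) that(2)] fn_app[OF bin_c(2) that(2)] gW bl(1)[OF that(2)] suc_W by simp
  have p: "bin (p x)" "k \<in> W \<Longrightarrow> p x \<cdot> k = q x k" if "bin x" for x k
    unfolding p_def using lam[OF tdef_q q2[OF that]] by blast+
  have p_block: "p x \<cdot> k = c (x \<cdot> j) \<cdot> (g \<cdot> suc j) \<cdot> k"
    if "bin x" "j \<in> W" "k \<in> El (g \<cdot> suc j)" "k \<notin> El (g \<cdot> j)" for x j k
  proof -
    have "k \<in> W" using W_El[OF gW that(3)] that(2) by simp
    then show ?thesis using p(2)[OF that(1)] bl_eq[OF that(2-)] by (simp add: q_def)
  qed
  have p_start: "p x \<cdot> (g \<cdot> j) = c (x \<cdot> j) \<cdot> (g \<cdot> suc j) \<cdot> (g \<cdot> j)" if "bin x" "j \<in> W" for x j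
    by (rule p_block) (use that g_less in auto)
  show thesis
  proof (rule that[of p])
    show "tdef (\<lambda>e. p (e 0))" unfolding p_def q_def bl_def by (intro dfn_intros tdef_c)
    fix x y assume xy: "bin x" "bin y"
    show "bin (p x)" by (rule p(1)[OF xy(1)])
    show "E0 mem w (p x) (p y) \<longleftrightarrow> E0 mem w x y"
      unfolding E0_iff[OF xy] E0_iff[OF p(1)[OF xy(1)] p(1)[OF xy(2)]]
    proof
      assume "\<exists>n\<in>W. \<forall>k\<in>W. n \<in> El k \<longrightarrow> p x \<cdot> k = p y \<cdot> k"
      then obtain n where n: "n \<in> W" "\<forall>k\<in>W. n \<in> El k \<longrightarrow> p x \<cdot> k = p y \<cdot> k" by blast
      have "x \<cdot> j = y \<cdot> j" if j: "j \<in> W" "n \<in> El j" for j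
      proof -
        \<comment> \<open>Block j starts no earlier than position j, hence beyond n, and its two
          words differ at its start.\<close>
        have "n \<in> El (g \<cdot> j)" using g_ge[OF j(1)] j(2) by blast
        then have "p x \<cdot> (g \<cdot> j) = p y \<cdot> (g \<cdot> j)" using n gW[OF j(1)] by blast
        then have "c (x \<cdot> j) \<cdot> (g \<cdot> suc j) \<cdot> (g \<cdot> j) = c (y \<cdot> j) \<cdot> (g \<cdot> suc j) \<cdot> (g \<cdot> j)"
          using p_start xy j(1) by simp
        then show ?thesis
          using ok_g[OF j(1)] bin_cases[OF xy(1) j(1)] bin_cases[OF xy(2) j(1)]
          unfolding ok_def c_def by auto
      qed
      then show "\<exists>n\<in>W. \<forall>k\<in>W. n \<in> El k \<longrightarrow> x \<cdot> k = y \<cdot> k" using n(1) by blast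
    next
      assume "\<exists>n\<in>W. \<forall>k\<in>W. n \<in> El k \<longrightarrow> x \<cdot> k = y \<cdot> k"
      then obtain n where n: "n \<in> W" "\<forall>k\<in>W. n \<in> El k \<longrightarrow> x \<cdot> k = y \<cdot> k" by blast
      have "p x \<cdot> k = p y \<cdot> k" if k: "k \<in> W" "g \<cdot> suc n \<in> El k" for k
      proof -
        have "\<not> El (g \<cdot> suc (bl k)) \<subseteq> El (g \<cdot> suc n)"
          using bl(2)[OF k(1)] k(2) asym by blast
        then have "n \<in> El (bl k)"
          using W_linear[OF n(1) bl(1)[OF k(1)]] g_mono[OF suc_W[OF n(1)], of "bl k"] by auto
        then have "x \<cdot> bl k = y \<cdot> bl k" using n(2) bl(1)[OF k(1)] by blast
        then show ?thesis using p(2) xy k(1) by (simp add: q_def)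
      qed
      then show "\<exists>n\<in>W. \<forall>k\<in>W. n \<in> El k \<longrightarrow> p x \<cdot> k = p y \<cdot> k"
        using gW[OF suc_W[OF n(1)]] by blast
    qed
    fix i assume ne: "\<not> E0 mem w x y" and i: "i \<in> W"
    \<comment> \<open>Inequivalent points differ beyond every i. Block j takes care of the dense set
      with index \<open>g \<cdot> j\<close> instead of j, which is enough since the sets decrease
      and j \<le> \<open>g \<cdot> j\<close>.\<close>
    obtain j where j: "j \<in> W" "i \<in> El j" "x \<cdot> j \<noteq> y \<cdot> j"
      using ne i unfolding E0_iff[OF xy] by blast
    have ok: "D (g \<cdot> j) x' y' (g \<cdot> suc j)" if "bin x'" "bin y'"
      "\<forall>k\<in>El (g \<cdot> suc j). k \<notin> El (g \<cdot> j) \<longrightarrow> x' \<cdot> k = cx \<cdot> (g \<cdot> suc j) \<cdot> k \<and> y' \<cdot> k = cy \<cdot> (g \<cdot> suc j) \<cdot> k" for x' y'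
      using ok_g[OF j(1)] that unfolding ok_def by blast
    consider "x \<cdot> j = zero" "y \<cdot> j = one" | "x \<cdot> j = one" "y \<cdot> j = zero"
      using bin_cases[OF xy(1) j(1)] bin_cases[OF xy(2) j(1)] j(3) by auto
    then have "D0 (g \<cdot> j) (p x) (p y) (g \<cdot> suc j)"
    proof cases
      case 1
      have "D (g \<cdot> j) (p x) (p y) (g \<cdot> suc j)"
        by (rule ok) (use p xy p_block j(1) 1 in \<open>auto simp: c_def\<close>)
      then show ?thesis unfolding D_def by blast
    next
      case 2
      have "D (g \<cdot> j) (p y) (p x) (g \<cdot> suc j)"
        by (rule ok) (use p xy p_block j(1) 2 in \<open>auto simp: c_def\<close>)
      then show ?thesis unfolding D_def by blast
    qed
    moreover have "El i \<subseteq> El (g \<cdot> j)" using g_ge[OF j(1)] W_trans[OF j(1,2)] by blast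
    ultimately have "D0 i (p x) (p y) (g \<cdot> suc j)" by (rule dense_family_mono[OF D0 _ order_refl])
    then show "\<exists>n\<in>W. D0 i (p x) (p y) n" using gW[OF suc_W[OF j(1)]] by blast
  qed
qed

end

context strategy
begin

lemma dense_family_reach: "dense_family reach"
proof (rule dense_familyI)
  show "dfn (\<lambda>e. reach (e 0) (e (Suc 0)) (e (Suc (Suc 0))) (e (Suc (Suc (Suc 0)))))"
    by (intro dfn_intros)
  show "reach i x' y' n" if "n \<in> W" "reach i x y n" "agree n x x'" "agree n y y'" for i x y n x' y'
    using reach_cong that by blast
  show "reach i' x y n'" if "reach i x y n" "El n \<subseteq> El n'" "El i' \<subseteq> El i" for i x y n i' n'
    using reach_mono that by blast
  show "\<exists>x' y'. \<exists>n'\<in>W. bin x' \<and> bin y' \<and> El n \<subseteq> El n' \<and> agree n x x' \<and> agree n y y' \<and> reach i x' y' n'"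
    if "i \<in> W" "n \<in> W" "bin x" "bin y" for i x y n
    using reach_dense[OF that(1,3,4,2)] by blast
qed

end

section \<open>The partition relation\<close>

context zf_omega
begin

lemma dfn_follows [dfn_intros]:
  "tdef s \<Longrightarrow> tdef \<sigma> \<Longrightarrow> tdef r \<Longrightarrow> dfn (\<lambda>e. follows mem (El (s e)) (\<sigma> e) (r e))"
  by (rule dfn_subst3, unfold follows_def, intro dfn_intros)

lemma E0_refl: "bin x \<Longrightarrow> E0 mem w x x"
  using E0_iff zero_W by blast

lemma E0_sym: "bin x \<Longrightarrow> bin y \<Longrightarrow> E0 mem w x y \<Longrightarrow> E0 mem w y x"
  using E0_iff by metis

lemma E0_trans:
  assumes "bin x" "bin y" "bin z" "E0 mem w x y" "E0 mem w y z"
  shows "E0 mem w x z"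
proof -
  obtain m where m: "m \<in> W" "\<forall>k\<in>W. m \<in> El k \<longrightarrow> x \<cdot> k = y \<cdot> k"
    using assms(4) unfolding E0_iff[OF assms(1,2)] by blast
  obtain n where n: "n \<in> W" "\<forall>k\<in>W. n \<in> El k \<longrightarrow> y \<cdot> k = z \<cdot> k"
    using assms(5) unfolding E0_iff[OF assms(2,3)] by blast
  obtain l where l: "l \<in> W" "El m \<subseteq> El l" "El n \<subseteq> El l" by (rule W_max[OF m(1) n(1)])
  have "x \<cdot> k = z \<cdot> k" if k: "k \<in> W" "l \<in> El k" for k
  proof -
    have "m \<in> El k" "n \<in> El k"
      using not_in_iff[OF m(1) k(1)] not_in_iff[OF n(1) k(1)] l k irrefl[of l] by auto
    with m n k show ?thesis by simp
  qed
  then show ?thesis unfolding E0_iff[OF assms(1,3)] using l(1) by blast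
qed

text \<open>The two constant sequences. They guarantee that the sets of inequivalent pairs
  considered later are nonempty.\<close>

lemma E0_const:
  obtains x y where "bin x" "bin y" "\<not> E0 mem w x y"
proof -
  define x where "x = lam two (\<lambda>_. zero)"
  define y where "y = lam two (\<lambda>_. one)"
  have x: "bin x" "\<And>k. k \<in> W \<Longrightarrow> x \<cdot> k = zero" and y: "bin y" "\<And>k. k \<in> W \<Longrightarrow> y \<cdot> k = one"
    unfolding x_def y_def using lam[OF tdef_const[of zero], of two] lam[OF tdef_const[of one], of two] by auto
  have "\<exists>k\<in>W. n \<in> El k \<and> x \<cdot> k \<noteq> y \<cdot> k" if "n \<in> W" for n
    using that x(2) y(2) by (intro bexI[of _ "suc n"]) auto
  then have "\<not> E0 mem w x y" unfolding E0_iff[OF x(1) y(1)] by blast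
  with x(1) y(1) that show thesis by blast
qed

section \<open>Invariant and comeager sets of pairs\<close>

definition invariant :: "('v \<Rightarrow> 'v \<Rightarrow> bool) \<Rightarrow> bool" where
  "invariant B \<longleftrightarrow> (\<forall>x y x' y'. bin x \<longrightarrow> bin y \<longrightarrow> bin x' \<longrightarrow> bin y' \<longrightarrow>
     E0 mem w x x' \<longrightarrow> E0 mem w y y' \<longrightarrow> B x y \<longrightarrow> B x' y')"

definition comeager :: "('v \<Rightarrow> 'v \<Rightarrow> bool) \<Rightarrow> bool" where
  "comeager B \<longleftrightarrow> (\<exists>D. dense_family D \<and> (\<forall>x y. bin x \<longrightarrow> bin y \<longrightarrow> (\<forall>i\<in>W. \<exists>n\<in>W. D i x y n) \<longrightarrow> B x y))"

lemma comeager_conj: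
  assumes "comeager A" "comeager B"
  shows "comeager (\<lambda>x y. A x y \<and> B x y)"
proof -
  obtain D where D: "dense_family D" "\<And>x y. bin x \<Longrightarrow> bin y \<Longrightarrow> \<forall>i\<in>W. \<exists>n\<in>W. D i x y n \<Longrightarrow> A x y"
    using assms(1) unfolding comeager_def by blast
  obtain D' where D': "dense_family D'" "\<And>x y. bin x \<Longrightarrow> bin y \<Longrightarrow> \<forall>i\<in>W. \<exists>n\<in>W. D' i x y n \<Longrightarrow> B x y"
    using assms(2) unfolding comeager_def by blast
  show ?thesis
    unfolding comeager_def
  proof (intro exI conjI allI impI)
    show "dense_family (\<lambda>i x y n. D i x y n \<and> D' i x y n)" by (rule dense_family_conj[OF D(1) D'(1)])
  qed (use D(2) D'(2) in blast)+
qed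

end

context strategy
begin

text \<open>The outcome and the pair differ only below \<open>n0\<close>, so they have the same
  classes.\<close>

lemma reach_outcome:
  assumes xy: "bin x" "bin y" and D: "\<forall>i\<in>W. \<exists>n\<in>W. reach i x y n"
  obtains r x' y' where "run r" "follows mem (El T) \<tau> r" "bin x'" "bin y'" "decodes r x' y'"
    "E0 mem w x x'" "E0 mem w y y'"
proof (rule reach_limit[OF xy bspec[OF D]])
  fix r x' y'
  assume *: "run r" "follows mem (El T) \<tau> r" "bin x'" "bin y'" "decodes r x' y'"
    and eq: "\<And>k. k \<in> W \<Longrightarrow> k \<notin> El n0 \<Longrightarrow> x' \<cdot> k = x \<cdot> k \<and> y' \<cdot> k = y \<cdot> k"
  have "E0 mem w x x'" "E0 mem w y y'"
    unfolding E0_iff[OF xy(1) *(3)] E0_iff[OF xy(2) *(4)] using eq i0(5) asym by metis+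
  with * that show thesis by blast
qed

end

section \<open>From winning strategies to comeager sets\<close>

context coded
begin

text \<open>A run that leaves some position unfixed has no outcome and counts as lost for I. This is
  harmless, since the greedy opponent always covers all positions.\<close>

definition wins :: "('v \<Rightarrow> 'v \<Rightarrow> bool) \<Rightarrow> 'v \<Rightarrow> bool" where
  "wins B r \<longleftrightarrow> (\<exists>x y. bin x \<and> bin y \<and> decodes r x y \<and> B x y)"

lemma wins_iff: "bin x \<Longrightarrow> bin y \<Longrightarrow> decodes r x y \<Longrightarrow> wins B r \<longleftrightarrow> B x y"
  unfolding wins_def using decodes_unique by metis

lemma comeager_I:
  assumes S: "is_evens mem w S" and Dq: "is_finseqs mem w Dq" and \<sigma>: "fn \<sigma> Dq w"
    and win: "\<And>r. run r \<Longrightarrow> follows mem (El S) \<sigma> r \<Longrightarrow> wins B r" and B: "invariant B"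
  shows "comeager B"
proof -
  have S': "El S \<subseteq> W" "zero \<in> El S" "\<And>n. n \<in> W \<Longrightarrow> suc n \<in> El S \<longleftrightarrow> n \<notin> El S"
    using S unfolding is_evens_def is_empty_iff is_succ_iff by auto
  \<comment> \<open>Any run will do: its restriction to \<open>zero\<close> is the empty sequence,
    and \<open>v\<close> is the answer of \<sigma> to it. This opening move also becomes the bound
    \<open>n0\<close>.\<close>
  define z where "z = lam w (\<lambda>_. zero)"
  have z: "run z" unfolding z_def using lam[OF tdef_const[of zero], of w] by auto
  define v where "v = \<sigma> \<cdot> restr z zero"
  have v: "v \<in> W" unfolding v_def
    using fn_app[OF \<sigma>] fn_restr[OF z zero_W] Dq zero_W unfolding is_finseqs_def by blast
  define r0 where "r0 = lam w (\<lambda>_. v)"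
  have r0: "run r0" "\<And>k. k \<in> W \<Longrightarrow> r0 \<cdot> k = v"
    unfolding r0_def using lam[OF tdef_const[of v], of w] v by auto
  have "restr r0 zero = restr z zero" by (rule restr_cong[OF r0(1) z]) simp_all
  \<comment> \<open>I moves at even turns, so the opponent's first turn is
    \<open>one\<close>.\<close>
  then interpret strategy mem w cx cy S \<sigma> Dq v one r0
    by unfold_locales (use Dq \<sigma> S' r0 v in \<open>auto simp: v_def\<close>)
  show ?thesis
    unfolding comeager_def
  proof (intro exI[of _ reach] conjI allI impI dense_family_reach)
    fix x y assume xy: "bin x" "bin y" and D: "\<forall>i\<in>W. \<exists>n\<in>W. reach i x y n"
    obtain r x' y' where r: "run r" "follows mem (El S) \<sigma> r" "bin x'" "bin y'" "decodes r x' y'"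
      "E0 mem w x x'" "E0 mem w y y'"
      by (rule reach_outcome[OF xy D])
    have "B x' y'" using win[OF r(1,2)] wins_iff[OF r(3-5)] by blast
    then show "B x y" using B E0_sym xy r unfolding invariant_def by blast
  qed
qed

lemma comeager_II:
  assumes S: "is_evens mem w S" and Dq: "is_finseqs mem w Dq" and \<tau>: "fn \<tau> Dq w"
    and win: "\<And>r. run r \<Longrightarrow> follows mem (W - El S) \<tau> r \<Longrightarrow> \<not> wins B r" and B: "invariant B"
  shows "comeager (\<lambda>x y. \<not> B x y)"
proof -
  have S': "El S \<subseteq> W" "zero \<in> El S" "\<And>n. n \<in> W \<Longrightarrow> suc n \<in> El S \<longleftrightarrow> n \<notin> El S"
    using S unfolding is_evens_def is_empty_iff is_succ_iff by auto
  have "dfn (\<lambda>e. e 0 \<notin> El S)" by (intro dfn_intros)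
  then obtain T where "El T = {n \<in> W. n \<notin> El S}" by (rule separation)
  then have T_eq: "El T = W - El S" by blast
  define z where "z = lam w (\<lambda>_. zero)"
  have z: "run z" unfolding z_def using lam[OF tdef_const[of zero], of w] by auto
  \<comment> \<open>The opponent of II moves at turn \<open>zero\<close>; the opening is empty and
    no position is ignored.\<close>
  interpret strategy mem w cx cy T \<tau> Dq zero zero z
    by unfold_locales (use Dq \<tau> T_eq S' z in auto)
  show ?thesis
    unfolding comeager_def
  proof (intro exI[of _ reach] conjI allI impI dense_family_reach)
    fix x y assume xy: "bin x" "bin y" and D: "\<forall>i\<in>W. \<exists>n\<in>W. reach i x y n"
    obtain r x' y' where r: "run r" "follows mem (El T) \<tau> r" "bin x'" "bin y'" "decodes r x' y'"
      "E0 mem w x x'" "E0 mem w y y'"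
      by (rule reach_outcome[OF xy D])
    have "\<not> B x' y'" using win[OF r(1)] r(2) wins_iff[OF r(3-5)] T_eq by metis
    then show "\<not> B x y" using B xy r unfolding invariant_def by blast
  qed
qed

lemma comeager_reduction:
  assumes "comeager B"
  obtains p where "tdef (\<lambda>e. p (e 0))" "\<And>x. bin x \<Longrightarrow> bin (p x)"
    "\<And>x y. bin x \<Longrightarrow> bin y \<Longrightarrow> E0 mem w (p x) (p y) \<longleftrightarrow> E0 mem w x y"
    "\<And>x y. bin x \<Longrightarrow> bin y \<Longrightarrow> \<not> E0 mem w x y \<Longrightarrow> B (p x) (p y)"
proof -
  obtain D where D: "dense_family D" "\<And>x y. bin x \<Longrightarrow> bin y \<Longrightarrow> \<forall>i\<in>W. \<exists>n\<in>W. D i x y n \<Longrightarrow> B x y"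
    using assms unfolding comeager_def by blast
  show thesis
  proof (rule fusion[OF D(1)])
    fix p assume p: "tdef (\<lambda>e. p (e 0))" "\<And>x. bin x \<Longrightarrow> bin (p x)"
      "\<And>x y. bin x \<Longrightarrow> bin y \<Longrightarrow> E0 mem w (p x) (p y) \<longleftrightarrow> E0 mem w x y"
      "\<And>x y i. bin x \<Longrightarrow> bin y \<Longrightarrow> \<not> E0 mem w x y \<Longrightarrow> i \<in> W \<Longrightarrow> \<exists>n\<in>W. D i (p x) (p y) n"
    have "B (p x) (p y)" if "bin x" "bin y" "\<not> E0 mem w x y" for x y
      using D(2)[OF p(2)[OF that(1)] p(2)[OF that(2)]] p(4)[OF that] by blast
    with p(1-3) show thesis by (rule that)
  qed
qed

text \<open>A Baire category theorem: apply the reduction to two inequivalent points. As the pair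
  found is inequivalent, neither E0 nor any set of pairs inside it is comeager.\<close>

lemma comeager_meets:
  assumes "comeager B"
  obtains x y where "bin x" "bin y" "\<not> E0 mem w x y" "B x y"
proof (rule comeager_reduction[OF assms])
  fix p assume p: "\<And>x. bin x \<Longrightarrow> bin (p x)"
    "\<And>x y. bin x \<Longrightarrow> bin y \<Longrightarrow> E0 mem w (p x) (p y) \<longleftrightarrow> E0 mem w x y"
    "\<And>x y. bin x \<Longrightarrow> bin y \<Longrightarrow> \<not> E0 mem w x y \<Longrightarrow> B (p x) (p y)"
  obtain x y where xy: "bin x" "bin y" "\<not> E0 mem w x y" by (rule E0_const)
  show thesis
    by (rule that[OF p(1)[OF xy(1)] p(1)[OF xy(2)] _ p(3)[OF xy]]) (use p(2)[OF xy(1,2)] xy(3) in blast)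
qed

lemma partition:
  assumes AD: "AD mem" and Q: "is_cantor_mod_E0 mem Q" and n: "n \<in> W"
  shows "partition_rel mem Q Q n"
  unfolding partition_rel_def
proof (intro allI impI, elim conjE)
  fix P f assume P: "is_distinct_pairs mem Q P" and f: "fn f P n"
  obtain S where S: "is_evens mem w S" by (rule evens)
  obtain Dq where Dq: "is_finseqs mem w Dq" by (rule finseqs)
  obtain N where N: "is_funspace mem w w N" by (rule funspace)
  obtain w' t C where "is_omega mem w'" "is_two mem t" "is_funspace mem w' t C"
    and Q1: "El Q = {c. \<exists>x\<in>El C. El c = {y \<in> El C. E0 mem w' x y}}"
    using Q unfolding is_cantor_mod_E0_def by blast
  \<comment> \<open>Both are the least inductive set.\<close>
  moreover from this have "w' = w" using omega unfolding is_omega_def by (intro ext) blast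
  ultimately have C: "x \<in> El C \<longleftrightarrow> bin x" and Q2: "El Q = {c. \<exists>x\<in>El C. El c = {y \<in> El C. E0 mem w x y}}" for x
    unfolding is_two_iff is_funspace_def by auto
  define cls where "cls x = the1 (\<lambda>c. El c = {y. y \<in> El C \<and> E0 mem w x y})" for x
  have cls: "El (cls x) = {y \<in> El C. E0 mem w x y}" for x
  proof -
    have "dfn (\<lambda>e. E0 mem w x (e 0))" by (intro dfn_intros)
    then obtain c where c: "El c = {y \<in> El C. E0 mem w x y}" by (rule separation)
    have "cls x = c" unfolding cls_def by (rule the1_eq) (use c in \<open>auto intro: ext\<close>)
    with c show ?thesis by simp
  qed
  have tdef_cls: "tdef (\<lambda>e. cls (s e))" if "tdef s" for s
    by (rule tdef_subst1[OF _ that], unfold cls_def, intro dfn_intros)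
  have cls_iff: "El c = {y. bin y \<and> E0 mem w x y} \<longleftrightarrow> c = cls x" for c x
    using ext[of c "cls x"] by (auto simp: cls C)
  have Q': "c \<in> El Q \<longleftrightarrow> (\<exists>x. bin x \<and> c = cls x)" for c
    unfolding Q2 mem_Collect_eq Bex_def C cls_iff ..
  have cls_eq: "cls x = cls y \<longleftrightarrow> E0 mem w x y" if xy: "bin x" "bin y" for x y
  proof
    assume "cls x = cls y"
    then have "El (cls x) = El (cls y)" by simp
    then show "E0 mem w x y" unfolding cls C using xy E0_refl[OF xy(2)] by auto
  next
    assume "E0 mem w x y"
    then show "cls x = cls y"
      by (intro ext) (use xy E0_trans E0_sym in \<open>unfold cls C, blast\<close>)
  qed
  have P': "pair (cls x) (cls y) \<in> El P" if "bin x" "bin y" "\<not> E0 mem w x y" for x y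
    using P that cls_eq Q' unfolding is_distinct_pairs_def is_pair_pair by auto
  \<comment> \<open>\<open>E0\<close> is included so that \<open>B n\<close> is everything, although \<open>f\<close> is only defined on distinct classes\<close>
  define B where "B k x y \<longleftrightarrow> E0 mem w x y \<or> f \<cdot> pair (cls x) (cls y) \<in> El k" for k x y
  have dfn_B: "dfn (\<lambda>e. B (k e) (x e) (y e))" if "tdef k" "tdef x" "tdef y" for k x y
    unfolding B_def by (intro dfn_intros tdef_cls that)
  have B: "invariant (B k)" for k
    unfolding invariant_def
  proof (intro allI impI)
    fix x y x' y' assume *: "bin x" "bin y" "bin x'" "bin y'" "E0 mem w x x'" "E0 mem w y y'" "B k x y"
    then have "cls x = cls x'" "cls y = cls y'" using cls_eq by simp_all
    then show "B k x' y'" using * cls_eq unfolding B_def by metis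
  qed
  \<comment> \<open>I has a winning strategy for \<open>B k\<close>. This ranges over strategies of
    the model only, so it is definable and a least k can be taken.\<close>
  define I where "I k \<longleftrightarrow> (\<exists>\<sigma>. fn \<sigma> Dq w \<and> (\<forall>r. run r \<longrightarrow> follows mem (El S) \<sigma> r \<longrightarrow> wins (B k) r))" for k
  have dfn_wins: "dfn (\<lambda>e. wins (B (k e)) (r e))" if "tdef k" "tdef r" for k r
    by (rule dfn_subst2[OF _ that], unfold wins_def, intro dfn_intros dfn_B)
  have dfn_I: "dfn (\<lambda>e. I (e 0))" unfolding I_def by (intro dfn_intros dfn_wins)
  have I: "comeager (B k)" if "I k" for k
    using that comeager_I[OF S Dq _ _ B] unfolding I_def by blast
  have II: "comeager (\<lambda>x y. \<not> B k x y)" if "\<not> I k" for k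
  proof -
    have "dfn (\<lambda>e. wins (B k) (e 0))" by (intro dfn_wins dfn_intros)
    then obtain A where A: "El A = {r \<in> El N. wins (B k) r}" by (rule separation)
    have N': "r \<in> El N \<longleftrightarrow> run r" for r using N by (simp add: is_funspace_def)
    have "(\<exists>\<sigma>. fn \<sigma> Dq w \<and> (\<forall>x\<in>El N. follows mem (El S) \<sigma> x \<longrightarrow> x \<in> El A)) \<or>
          (\<exists>\<tau>. fn \<tau> Dq w \<and> (\<forall>x\<in>El N. follows mem (W - El S) \<tau> x \<longrightarrow> x \<notin> El A))"
      using AD[unfolded AD_def, rule_format, of w S Dq N A] omega S Dq N A by blast
    moreover have "\<not> (\<exists>\<sigma>. fn \<sigma> Dq w \<and> (\<forall>x\<in>El N. follows mem (El S) \<sigma> x \<longrightarrow> x \<in> El A))"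
    proof
      assume "\<exists>\<sigma>. fn \<sigma> Dq w \<and> (\<forall>x\<in>El N. follows mem (El S) \<sigma> x \<longrightarrow> x \<in> El A)"
      then obtain \<sigma> where \<sigma>: "fn \<sigma> Dq w" "\<forall>x\<in>El N. follows mem (El S) \<sigma> x \<longrightarrow> x \<in> El A" by blast
      have "wins (B k) r" if "run r" "follows mem (El S) \<sigma> r" for r
        using \<sigma>(2) that by (simp add: A N')
      with \<sigma>(1) \<open>\<not> I k\<close> show False unfolding I_def by blast
    qed
    ultimately obtain \<tau> where \<tau>: "fn \<tau> Dq w" "\<forall>x\<in>El N. follows mem (W - El S) \<tau> x \<longrightarrow> x \<notin> El A"
      by blast
    have "\<not> wins (B k) r" if "run r" "follows mem (W - El S) \<tau> r" for r
      using \<tau>(2) that by (simp add: A N')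
    then show ?thesis by (rule comeager_II[OF S Dq \<tau>(1) _ B])
  qed
  \<comment> \<open>Otherwise some inequivalent pair would lie outside \<open>B n\<close>, although
    all colours are elements of n.\<close>
  have "I n"
  proof (rule ccontr)
    assume "\<not> I n"
    then obtain x y where xy: "bin x" "bin y" "\<not> E0 mem w x y" "\<not> B n x y"
      using comeager_meets[OF II] by metis
    then show False using fn_app[OF f P'] unfolding B_def by blast
  qed
  then obtain k where k: "k \<in> W" "I k" "\<And>j. j \<in> El k \<Longrightarrow> \<not> I j"
    using least[of I, OF dfn_I n] by blast
  \<comment> \<open>\<open>B zero\<close> is just E0, since \<open>zero\<close> has no
    elements.\<close>
  have "k \<noteq> zero"
  proof
    assume "k = zero"
    then obtain x y where "\<not> E0 mem w x y" "B zero x y"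
      using comeager_meets[OF I] k(2) by metis
    then show False unfolding B_def by simp
  qed
  then obtain c where c: "c \<in> W" "k = suc c" using k(1) by (blast elim: W_cases)
  have "comeager (\<lambda>x y. B (suc c) x y \<and> \<not> B c x y)"
    by (rule comeager_conj[OF I II]) (use k c in auto)
  then obtain p where p: "tdef (\<lambda>e. p (e 0))" "\<And>x. bin x \<Longrightarrow> bin (p x)"
    "\<And>x y. bin x \<Longrightarrow> bin y \<Longrightarrow> E0 mem w (p x) (p y) \<longleftrightarrow> E0 mem w x y"
    and pB: "\<And>x y. bin x \<Longrightarrow> bin y \<Longrightarrow> \<not> E0 mem w x y \<Longrightarrow> B (suc c) (p x) (p y) \<and> \<not> B c (p x) (p y)"
    by (rule comeager_reduction) blast
  have tdef_p: "tdef (\<lambda>e. p (s e))" if "tdef s" for s by (rule tdef_subst1[OF p(1) that])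
  \<comment> \<open>The only element of \<open>suc c\<close> that is not an element of
    \<open>c\<close> is \<open>c\<close> itself.\<close>
  have fp: "f \<cdot> pair (cls (p x)) (cls (p y)) = c" if "bin x" "bin y" "\<not> E0 mem w x y" for x y
    using pB[OF that] p(3)[OF that(1,2)] that(3) unfolding B_def by auto
  have pc: "cls (p x) = cls (p y) \<longleftrightarrow> cls x = cls y" if "bin x" "bin y" for x y
    using cls_eq p(2,3) that by simp
  have "dfn (\<lambda>e. \<exists>x. bin x \<and> e 0 = cls (p x))" by (intro dfn_intros tdef_cls tdef_p)
  then obtain Z where "El Z = {d \<in> El Q. \<exists>x. bin x \<and> d = cls (p x)}"
    by (rule separation[where P = "\<lambda>d. \<exists>x. bin x \<and> d = cls (p x)"])
  then have Z: "d \<in> El Z \<longleftrightarrow> (\<exists>x. bin x \<and> d = cls (p x))" for d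
    using Q' p(2) by blast
  obtain ZQ where ZQ: "El ZQ = {pair a b | a b. a \<in> El Z \<and> b \<in> El Q}" by (rule product)
  \<comment> \<open>The inverse of the map induced by \<open>p\<close> on classes. It is well
    defined and injective because \<open>p\<close> both preserves and reflects E0.\<close>
  have "dfn (\<lambda>e. \<exists>x. bin x \<and> e 0 = pair (cls (p x)) (cls x))" by (intro dfn_intros tdef_cls tdef_p)
  then obtain g where "El g = {q \<in> El ZQ. \<exists>x. bin x \<and> q = pair (cls (p x)) (cls x)}"
    by (rule separation[where P = "\<lambda>q. \<exists>x. bin x \<and> q = pair (cls (p x)) (cls x)"])
  then have g: "q \<in> El g \<longleftrightarrow> (\<exists>x. bin x \<and> q = pair (cls (p x)) (cls x))" for q
    using Z Q' ZQ by auto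
  have rel_g: "rel mem g a b \<longleftrightarrow> (\<exists>x. bin x \<and> a = cls (p x) \<and> b = cls x)" for a b
    unfolding rel_iff g by simp
  have "fn g Z Q"
    unfolding fn_iff
  proof (intro conjI ballI)
    show "\<exists>a\<in>El Z. \<exists>b\<in>El Q. q = pair a b" if "q \<in> El g" for q
      using that Z Q' unfolding g by blast
    show "\<exists>!b. rel mem g a b" if "a \<in> El Z" for a
      using that pc unfolding Z rel_g by metis
  qed
  moreover have "\<exists>!a. rel mem g a b" if "b \<in> El Q" for b
    using that pc unfolding Q' rel_g by metis
  ultimately have bij: "is_bij mem g Z Q" unfolding is_bij_def by blast
  obtain ZZ where ZZ: "El ZZ = {pair a b | a b. a \<in> El Z \<and> b \<in> El Z}" by (rule product)
  have "dfn (\<lambda>e. \<exists>x0\<in>El Z. \<exists>x1\<in>El Z. x0 \<noteq> x1 \<and> e 0 = pair x0 x1)" by (intro dfn_intros)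
  then obtain PZ where "El PZ = {q \<in> El ZZ. \<exists>x0\<in>El Z. \<exists>x1\<in>El Z. x0 \<noteq> x1 \<and> q = pair x0 x1}"
    by (rule separation[where P = "\<lambda>q. \<exists>x0\<in>El Z. \<exists>x1\<in>El Z. x0 \<noteq> x1 \<and> q = pair x0 x1"])
  then have PZ: "El PZ = {q. \<exists>x0\<in>El Z. \<exists>x1\<in>El Z. x0 \<noteq> x1 \<and> q = pair x0 x1}"
    unfolding ZZ by auto
  obtain J where J: "El J = {c, c}" by (rule pairing)
  have PZ': "q \<in> El PZ \<longleftrightarrow> (\<exists>x y. bin x \<and> bin y \<and> \<not> E0 mem w x y \<and> q = pair (cls (p x)) (cls (p y)))" for q
    unfolding PZ using Z cls_eq p(2,3) by (auto, metis+)
  have PZ_P: "q \<in> El P \<and> f \<cdot> q = c" if "q \<in> El PZ" for q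
    using that fp P' p(2,3) unfolding PZ' by metis
  \<comment> \<open>The colour must actually be attained for the image to be a singleton.\<close>
  obtain x y where "bin x" "bin y" "\<not> E0 mem w x y" by (rule E0_const)
  then have "\<exists>q. q \<in> El PZ" unfolding PZ' by blast
  then have "El J = {b. \<exists>a\<in>El PZ. rel mem f a b}"
    unfolding J using PZ_P fn_rel[OF f] by auto
  then have "is_image mem f PZ J" unfolding is_image_def .
  moreover have "is_distinct_pairs mem Z PZ" unfolding is_distinct_pairs_def is_pair_pair by (rule PZ)
  moreover have "El Z \<subseteq> El Q" using Z Q' p(2) by blast
  ultimately show "\<exists>Z. El Z \<subseteq> El Q \<and> (\<exists>g. is_bij mem g Z Q) \<and>
      (\<exists>PZ I c. is_distinct_pairs mem Z PZ \<and> is_image mem f PZ I \<and> El I = {c})"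
    using bij J by auto
qed

end

theorem theorem7p4:
  fixes mem :: "'v \<Rightarrow> 'v \<Rightarrow> bool"
  assumes "ZF mem" and "DC mem" and "AD mem"
  shows "\<forall>w Q. is_omega mem w \<and> is_cantor_mod_E0 mem Q \<longrightarrow>
           (\<forall>n \<in> elts mem w. partition_rel mem Q Q n)"
proof (intro allI impI ballI, elim conjE)
  fix w Q n assume w: "is_omega mem w" and Q: "is_cantor_mod_E0 mem Q" and n: "n \<in> elts mem w"
  interpret zf_omega mem w by unfold_locales (rule assms(1) w)+
  obtain a b where "\<And>e. e \<in> W \<Longrightarrow> bin (app a e)" "\<And>e. e \<in> W \<Longrightarrow> bin (app b e)"
    "\<And>x y n. bin x \<Longrightarrow> bin y \<Longrightarrow> n \<in> W \<Longrightarrow>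
      \<exists>e\<in>W. n \<in> El e \<and> (\<forall>k\<in>El n. app (app a e) k = app x k \<and> app (app b e) k = app y k)"
    by (rule enumeration) (rule that; assumption)
  then interpret coded mem w a b
    by unfold_locales (auto simp: agree_def ball_conj_distrib)
  show "partition_rel mem Q Q n" by (rule partition[OF assms(3) Q n])
qed

end
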